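(* Let $\alpha>-1$ and $p>1$ be real numbers such that $\alpha+1\leq p\leq \alpha+2$. Let $f\in \mathcal{D}^p_\alpha\cap \mathcal{A}(\mathbb{D})$ be an outer function such that $\mathcal{Z}(f)=\{1\}$. Then $f$ is cyclic in $\mathcal{D}^p_\alpha$.
   Context: $\mathbb{D}$ is the open unit disc in $\mathbb{C}$ and $\mathbb{T}=\partial\mathbb{D}$. For $p\geq 1$ and $\alpha>-1$, the Besov-Dirichlet space $\mathcal{D}^p_\alpha$ is the Banach space of holomorphic functions $f$ on $\mathbb{D}$ such that $\mathcal{D}_{\alpha,p}(f)=\int_{\mathbb{D}}|f'(z)|^p\,dA_\alpha(z)<\infty$, where $dA_\alpha(z)=(1+\alpha)(1-|z|^2)^\alpha\,dA(z)$ and $dA$ is the normalized Lebesgue area measure on $\mathbb{D}$; the norm is given by $\|f\|_{\mathcal{D}^p_\alpha}^p=|f(0)|^p+\mathcal{D}_{\alpha,p}(f)$. The disc algebra $\mathcal{A}(\mathbb{D})$ is the set of holomorphic functions on $\mathbb{D}$ that extend continuously to $\overline{\mathbb{D}}$. For $f\in\mathcal{A}(\mathbb{D})$, $\mathcal{Z}(f)=\{\zeta\in\mathbb{T}: f(\zeta)=0\}$ (a subset of the unit circle). For $f\in\mathcal{D}^p_\alpha$, $[f]_{\mathcal{D}^p_\alpha}$ denotes the smallest closed subspace of $\mathcal{D}^p_\alpha$ containing $f$ and invariant under the shift $S:h(z)\mapsto zh(z)$, i.e. the closed linear span of $\{z^nf: n\in\mathbb{N}\}$, $\mathbb{N}=\{0,1,2,\dots\}$.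 The function $f$ is cyclic in $\mathcal{D}^p_\alpha$ if $[f]_{\mathcal{D}^p_\alpha}=\mathcal{D}^p_\alpha$ (equivalently, polynomial multiples of $f$ are dense in $\mathcal{D}^p_\alpha$). A function $f\in H^1$ (Hardy space) is outer if $f(z)=\exp\left(\frac{1}{2\pi}\int_{\mathbb{T}}\frac{\zeta+z}{\zeta-z}\log\varphi(\zeta)\,|d\zeta|\right)$ for $|z|<1$, where $\varphi\geq 0$ is in $L^1(\mathbb{T})$ with $\log\varphi\in L^1(\mathbb{T})$. *)

theory Defs
  imports "HOL-Complex_Analysis.Complex_Analysis"
begin

text \<open>
  Functions on the disc are total functions \<^typ>\<open>complex \<Rightarrow> complex\<close> whose values off the
  open unit disc are irrelevant, except for members of the disc algebra, whose values on the unit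
  circle are those of the continuous extension. Two functions agreeing on the open disc have
  distance 0, and closed subspaces (below) are saturated under this identification.

  The measures are carried by the disc and the circle themselves (not by the whole plane), so that
  measurability of an integrand only concerns its values there.
\<close>

definition area_measure :: "complex measure" where
  "area_measure = scale_measure (ennreal (1 / pi)) (restrict_space lborel (ball 0 1))"

definition weighted_area_measure :: "real \<Rightarrow> complex measure" where
  "weighted_area_measure \<alpha> =
     density area_measure (\<lambda>z. ennreal ((1 + \<alpha>) * (1 - (norm z)\<^sup>2) powr \<alpha>))"

definition dirichlet_integral :: "real \<Rightarrow> real \<Rightarrow> (complex \<Rightarrow> complex) \<Rightarrow> ennreal" where
  "dirichlet_integral p \<alpha> f =
     (\<integral>\<^sup>+ z. ennreal (norm (deriv f z) powr p) \<partial>weighted_area_measure \<alpha>)"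

definition besov_dirichlet :: "real \<Rightarrow> real \<Rightarrow> (complex \<Rightarrow> complex) set" where
  "besov_dirichlet p \<alpha> =
     {f. f holomorphic_on ball 0 1 \<and> dirichlet_integral p \<alpha> f < \<infinity>}"

definition besov_dirichlet_norm :: "real \<Rightarrow> real \<Rightarrow> (complex \<Rightarrow> complex) \<Rightarrow> real" where
  "besov_dirichlet_norm p \<alpha> f =
     (norm (f 0) powr p + enn2real (dirichlet_integral p \<alpha> f)) powr (1 / p)"

definition disc_algebra :: "(complex \<Rightarrow> complex) set" where
  "disc_algebra = {f. f holomorphic_on ball 0 1 \<and> continuous_on (cball 0 1) f}"

definition circle_zeros :: "(complex \<Rightarrow> complex) \<Rightarrow> complex set" where
  "circle_zeros f = {\<zeta> \<in> sphere 0 1. f \<zeta> = 0}"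

definition closed_subspace :: "real \<Rightarrow> real \<Rightarrow> (complex \<Rightarrow> complex) set \<Rightarrow> bool" where
  "closed_subspace p \<alpha> M \<longleftrightarrow>
     M \<subseteq> besov_dirichlet p \<alpha> \<and>
     (\<lambda>z. 0) \<in> M \<and>
     (\<forall>g\<in>M. \<forall>h\<in>M. (\<lambda>z. g z + h z) \<in> M) \<and>
     (\<forall>c. \<forall>h\<in>M. (\<lambda>z. c * h z) \<in> M) \<and>
     (\<forall>h g. (\<forall>n::nat. h n \<in> M) \<and> g \<in> besov_dirichlet p \<alpha> \<and>
        (\<lambda>n. besov_dirichlet_norm p \<alpha> (\<lambda>z. h n z - g z)) \<longlonglongrightarrow> 0 \<longrightarrow> g \<in> M)"

definition shift :: "(complex \<Rightarrow> complex) \<Rightarrow> complex \<Rightarrow> complex" where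
  "shift h = (\<lambda>z. z * h z)"

definition generated_invariant_subspace ::
    "real \<Rightarrow> real \<Rightarrow> (complex \<Rightarrow> complex) \<Rightarrow> (complex \<Rightarrow> complex) set" where
  "generated_invariant_subspace p \<alpha> f =
     besov_dirichlet p \<alpha> \<inter> \<Inter> {M. closed_subspace p \<alpha> M \<and> shift ` M \<subseteq> M \<and> f \<in> M}"

definition cyclic :: "real \<Rightarrow> real \<Rightarrow> (complex \<Rightarrow> complex) \<Rightarrow> bool" where
  "cyclic p \<alpha> f \<longleftrightarrow> generated_invariant_subspace p \<alpha> f = besov_dirichlet p \<alpha>"

definition arc_length :: "complex measure" where
  "arc_length =
     distr (restrict_space lborel {0..<2 * pi}) (restrict_space borel (sphere 0 1)) cis"

definition hardy_H1 :: "(complex \<Rightarrow> complex) set" where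
  "hardy_H1 = {f. f holomorphic_on ball 0 1 \<and>
     (SUP r\<in>{0..<1}. ennreal (1 / (2 * pi)) *
        (\<integral>\<^sup>+ \<zeta>. ennreal (norm (f (complex_of_real r * \<zeta>))) \<partial>arc_length)) < \<infinity>}"

text \<open>
  Since \<^term>\<open>ln (0::real) = 0\<close>, integrability of \<open>ln \<circ> \<phi>\<close> does not by itself force \<open>\<phi>\<close> to be
  positive almost everywhere, as integrability of \<open>log \<phi>\<close> with \<open>log 0 = -\<infinity>\<close> does; hence the
  explicit almost-everywhere condition.
\<close>

definition outer :: "(complex \<Rightarrow> complex) \<Rightarrow> bool" where
  "outer f \<longleftrightarrow> f \<in> hardy_H1 \<and>
     (\<exists>\<phi>::complex \<Rightarrow> real.
        (\<forall>\<zeta>\<in>sphere 0 1. 0 \<le> \<phi> \<zeta>) \<and>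
        integrable arc_length \<phi> \<and>
        (AE \<zeta> in arc_length. 0 < \<phi> \<zeta>) \<and>
        integrable arc_length (\<lambda>\<zeta>. ln (\<phi> \<zeta>)) \<and>
        (\<forall>z\<in>ball 0 1. f z =
           exp (1 / (2 * complex_of_real pi) *
                (\<integral>\<zeta>. (\<zeta> + z) / (\<zeta> - z) * complex_of_real (ln (\<phi> \<zeta>)) \<partial>arc_length))))"

end

theory Submission
  imports Defs "HOL-Real_Asymp.Real_Asymp"
begin

text \<open>
  If \<open>f\<close> is not cyclic, a bounded functional \<open>L \<noteq> 0\<close> annihilates a closed shift-invariant subspace that
  contains \<open>f\<close>, and hence all products of \<open>f\<close> with bounded functions of the space. Where \<open>z - \<lambda>\<close> has an
  inverse \<open>g\<close> modulo such products, \<open>\<Phi>(\<lambda>) = L g\<close> does not depend on the choice of \<open>g\<close>, and this happens for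
  every \<open>\<lambda> \<noteq> 1\<close> because \<open>f\<close> has no other zero in the closed disc. So \<open>\<Phi>\<close> is holomorphic off \<open>1\<close> and vanishes
  at infinity, with \<open>\<bar>\<Phi>(\<lambda>)\<bar> \<lesssim> (\<bar>\<lambda>\<bar> - 1)\<^sup>-\<^sup>2\<close> outside the disc and
  \<open>\<bar>\<Phi>(\<lambda>)\<bar> \<lesssim> (1 - \<bar>\<lambda>\<bar>)\<^sup>-\<^sup>2 / \<bar>f(\<lambda>)\<bar>\<close> inside, where \<open>log \<bar>f(\<lambda>)\<bar> \<ge> - o(1 / (1 - \<bar>\<lambda>\<bar>))\<close> as \<open>f\<close> is outer.
  The substitution \<open>\<lambda> = 1 + 1/w\<close> gives an entire function that is a polynomial by a Phragmen-Lindelof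
  argument; \<open>\<bar>\<lambda>\<bar> = 1\<close> becomes the line \<open>Re w = - 1/2\<close>. Applying \<open>L\<close> to
  \<open>\<Sum>\<^sub>j\<^sub><\<^sub>J 2\<^sup>-\<^sup>j / (z - 1 - 2\<^sup>-\<^sup>j)\<close>, whose norm is \<open>O(J\<^bsup>1/p\<^esup>)\<close> when \<open>p \<le> \<alpha> + 2\<close>, shows that the polynomial is
  zero because \<open>p > 1\<close>. Then \<open>L\<close> annihilates all polynomials, which are dense.
\<close>

subsection \<open>Phragmen-Lindelof theorems\<close>

text \<open>When p \<le> \<alpha> + 2 the space contains unbounded functions and is not closed under
  products, so the ideal arithmetic behind \<Phi> takes place among its bounded members. Under
  \<lambda> = 1 + 1/w the reciprocal distance of \<lambda> to the circle becomes comparable to |w|^2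
  / |Re w + 1/2| for large w. The obstacle is that the bounds from both sides of the line Re w = -
  1/2 blow up on it; they are carried across by a local argument on squares centred on the line, at
  the price of knowing only order-two growth in the left half-plane. Order two is harmless in
  sectors of opening pi/4, and in the cone around the negative axis the bound is a constant times
  exp (\<epsilon> |w|) for every \<epsilon> > 0. That freedom is where outerness enters: the
  singular inner function exp (- (1 + z) / (1 - z)) has reciprocal exp (- 2 w - 1), of positive
  exponential type. The test functions have one pole per dyadic scale, so that a linear polynomial a
  w pairs with them to exactly J a, which outgrows their norm.\<close>

lemma maximum_modulus_compact:
  fixes f :: "complex \<Rightarrow> complex"
  assumes "compact S" "open U" "U \<subseteq> S" "f holomorphic_on S"
    and B: "\<And>z. z \<in> S - U \<Longrightarrow> norm (f z) \<le> B" and "\<xi> \<in> S"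
  shows "norm (f \<xi>) \<le> B"
proof (rule maximum_modulus_frontier[of f S])
  have "closure S = S"
    using assms(1) compact_imp_closed closure_closed by blast
  then show "continuous_on (closure S) f"
    using assms(4) holomorphic_on_imp_continuous_on by auto
  show "norm (f z) \<le> B" if "z \<in> frontier S" for z
  proof (rule B)
    have "U \<subseteq> interior S"
      using assms(2,3) by (simp add: interior_maximal)
    then show "z \<in> S - U"
      using that \<open>closure S = S\<close> by (auto simp: frontier_def)
  qed
  show "f holomorphic_on interior S"
    using assms(4) holomorphic_on_subset interior_subset by blast
qed (use assms compact_imp_bounded in auto)

text \<open>In the sector \<open>\<bar>Im v\<bar> \<le> Re v\<close> one has |v|^2 \<le> 2 (Re v)^2.
  Applied to 1 + i w and 1 - i w, this gives the damping of the corner multiplier below.\<close>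

lemma Re_inverse_ge:
  assumes "\<bar>Im v\<bar> \<le> Re v" "0 < Re v"
  shows "1 / (2 * Re v) \<le> Re (1 / v)"
proof -
  have "(Im v)\<^sup>2 \<le> (Re v)\<^sup>2"
    using assms by (simp add: abs_le_square_iff[symmetric])
  moreover have "(Re v)\<^sup>2 + (Im v)\<^sup>2 > 0"
    using assms by (simp add: add_pos_nonneg)
  ultimately have "1 / (2 * Re v) \<le> Re v / ((Re v)\<^sup>2 + (Im v)\<^sup>2)"
    using assms by (simp add: pos_divide_le_eq pos_le_divide_eq power2_eq_square)
  then show ?thesis
    by (simp add: Re_divide power2_eq_square)
qed

text \<open>The multiplier \<open>exp (- 2 A / (1 + \<i> \<xi>) - 2 A / (1 - \<i> \<xi>))\<close> compensates the blow-up at the two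
  corners of the square at which the vertical axis leaves it.\<close>

lemma bound_across_line_aux:
  fixes F :: "complex \<Rightarrow> complex"
  assumes F: "F holomorphic_on UNIV" and A: "A > 0"
    and bd: "\<And>w. \<bar>Re w\<bar> + \<bar>Im w\<bar> \<le> 1 \<Longrightarrow> Re w \<noteq> 0 \<Longrightarrow> norm (F w) \<le> exp (A / \<bar>Re w\<bar>)"
    and t: "\<bar>t\<bar> \<le> 1"
  shows "norm (F (of_real t)) \<le> exp (4 * A)"
proof -
  define Q where "Q = {w::complex. \<bar>Re w\<bar> + \<bar>Im w\<bar> \<le> 1}"
  have cont: "continuous_on X F" for X
    using F holomorphic_on_imp_continuous_on holomorphic_on_subset by blast
  have "closed Q"
    unfolding Q_def by (intro closed_Collect_le continuous_intros)
  moreover have "Q \<subseteq> cball 0 1"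
    unfolding Q_def using cmod_le order_trans by fastforce
  ultimately have cQ: "compact Q"
    using bounded_subset bounded_cball compact_eq_bounded_closed by blast
  then have "bounded (F ` Q)"
    using cont compact_continuous_image compact_imp_bounded by blast
  then obtain K where K: "K > 0" "\<And>w. w \<in> Q \<Longrightarrow> norm (F w) \<le> K"
    unfolding bounded_pos by auto
  \<comment> \<open>The corners are cut off at height 1 - d, with d so small that the multiplier
    absorbs the crude compactness bound: K \<le> exp K \<le> exp (A / d). The final bound then
    depends on A alone.\<close>
  define d where "d = min (1/2) (A / K)"
  have d: "0 < d" "d < 1" "d \<le> A / K"
    using A K by (auto simp: d_def)
  have "K \<le> exp K"
    using exp_ge_add_one_self[of K] by linarith
  also have "\<dots> \<le> exp (A / d)"
    using d K by (simp add: field_simps)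
  finally have Kd: "K * exp (- (A / d)) \<le> 1"
    by (simp add: exp_minus field_simps)
  define S where "S = {w \<in> Q. \<bar>Im w\<bar> \<le> 1 - d}"
  define U where "U = {w::complex. \<bar>Re w\<bar> + \<bar>Im w\<bar> < 1 \<and> \<bar>Im w\<bar> < 1 - d}"
  define G where "G = (\<lambda>w. F w * exp (- (2 * A) / (1 + \<i> * w) - 2 * A / (1 - \<i> * w)))"
  have S_eq: "S = Q \<inter> {w. \<bar>Im w\<bar> \<le> 1 - d}"
    by (auto simp: S_def)
  have cS: "compact S"
    unfolding S_eq by (intro compact_Int_closed cQ closed_Collect_le continuous_intros)
  have pos: "\<bar>Im (1 + \<i> * w)\<bar> \<le> Re (1 + \<i> * w) \<and> 0 < Re (1 + \<i> * w) \<and>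
             \<bar>Im (1 - \<i> * w)\<bar> \<le> Re (1 - \<i> * w) \<and> 0 < Re (1 - \<i> * w)" if "w \<in> S" for w
    using that d by (auto simp: S_def Q_def)
  have nz: "1 + \<i> * w \<noteq> 0" "1 - \<i> * w \<noteq> 0" if "w \<in> S" for w
    using pos[OF that] by (metis less_irrefl zero_complex.sel(1))+
  have normG: "norm (G w) = norm (F w) * exp (- (2 * A * Re (1 / (1 + \<i> * w))) - 2 * A * Re (1 / (1 - \<i> * w)))" for w
    by (simp add: G_def norm_mult Re_divide)
  have GB: "norm (G w) \<le> 1" if w: "w \<in> S - U" for w
  proof -
    have wS: "w \<in> S" using w by auto
    define r1 where "r1 = Re (1 / (1 + \<i> * w))"
    define r2 where "r2 = Re (1 / (1 - \<i> * w))"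
    have r1: "1 / (2 * (1 - Im w)) \<le> r1" and r2: "1 / (2 * (1 + Im w)) \<le> r2"
      using Re_inverse_ge[of "1 + \<i> * w"] Re_inverse_ge[of "1 - \<i> * w"] pos[OF wS]
      by (auto simp: r1_def r2_def)
    have im: "\<bar>Im w\<bar> < 1"
      using wS d by (auto simp: S_def)
    have r0: "r1 \<ge> 0" "r2 \<ge> 0"
      using r1 r2 im by (auto intro: order_trans[rotated])
    \<comment> \<open>The nearer corner alone provides the damping; the term of the other one has
      the favourable sign.\<close>
    have rm: "1 / (2 * (1 - \<bar>Im w\<bar>)) \<le> r1 + r2"
      using r1 r2 r0 im by (cases "Im w \<ge> 0") auto
    then have "2 * A * (1 / (2 * (1 - \<bar>Im w\<bar>))) \<le> 2 * A * (r1 + r2)"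
      using A by (intro mult_left_mono) auto
    then have "A / (1 - \<bar>Im w\<bar>) \<le> 2 * A * (r1 + r2)"
      by (simp only: mult_divide_mult_cancel_left_if times_divide_eq_right mult_1_right) auto
    then have ex: "exp (- (2 * A * r1) - 2 * A * r2) \<le> exp (- (A / (1 - \<bar>Im w\<bar>)))"
      by (simp add: algebra_simps)
    have "norm (F w) * exp (- (A / (1 - \<bar>Im w\<bar>))) \<le> 1"
    proof (cases "\<bar>Re w\<bar> + \<bar>Im w\<bar> < 1")
      case True
      then have "\<bar>Im w\<bar> = 1 - d"
        using w by (auto simp: U_def S_def)
      then have "norm (F w) * exp (- (A / (1 - \<bar>Im w\<bar>))) \<le> K * exp (- (A / d))"
        using K wS by (auto simp: S_def)
      then show ?thesis using Kd by linarith
    next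
      case False
      \<comment> \<open>On the slanted sides |Re w| equals 1 - |Im w|, so growth and damping cancel
        exactly. The cut keeps Re w away from 0 here.\<close>
      then have "\<bar>Re w\<bar> = 1 - \<bar>Im w\<bar>" and Q: "\<bar>Re w\<bar> + \<bar>Im w\<bar> \<le> 1"
        using wS by (auto simp: S_def Q_def)
      then have "norm (F w) \<le> exp (A / (1 - \<bar>Im w\<bar>))"
        using bd[OF Q] im by auto
      then show ?thesis
        by (simp add: exp_minus field_simps)
    qed
    moreover have "norm (G w) \<le> norm (F w) * exp (- (A / (1 - \<bar>Im w\<bar>)))"
      unfolding normG using ex by (auto simp: r1_def r2_def intro: mult_left_mono)
    ultimately show ?thesis by linarith
  qed
  have tS: "of_real t \<in> S"
    using t d by (auto simp: S_def Q_def)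
  have "norm (G (of_real t)) \<le> 1"
  proof (rule maximum_modulus_compact[OF cS _ _ _ GB tS])
    show "open U"
      unfolding U_def by (intro open_Collect_conj open_Collect_less continuous_intros)
    show "U \<subseteq> S"
      by (auto simp: U_def S_def Q_def)
    show "G holomorphic_on S"
      unfolding G_def using nz by (intro holomorphic_intros holomorphic_on_subset[OF F]) auto
  qed
  \<comment> \<open>On the real axis both real parts equal 1 / (1 + t^2), so undoing the multiplier
    costs at most exp (4 A).\<close>
  have r1: "Re (1 / (1 + \<i> * of_real t)) \<le> 1" "Re (1 / (1 - \<i> * of_real t)) \<le> 1"
    using divide_le_eq_1_pos[of "1 + t\<^sup>2" 1] by (auto simp: Re_divide add_pos_nonneg)
  then have "A * Re (1 / (1 + \<i> * of_real t)) \<le> A" "A * Re (1 / (1 - \<i> * of_real t)) \<le> A"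
    using A by (auto simp: mult_le_cancel_left2)
  then have "exp (- (4 * A)) \<le> exp (- (2 * A * Re (1 / (1 + \<i> * of_real t))) - 2 * A * Re (1 / (1 - \<i> * of_real t)))"
    by simp
  then have "norm (F (of_real t)) * exp (- (4 * A)) \<le> norm (G (of_real t))"
    unfolding normG by (intro mult_left_mono) auto
  with \<open>norm (G (of_real t)) \<le> 1\<close> have "norm (F (of_real t)) * exp (- (4 * A)) \<le> 1"
    by linarith
  then show ?thesis
    by (simp add: exp_minus field_simps)
qed

text \<open>The translate to a centre c, meant for c on a vertical line where the estimates from
  both sides degenerate: the horizontal diagonal of the square crosses the line, and the bound
  survives on it with only a factor 4 in the exponent.\<close>

lemma bound_across_line:
  fixes F :: "complex \<Rightarrow> complex"
  assumes F: "F holomorphic_on UNIV" and A: "A > 0"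
    and bd: "\<And>w. \<bar>Re (w - c)\<bar> + \<bar>Im (w - c)\<bar> \<le> 1 \<Longrightarrow> Re (w - c) \<noteq> 0 \<Longrightarrow>
               norm (F w) \<le> exp (A / \<bar>Re (w - c)\<bar>)"
    and t: "\<bar>t\<bar> \<le> 1"
  shows "norm (F (c + of_real t)) \<le> exp (4 * A)"
proof -
  have "(\<lambda>w. F (c + w)) holomorphic_on UNIV"
    by (rule holomorphic_on_compose_gen[of "\<lambda>w. c + w" _ F UNIV, unfolded o_def])
       (auto intro!: holomorphic_intros F)
  then show ?thesis
    using bound_across_line_aux[of "\<lambda>w. F (c + w)" A t] A t bd[of "c + _"] by auto
qed

text \<open>The sector arg w in [pi/2, 3 pi/4] has opening pi/4, for which order 4 is critical, so
  order-two growth is beaten by a multiplier of order 3. The argument of w^3 sweeps an interval of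
  length 3 pi/4, and the factor 2 + i rotates it to be roughly centred at 0, which makes the real
  part positive inside the sector.\<close>

lemma phragmen_lindelof_sector:
  fixes G :: "complex \<Rightarrow> complex"
  assumes G: "G holomorphic_on {w. Re w < 1}" and B: "B > 0"
    and gr: "\<And>w. Re w \<le> 0 \<Longrightarrow> norm (G w) \<le> exp (C * (1 + (norm w)\<^sup>2))"
    and im: "\<And>y. y \<ge> 0 \<Longrightarrow> norm (G (Complex 0 y)) \<le> B"
    and ray: "\<And>y. y \<ge> 0 \<Longrightarrow> norm (G (Complex (- y) y)) \<le> B"
    and w: "Re w \<le> 0" "- Re w \<le> Im w"
  shows "norm (G w) \<le> B"
proof -
  have key: "norm (G w) * exp (- (\<eta> * Re ((2 + \<i>) * w ^ 3))) \<le> B" if \<eta>: "\<eta> > 0" for \<eta>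
  proof -
    define H where "H = (\<lambda>w. G w * exp (- (\<eta> * ((2 + \<i>) * w ^ 3))))"
    have normH: "norm (H w) = norm (G w) * exp (- (\<eta> * Re ((2 + \<i>) * w ^ 3)))" for w
      by (simp add: H_def norm_mult)
    have Re3: "(Im w) ^ 3 \<le> Re ((2 + \<i>) * w ^ 3)" if "Re w \<le> 0" "- Re w \<le> Im w" for w
    proof -
      define a where "a = - Re w"
      define y where "y = Im w"
      have a: "0 \<le> a" "a \<le> y" using that by (auto simp: a_def y_def)
      have eq: "Re ((2 + \<i>) * w ^ 3) = 6 * a * y\<^sup>2 - 2 * a ^ 3 + y ^ 3 - 3 * a\<^sup>2 * y"
        by (simp add: a_def y_def power3_eq_cube power2_eq_square algebra_simps)
      have "a * a \<le> y * y" "a * y \<le> y * y"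
        using a by (auto intro: mult_mono)
      then have "a * (a * a) \<le> a * (y * y)" "a * (a * y) \<le> a * (y * y)"
        using a by (auto intro: mult_left_mono)
      moreover have "0 \<le> a * (y * y)" using a by auto
      ultimately show ?thesis
        unfolding eq y_def[symmetric] by (simp add: power3_eq_cube power2_eq_square algebra_simps)
    qed
    \<comment> \<open>R is the height at which the sector is truncated. On the top edge |v|^2 \<le>
      2 R^2, and the cubic damping wins against the quadratic growth there, with ln B producing the
      bound B.\<close>
    have "eventually (\<lambda>R. \<bar>C\<bar> * (1 + 2 * R\<^sup>2) \<le> \<eta> * R ^ 3 + ln B) at_top"
      using \<eta> by real_asymp
    then obtain R where R: "\<bar>C\<bar> * (1 + 2 * R\<^sup>2) \<le> \<eta> * R ^ 3 + ln B" "R > 0" "R \<ge> Im w"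
      using eventually_conj[OF _ eventually_conj[OF eventually_gt_at_top[of 0] eventually_ge_at_top[of "Im w"]]]
        eventually_happens[of _ "at_top :: real filter"] by fastforce
    define S where "S = {w. Re w \<le> 0 \<and> - Re w \<le> Im w \<and> Im w \<le> R}"
    define U where "U = {w. Re w < 0 \<and> - Re w < Im w \<and> Im w < R}"
    have "closed S"
      unfolding S_def by (intro closed_Collect_conj closed_Collect_le continuous_intros)
    moreover have "S \<subseteq> cball 0 (2 * R)"
      using cmod_le by (auto simp: S_def) (smt (verit) cmod_le)
    ultimately have cS: "compact S"
      using bounded_subset bounded_cball compact_eq_bounded_closed by blast
    have "norm (H w) \<le> B"
    proof (rule maximum_modulus_compact[OF cS, of U H])
      show "open U"
        unfolding U_def by (intro open_Collect_conj open_Collect_less continuous_intros)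
      show "U \<subseteq> S" by (auto simp: U_def S_def)
      have "S \<subseteq> {w. Re w < 1}" by (auto simp: S_def)
      then show "H holomorphic_on S"
        unfolding H_def by (intro holomorphic_intros holomorphic_on_subset[OF G])
      show "w \<in> S" using w R by (auto simp: S_def)
      fix v assume v: "v \<in> S - U"
      then have v': "Re v \<le> 0" "- Re v \<le> Im v" "Im v \<le> R" by (auto simp: S_def)
      then have y0: "Im v \<ge> 0" by linarith
      have ex: "exp (- (\<eta> * Re ((2 + \<i>) * v ^ 3))) \<le> exp (- (\<eta> * Im v ^ 3))"
        using Re3[OF v'(1,2)] \<eta> by (simp del: Re_power_real)
      have le: "norm (H v) \<le> norm (G v) * exp (- (\<eta> * Im v ^ 3))"
        unfolding normH using ex by (intro mult_left_mono) auto
      also have "\<dots> \<le> B"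
      proof (cases "Im v = R")
        case True
        have "(norm v)\<^sup>2 \<le> 2 * R\<^sup>2"
          using v' True abs_le_square_iff[of "Re v" R] by (simp add: cmod_power2)
        then have "C * (1 + (norm v)\<^sup>2) \<le> \<bar>C\<bar> * (1 + 2 * R\<^sup>2)"
          by (intro mult_mono) auto
        also have "\<dots> \<le> \<eta> * R ^ 3 + ln B" by fact
        finally have "norm (G v) \<le> exp (\<eta> * R ^ 3 + ln B)"
          using gr[OF v'(1)] by (meson exp_le_cancel_iff order_trans)
        also have "\<dots> = exp (\<eta> * R ^ 3) * B"
          using B by (simp add: exp_add)
        finally show ?thesis
          using True by (simp add: exp_minus field_simps)
      next
        case False
        then have "v = Complex 0 (Im v) \<or> v = Complex (- Im v) (Im v)"
          using v v' by (auto simp: U_def complex_eq_iff)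
        then have "norm (G v) \<le> B"
          using im[OF y0] ray[OF y0] by metis
        moreover have "exp (- (\<eta> * Im v ^ 3)) \<le> 1"
          using \<eta> y0 by simp
        ultimately show ?thesis
          by (smt (verit) mult_left_le norm_ge_zero)
      qed
      finally show "norm (H v) \<le> B" .
    qed
    then show ?thesis by (simp add: normH)
  qed
  \<comment> \<open>Since B does not depend on \<eta>, the damping can be removed at the fixed point
    w by letting \<eta> tend to 0.\<close>
  have "((\<lambda>\<eta>. norm (G w) * exp (- (\<eta> * Re ((2 + \<i>) * w ^ 3)))) \<longlongrightarrow>
        norm (G w) * exp (- (0 * Re ((2 + \<i>) * w ^ 3)))) (at_right 0)"
    by (intro tendsto_intros)
  moreover have "eventually (\<lambda>\<eta>. norm (G w) * exp (- (\<eta> * Re ((2 + \<i>) * w ^ 3))) \<le> B) (at_right 0)"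
    using key by (auto simp: eventually_at_filter)
  ultimately show ?thesis
    using tendsto_upperbound[of _ _ "at_right (0::real)" B] by fastforce
qed

text \<open>A power trick: dividing G^n by 1 - w makes large half circles harmless for a bounded G,
  at the price of a factor |1 - w| that does not depend on n and disappears on taking n-th
  roots.\<close>

lemma phragmen_lindelof_half_plane:
  fixes G :: "complex \<Rightarrow> complex"
  assumes G: "G holomorphic_on {w. Re w < 1}" and B: "B > 0"
    and gr: "\<And>w. Re w \<le> 0 \<Longrightarrow> norm (G w) \<le> K"
    and im: "\<And>w. Re w = 0 \<Longrightarrow> norm (G w) \<le> B"
    and w: "Re w \<le> 0"
  shows "norm (G w) \<le> B"
proof -
  have key: "norm (G w) ^ n \<le> B ^ n * norm (1 - w)" for n
  proof -
    define H where "H = (\<lambda>w. G w ^ n / (1 - w))"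
    \<comment> \<open>On the arc |v| = R one has |1 - v| \<ge> R \<ge> K^n / B^n, which turns the
      crude bound K^n into B^n.\<close>
    define R where "R = norm w + 1 + K ^ n / B ^ n"
    have K0: "K \<ge> 0" using order_trans[OF norm_ge_zero gr[of 0]] by simp
    then have "K ^ n / B ^ n \<ge> 0" using B by simp
    then have R: "R > 0" "norm w \<le> R" "K ^ n / B ^ n \<le> R"
      unfolding R_def using norm_ge_zero[of w] by linarith+
    have ge1: "1 \<le> norm (1 - v)" "norm v \<le> norm (1 - v)" if "Re v \<le> 0" for v
    proof -
      show "1 \<le> norm (1 - v)"
        using complex_Re_le_cmod[of "1 - v"] that by simp
      show "norm v \<le> norm (1 - v)"
        using that by (simp add: cmod_def power2_eq_square algebra_simps)
    qed
    define S where "S = {w. Re w \<le> 0} \<inter> cball 0 R"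
    define U where "U = {w. Re w < 0} \<inter> ball 0 R"
    have cS: "compact S"
      unfolding S_def Int_commute[of "{w. Re w \<le> 0}"]
      by (intro compact_Int_closed compact_cball closed_Collect_le continuous_intros)
    have "norm (H w) \<le> B ^ n"
    proof (rule maximum_modulus_compact[OF cS, of U H])
      show "open U"
        unfolding U_def by (intro open_Int open_ball open_Collect_less continuous_intros)
      show "U \<subseteq> S" by (auto simp: U_def S_def)
      have "S \<subseteq> {w. Re w < 1}" by (auto simp: S_def)
      moreover have "1 - v \<noteq> 0" if "v \<in> S" for v
        using that by (auto simp: S_def)
      ultimately show "H holomorphic_on S"
        unfolding H_def by (intro holomorphic_intros holomorphic_on_subset[OF G]) auto
      show "w \<in> S" using w R by (auto simp: S_def)
      fix v assume v: "v \<in> S - U"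
      then have v': "Re v \<le> 0" by (auto simp: S_def)
      show "norm (H v) \<le> B ^ n"
      proof (cases "Re v = 0")
        case True
        have "norm (G v) ^ n \<le> B ^ n * 1"
          using im[OF True] by (simp add: power_mono)
        also have "\<dots> \<le> B ^ n * norm (1 - v)"
          using ge1[OF v'] B by (intro mult_left_mono) auto
        finally show ?thesis
          using ge1[OF v'] B by (auto simp: H_def norm_divide norm_power divide_le_eq)
      next
        case False
        then have "norm v = R" using v by (auto simp: S_def U_def)
        then have "K ^ n / B ^ n \<le> norm (1 - v)"
          using R ge1[OF v'] by linarith
        then have "K ^ n \<le> B ^ n * norm (1 - v)"
          using B by (simp add: field_simps)
        moreover have "norm (G v) ^ n \<le> K ^ n"
          using gr[OF v'] by (simp add: power_mono)
        ultimately show ?thesis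
          using ge1[OF v'] B by (auto simp: H_def norm_divide norm_power divide_le_eq)
      qed
    qed
    moreover have "norm (1 - w) > 0" using ge1[OF w] by linarith
    ultimately show ?thesis
      by (simp add: H_def norm_divide norm_power pos_divide_le_eq)
  qed
  show ?thesis
  proof (rule ccontr)
    assume "\<not> ?thesis"
    then have "1 < norm (G w) / B" using B by simp
    then obtain n where "norm (1 - w) < (norm (G w) / B) ^ n"
      using real_arch_pow by blast
    then show False
      using key[of n] B by (simp add: power_divide field_simps)
  qed
qed

text \<open>After division by (1 - w)^4 and multiplication by exp (\<delta> w), the bound
  \<open>left\<close> makes the function bounded on the cone |Im w| \<le> - Re w. The two remaining
  sectors have opening pi/4 and fall to the order-two bound \<open>gr\<close>. The bound obtained so
  far depends on \<delta>, but the half-plane theorem improves it to the bound on the imaginary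
  axis, which does not; then \<delta> tends to 0.\<close>

lemma entire_quartic_growth:
  fixes F :: "complex \<Rightarrow> complex"
  assumes F: "F holomorphic_on UNIV"
    and right: "\<And>w. Re w \<ge> 0 \<Longrightarrow> norm (F w) \<le> M * (1 + norm w) ^ 4"
    and left: "\<And>\<epsilon>. \<epsilon> > 0 \<Longrightarrow> \<exists>C. \<forall>w. Re w \<le> -1 \<longrightarrow> norm (F w) \<le> exp (C + \<epsilon> * (norm w)\<^sup>2 / \<bar>Re w\<bar>)"
    and gr: "\<And>w. Re w \<le> 0 \<Longrightarrow> norm (F w) \<le> exp (C * (1 + (norm w)\<^sup>2))"
  shows "\<exists>K. \<forall>w. norm (F w) \<le> K * (1 + norm w) ^ 4"
proof -
  \<comment> \<open>The 4 comes from (1 + |w|)^4 \<le> 4 |1 - w|^4 on the imaginary axis; the 1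
    makes \<open>M'\<close> positive.\<close>
  define M' where "M' = 4 * \<bar>M\<bar> + 1"
  have M': "M' > 0" by (simp add: M'_def)
  have ge1: "1 \<le> norm (1 - v)" if "Re v \<le> 0" for v
    using complex_Re_le_cmod[of "1 - v"] that by simp
  have key: "norm (F w) \<le> M' * norm (1 - w) ^ 4 * exp (- (\<delta> * Re w))" if \<delta>: "\<delta> > 0" and w: "Re w \<le> 0" for \<delta> w
  proof -
    define G where "G = (\<lambda>w. F w / (1 - w) ^ 4 * exp (of_real \<delta> * w))"
    have normG: "norm (G w) = norm (F w) / norm (1 - w) ^ 4 * exp (\<delta> * Re w)" for w :: complex
      by (simp add: G_def norm_mult norm_divide norm_power)
    have GF: "norm (G w) \<le> norm (F w) * exp (\<delta> * Re w)" if "Re w \<le> 0" for w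
    proof -
      have "1 \<le> norm (1 - w) ^ 4" using ge1[OF that] by simp
      then have "norm (F w) / norm (1 - w) ^ 4 \<le> norm (F w) / 1"
        by (intro divide_left_mono) (auto intro: mult_pos_pos)
      then show ?thesis
        unfolding normG by (intro mult_right_mono) auto
    qed
    have ex1: "exp (\<delta> * Re w) \<le> 1" if "Re w \<le> 0" for w
      using that \<delta> by (simp add: mult_nonneg_nonpos)
    have GF1: "norm (G w) \<le> norm (F w)" if "Re w \<le> 0" for w
      using GF[OF that] ex1[OF that] by (smt (verit) mult_left_le norm_ge_zero)
    have Ghol: "G holomorphic_on {w. Re w < 1}"
      unfolding G_def by (intro holomorphic_intros holomorphic_on_subset[OF F]) auto
    have imG: "norm (G w) \<le> M'" if "Re w = 0" for w
    proof -
      have "(1 + norm w)\<^sup>2 \<le> 2 * (norm (1 - w))\<^sup>2"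
        using that sum_squares_bound[of 1 "\<bar>Im w\<bar>"]
        by (simp add: cmod_power2 cmod_def) (simp add: power2_eq_square algebra_simps)
      then have "((1 + norm w)\<^sup>2)\<^sup>2 \<le> (2 * (norm (1 - w))\<^sup>2)\<^sup>2"
        by (intro power_mono) auto
      then have *: "(1 + norm w) ^ 4 \<le> 4 * norm (1 - w) ^ 4"
        by (simp add: power_mult_distrib flip: power_mult)
      have "norm (F w) \<le> \<bar>M\<bar> * (1 + norm w) ^ 4"
        using right[of w] that by (smt (verit) mult_right_mono zero_le_power norm_ge_zero)
      also have "\<dots> \<le> \<bar>M\<bar> * (4 * norm (1 - w) ^ 4)"
        using * by (intro mult_left_mono) auto
      finally have "norm (F w) \<le> M' * norm (1 - w) ^ 4"
        unfolding M'_def distrib_right using zero_le_power[OF norm_ge_zero[of "1 - w"], of 4]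
        by linarith
      moreover have "norm (1 - w) ^ 4 > 0"
        using ge1[of w] that by auto
      ultimately show ?thesis
        using that by (simp add: normG divide_le_eq)
    qed
    \<comment> \<open>The choice \<delta> / 2 compensates the 2 in |w|^2 \<le> 2 (Re w)^2, valid on
      the cone, so that exp (\<delta> Re w) cancels the exponential.\<close>
    obtain C' where C': "\<And>w. Re w \<le> -1 \<Longrightarrow> norm (F w) \<le> exp (C' + \<delta> / 2 * (norm w)\<^sup>2 / \<bar>Re w\<bar>)"
      using left[of "\<delta> / 2"] \<delta> by auto
    define B where "B = M' + exp C' + exp (3 * \<bar>C\<bar>)"
    have B: "B > 0" "M' \<le> B" "exp C' \<le> B" "exp (3 * \<bar>C\<bar>) \<le> B"
      using M' exp_gt_zero[of C'] exp_gt_zero[of "3 * \<bar>C\<bar>"] unfolding B_def by linarith+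
    have mid: "norm (G w) \<le> B" if "\<bar>Im w\<bar> \<le> - Re w" for w
    proof -
      have re: "Re w \<le> 0" using that by linarith
      have sq: "(norm w)\<^sup>2 \<le> 2 * (Re w)\<^sup>2"
        using that abs_le_square_iff[of "Im w" "Re w"] by (simp add: cmod_power2)
      show ?thesis
      proof (cases "Re w \<le> -1")
        case True
        have "(norm w)\<^sup>2 / \<bar>Re w\<bar> \<le> 2 * \<bar>Re w\<bar>"
          using sq True by (simp add: field_simps power2_eq_square)
        then have "\<delta> / 2 * ((norm w)\<^sup>2 / \<bar>Re w\<bar>) \<le> \<delta> / 2 * (2 * \<bar>Re w\<bar>)"
          using \<delta> by (intro mult_left_mono) auto
        then have "norm (F w) \<le> exp (C' - \<delta> * Re w)"
          using True by (intro order_trans[OF C'[OF True]]) simp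
        then have "norm (F w) * exp (\<delta> * Re w) \<le> exp (C' - \<delta> * Re w) * exp (\<delta> * Re w)"
          by (intro mult_right_mono) auto
        then show ?thesis
          using GF[OF re] B by (simp flip: exp_add)
      next
        case False
        then have "(Re w)\<^sup>2 \<le> 1" using re by (simp add: abs_square_le_1)
        then have "C * (1 + (norm w)\<^sup>2) \<le> \<bar>C\<bar> * 3"
          using sq by (intro mult_mono) auto
        then have "norm (F w) \<le> exp (3 * \<bar>C\<bar>)"
          using gr[OF re] by (smt (verit) exp_le_cancel_iff)
        then show ?thesis using GF1[OF re] B by linarith
      qed
    qed
    have grG: "norm (G w) \<le> exp (C * (1 + (norm w)\<^sup>2))" if "Re w \<le> 0" for w
      using GF1[OF that] gr[OF that] by linarith
    have imB: "norm (G w) \<le> B" if "Re w = 0" for w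
      using imG[OF that] B by linarith
    have up: "norm (G w) \<le> B" if "Re w \<le> 0" "- Re w \<le> Im w" for w
      by (rule phragmen_lindelof_sector[OF Ghol B(1) grG _ _ that])
         (use imB mid in auto)
    \<comment> \<open>The lower sector is reduced to the upper one by conjugation.\<close>
    have cnj_half: "cnj ` {w. Re w < 1} = {w. Re w < 1}"
      by (force intro: image_eqI[of _ _ "cnj _"])
    have "open {w. Re w < 1}"
      by (intro open_Collect_less continuous_intros)
    then have Ghol': "(\<lambda>w. cnj (G (cnj w))) holomorphic_on {w. Re w < 1}"
      using holomorphic_on_compose_cnj_cnj[of G "{w. Re w < 1}"] Ghol by (simp add: o_def cnj_half)
    have down: "norm (G w) \<le> B" if "Re w \<le> 0" "- Re w \<le> - Im w" for w
    proof -
      have "norm (cnj (G (cnj (cnj w)))) \<le> B"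
        by (rule phragmen_lindelof_sector[OF Ghol' B(1), where C = C])
           (use imB mid grG[of "cnj _"] that in auto)
      then show ?thesis by simp
    qed
    have bG: "norm (G w) \<le> B" if "Re w \<le> 0" for w
      using mid[of w] up[of w] down[of w] that by linarith
    have "norm (G w) \<le> M'"
      by (rule phragmen_lindelof_half_plane[OF Ghol M' bG imG w])
    moreover have "norm (1 - w) ^ 4 > 0"
      using ge1[OF w] by auto
    ultimately show ?thesis
      by (simp add: normG exp_minus field_simps)
  qed
  have "norm (F w) \<le> M' * (1 + norm w) ^ 4" if w: "Re w \<le> 0" for w
  proof -
    have "((\<lambda>\<delta>. M' * norm (1 - w) ^ 4 * exp (- (\<delta> * Re w))) \<longlongrightarrow> M' * norm (1 - w) ^ 4 * exp (- (0 * Re w))) (at_right 0)"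
      by (intro tendsto_intros)
    moreover have "eventually (\<lambda>\<delta>. norm (F w) \<le> M' * norm (1 - w) ^ 4 * exp (- (\<delta> * Re w))) (at_right 0)"
      using key[OF _ w] by (auto simp: eventually_at_filter)
    ultimately have "norm (F w) \<le> M' * norm (1 - w) ^ 4"
      using tendsto_lowerbound[of _ _ "at_right (0::real)" "norm (F w)"] by fastforce
    also have "\<dots> \<le> M' * (1 + norm w) ^ 4"
      using M' norm_triangle_ineq4[of 1 w] by (intro mult_left_mono power_mono) auto
    finally show ?thesis .
  qed
  moreover have "norm (F w) \<le> M' * (1 + norm w) ^ 4" if "Re w \<ge> 0" for w
  proof -
    have "norm (F w) \<le> M * (1 + norm w) ^ 4" by (rule right[OF that])
    also have "\<dots> \<le> M' * (1 + norm w) ^ 4"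
      by (intro mult_right_mono) (auto simp: M'_def)
    finally show ?thesis .
  qed
  ultimately show ?thesis by (meson linear)
qed

subsection \<open>The Hahn-Banach theorem for spaces of functions\<close>

text \<open>Vector spaces appear as sets of functions with pointwise operations rather than as
  types, so that \<open>V\<close> can be instantiated by a space depending on p and
  \<alpha>.\<close>

locale function_space =
  fixes V :: "('a \<Rightarrow> complex) set"
  assumes zero: "(\<lambda>z. 0) \<in> V"
    and add: "g \<in> V \<Longrightarrow> h \<in> V \<Longrightarrow> (\<lambda>z. g z + h z) \<in> V"
    and scale: "g \<in> V \<Longrightarrow> (\<lambda>z. c * g z) \<in> V"
begin

lemma uminus: "g \<in> V \<Longrightarrow> (\<lambda>z. - g z) \<in> V"
  using scale[of g "-1"] by simp

definition sublinear :: "(('a \<Rightarrow> complex) \<Rightarrow> real) \<Rightarrow> bool" where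
  "sublinear s \<longleftrightarrow>
     (\<forall>g\<in>V. \<forall>h\<in>V. s (\<lambda>z. g z + h z) \<le> s g + s h) \<and>
     (\<forall>t\<ge>0. \<forall>g\<in>V. s (\<lambda>z. of_real t * g z) = t * s g)"

lemma sublinear_add: "sublinear s \<Longrightarrow> g \<in> V \<Longrightarrow> h \<in> V \<Longrightarrow> s (\<lambda>z. g z + h z) \<le> s g + s h"
  and sublinear_scale: "sublinear s \<Longrightarrow> g \<in> V \<Longrightarrow> t \<ge> 0 \<Longrightarrow> s (\<lambda>z. of_real t * g z) = t * s g"
  by (auto simp: sublinear_def)

lemma sublinear_zero: "sublinear s \<Longrightarrow> s (\<lambda>z. 0) = 0"
  using sublinear_scale[of s "\<lambda>z. 0" 0] zero by simp

lemma sublinear_minus: "sublinear s \<Longrightarrow> g \<in> V \<Longrightarrow> - s g \<le> s (\<lambda>z. - g z)"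
  using sublinear_add[of s g "\<lambda>z. - g z"] uminus[of g] sublinear_zero[of s] by simp

text \<open>For positive t one inequality is enough: applied to 1 / t and t g, it gives the reverse
  one.\<close>

lemma sublinearI:
  assumes zero: "s (\<lambda>z. 0) = 0"
    and add: "\<And>g h. g \<in> V \<Longrightarrow> h \<in> V \<Longrightarrow> s (\<lambda>z. g z + h z) \<le> s g + s h"
    and sc: "\<And>t g. t > 0 \<Longrightarrow> g \<in> V \<Longrightarrow> s (\<lambda>z. of_real t * g z) \<le> t * s g"
  shows "sublinear s"
  unfolding sublinear_def
proof (intro conjI allI ballI impI)
  fix t :: real and g assume "0 \<le> t" and g: "g \<in> V"
  show "s (\<lambda>z. of_real t * g z) = t * s g"
  proof (cases "t = 0")
    case False
    with \<open>0 \<le> t\<close> have t: "t > 0" by simp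
    have "s g = s (\<lambda>z. of_real (1 / t) * (of_real t * g z))"
      using t by simp
    also have "\<dots> \<le> 1 / t * s (\<lambda>z. of_real t * g z)"
      using t g by (intro sc scale) auto
    finally have "t * s g \<le> s (\<lambda>z. of_real t * g z)"
      using t by (simp add: field_simps)
    then show ?thesis using sc[OF t g] by linarith
  qed (simp add: zero)
qed (use add in auto)

text \<open>The infimum of s (g + t y) - t s y over t \<ge> 0 is again sublinear and lies below s;
  taking t = 1 at - y yields - s y. The value 0 outside \<open>V\<close> lets the pointwise order on
  total functions compare values on \<open>V\<close> only.\<close>

lemma sublinear_reduce:
  assumes s: "sublinear s" and y: "y \<in> V"
  shows "\<exists>s'. sublinear s' \<and> (\<forall>g\<in>V. s' g \<le> s g) \<and> s' (\<lambda>z. - y z) \<le> - s y \<and> (\<forall>g. g \<notin> V \<longrightarrow> s' g = 0)"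
proof -
  define k where "k = (\<lambda>g t. s (\<lambda>z. g z + of_real t * y z) - t * s y)"
  define s' where "s' = (\<lambda>g. if g \<in> V then INF t\<in>{0..}. k g t else 0)"
  \<comment> \<open>The infimum is finite: t y is the sum of g + t y and - g, so subadditivity
    bounds \<open>k g t\<close> from below independently of t.\<close>
  have lb: "- s (\<lambda>z. - g z) \<le> k g t" if "g \<in> V" "t \<ge> 0" for g t
  proof -
    have "t * s y = s (\<lambda>z. (g z + of_real t * y z) + - g z)"
      using sublinear_scale[OF s y that(2)] by simp
    also have "\<dots> \<le> s (\<lambda>z. g z + of_real t * y z) + s (\<lambda>z. - g z)"
      using that y by (intro sublinear_add[OF s] add scale uminus)
    finally show ?thesis by (simp add: k_def)
  qed
  have bdd: "bdd_below (k g ` {0..})" if "g \<in> V" for g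
    using lb[OF that] by (auto intro!: bdd_belowI2)
  have s'_le: "s' g \<le> k g t" if "g \<in> V" "t \<ge> 0" for g t
    using that bdd by (auto simp: s'_def intro!: cINF_lower)
  have s'_ge: "c \<le> s' g" if "g \<in> V" "\<And>t. t \<ge> 0 \<Longrightarrow> c \<le> k g t" for g c
    using that by (auto simp: s'_def intro!: cINF_greatest)
  have "sublinear s'"
  proof (rule sublinearI)
    have k0: "k (\<lambda>z. 0) t = 0" if "t \<ge> 0" for t
      using sublinear_scale[OF s y that] by (simp add: k_def)
    show "s' (\<lambda>z. 0) = 0"
      using s'_le[OF zero, of 0] s'_ge[OF zero, of 0] k0 by force
  next
    fix g h assume gh: "g \<in> V" "h \<in> V"
    have le: "s' (\<lambda>z. g z + h z) \<le> k g t + k h u" if "t \<ge> 0" "u \<ge> 0" for t u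
    proof -
      have "s' (\<lambda>z. g z + h z) \<le> k (\<lambda>z. g z + h z) (t + u)"
        using gh that by (intro s'_le add) auto
      also have "\<dots> = s (\<lambda>z. (g z + of_real t * y z) + (h z + of_real u * y z)) - (t + u) * s y"
        unfolding k_def by (simp add: algebra_simps)
      also have "\<dots> \<le> s (\<lambda>z. g z + of_real t * y z) + s (\<lambda>z. h z + of_real u * y z) - (t + u) * s y"
        using sublinear_add[OF s, of "\<lambda>z. g z + of_real t * y z" "\<lambda>z. h z + of_real u * y z"]
          gh y add scale by simp
      also have "\<dots> = k g t + k h u" by (simp add: k_def algebra_simps)
      finally show ?thesis .
    qed
    have "s' (\<lambda>z. g z + h z) - s' h \<le> k g t" if t: "t \<ge> 0" for t
    proof -
      have "s' (\<lambda>z. g z + h z) - k g t \<le> s' h"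
        using le[OF t] by (intro s'_ge gh) (auto simp: algebra_simps)
      then show ?thesis by linarith
    qed
    then show "s' (\<lambda>z. g z + h z) \<le> s' g + s' h"
      using s'_ge[OF gh(1)] by force
  next
    fix t :: real and g assume t: "t > 0" and g: "g \<in> V"
    have "s' (\<lambda>z. of_real t * g z) / t \<le> k g u" if u: "u \<ge> 0" for u
    proof -
      have "s' (\<lambda>z. of_real t * g z) \<le> k (\<lambda>z. of_real t * g z) (t * u)"
        using g t u by (intro s'_le scale) auto
      also have "\<dots> = s (\<lambda>z. of_real t * (g z + of_real u * y z)) - t * u * s y"
        by (simp add: k_def algebra_simps)
      also have "\<dots> = t * k g u"
        using t g y by (subst sublinear_scale[OF s]) (auto simp: k_def algebra_simps intro!: add scale)
      finally show ?thesis using t by (simp add: field_simps)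
    qed
    then show "s' (\<lambda>z. of_real t * g z) \<le> t * s' g"
      using s'_ge[OF g] t by (metis mult.commute pos_divide_le_eq)
  qed
  moreover have "s' g \<le> s g" if "g \<in> V" for g
    using s'_le[OF that, of 0] by (simp add: k_def)
  moreover have "s' (\<lambda>z. - y z) \<le> - s y"
    using s'_le[OF uminus[OF y], of 1] sublinear_zero[OF s] by (simp add: k_def)
  moreover have "s' g = 0" if "g \<notin> V" for g
    using that by (simp add: s'_def)
  ultimately show ?thesis by blast
qed

text \<open>A sublinear functional that is minimal under the pointwise order is linear, since
  the reduction step would decrease it at \<open>- y\<close> otherwise.\<close>

lemma linear_below_sublinear:
  assumes q: "sublinear q"
  shows "\<exists>l. (\<forall>g\<in>V. \<forall>h\<in>V. l (\<lambda>z. g z + h z) = l g + l h) \<and>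
             (\<forall>t. \<forall>g\<in>V. l (\<lambda>z. of_real t * g z) = t * l g) \<and> (\<forall>g\<in>V. l g \<le> q g)"
proof -
  define A where "A = {s. sublinear s \<and> (\<forall>g\<in>V. s g \<le> q g) \<and> (\<forall>g. g \<notin> V \<longrightarrow> s g = 0)}"
  \<comment> \<open>Zorn's lemma is applied to the reversed pointwise order. The infimum of a
    nonempty chain is finite, since sublinearity and s \<le> q force s g \<ge> - q (- g).\<close>
  have "\<exists>m\<in>A. \<forall>a\<in>A. a \<le> m \<longrightarrow> a = m"
  proof (rule predicate_Zorn)
    show "partial_order_on A (relation_of (\<lambda>a b. b \<le> a) A)"
      by (rule partial_order_on_relation_ofI) auto
  next
    fix C assume C: "C \<in> Chains (relation_of (\<lambda>a b. b \<le> a) A)"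
    then have CA: "C \<subseteq> A" and tot: "\<And>a b. a \<in> C \<Longrightarrow> b \<in> C \<Longrightarrow> a \<le> b \<or> b \<le> a"
      by (auto simp: Chains_def relation_of_def)
    show "\<exists>u\<in>A. \<forall>a\<in>C. u \<le> a"
    proof (cases "C = {}")
      case True
      define q' where "q' = (\<lambda>g. if g \<in> V then q g else 0)"
      have "q' \<in> A"
        using q unfolding A_def sublinear_def q'_def by (auto simp: add scale)
      then show ?thesis using True by auto
    next
      case False
      define u where "u = (\<lambda>g. if g \<in> V then INF s\<in>C. s g else 0)"
      have sC: "sublinear s" "\<And>g. g \<in> V \<Longrightarrow> s g \<le> q g" "\<And>g. g \<notin> V \<Longrightarrow> s g = 0" if "s \<in> C" for s
        using that CA by (auto simp: A_def)
      have "- q (\<lambda>z. - g z) \<le> s g" if "s \<in> C" "g \<in> V" for s g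
        using sublinear_minus[OF sC(1)[OF that(1)] uminus[OF that(2)]] sC(2)[OF that(1) uminus[OF that(2)]]
        by simp
      then have bdd: "bdd_below ((\<lambda>s. s g) ` C)" if "g \<in> V" for g
        using that by (intro bdd_belowI2)
      have u_le: "u g \<le> s g" if "s \<in> C" "g \<in> V" for s g
        using that bdd by (auto simp: u_def intro: cINF_lower)
      have u_ge: "c \<le> u g" if "g \<in> V" "\<And>s. s \<in> C \<Longrightarrow> c \<le> s g" for c g
        using that False by (auto simp: u_def intro: cINF_greatest)
      have "sublinear u"
      proof (rule sublinearI)
        have "(\<lambda>s. s (\<lambda>z. 0)) ` C = {0}"
          using False sublinear_zero[OF sC(1)] by force
        then show "u (\<lambda>z. 0) = 0" using zero by (simp add: u_def)
      next
        fix g h assume gh: "g \<in> V" "h \<in> V"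
        have le: "u (\<lambda>z. g z + h z) \<le> s1 g + s2 h" if "s1 \<in> C" "s2 \<in> C" for s1 s2
        proof -
          obtain s where s: "s \<in> C" "s \<le> s1" "s \<le> s2"
            using tot[OF \<open>s1 \<in> C\<close> \<open>s2 \<in> C\<close>] \<open>s1 \<in> C\<close> \<open>s2 \<in> C\<close> by auto
          have "u (\<lambda>z. g z + h z) \<le> s (\<lambda>z. g z + h z)"
            using gh s by (intro u_le add) auto
          also have "\<dots> \<le> s g + s h" using sublinear_add[OF sC(1)] s gh by auto
          also have "\<dots> \<le> s1 g + s2 h" using s by (intro add_mono) (auto simp: le_fun_def)
          finally show ?thesis .
        qed
        have "u (\<lambda>z. g z + h z) - u h \<le> s g" if t: "s \<in> C" for s
        proof -
          have "u (\<lambda>z. g z + h z) - s g \<le> u h"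
            using le[OF t] by (intro u_ge gh) (auto simp: algebra_simps)
          then show ?thesis by linarith
        qed
        then show "u (\<lambda>z. g z + h z) \<le> u g + u h"
          using u_ge[OF gh(1)] by force
      next
        fix t :: real and g assume t: "t > 0" and g: "g \<in> V"
        have "u (\<lambda>z. of_real t * g z) / t \<le> s g" if "s \<in> C" for s
          using u_le[OF that scale[OF g], of "of_real t"] sublinear_scale[OF sC(1)[OF that] g, of t] t
          by (simp add: field_simps)
        then show "u (\<lambda>z. of_real t * g z) \<le> t * u g"
          using u_ge[OF g] t by (metis mult.commute pos_divide_le_eq)
      qed
      moreover have "u g \<le> q g" if "g \<in> V" for g
      proof -
        obtain s where "s \<in> C" using False by auto
        then show ?thesis using u_le[of s g] sC(2)[of s g] that by linarith
      qed
      ultimately have "u \<in> A" by (auto simp: A_def u_def)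
      moreover have "u \<le> s" if "s \<in> C" for s
        using u_le[OF that] sC(3)[OF that] by (auto simp: le_fun_def u_def)
      ultimately show ?thesis by auto
    qed
  qed
  then obtain m where m: "m \<in> A" and min: "\<And>a. a \<in> A \<Longrightarrow> a \<le> m \<Longrightarrow> a = m" by auto
  have sm: "sublinear m" and mq: "\<And>g. g \<in> V \<Longrightarrow> m g \<le> q g" and m0: "\<And>g. g \<notin> V \<Longrightarrow> m g = 0"
    using m by (auto simp: A_def)
  have neg: "m (\<lambda>z. - y z) = - m y" if y: "y \<in> V" for y
  proof -
    obtain s' where s': "sublinear s'" "\<forall>g\<in>V. s' g \<le> m g" "s' (\<lambda>z. - y z) \<le> - m y" "\<forall>g. g \<notin> V \<longrightarrow> s' g = 0"
      using sublinear_reduce[OF sm y] by blast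
    have "s' \<in> A"
      using s' mq unfolding A_def by (auto intro: order_trans)
    moreover have "s' \<le> m"
      unfolding le_fun_def by (metis m0 order_refl s'(2,4))
    ultimately have "s' = m" by (rule min)
    then show ?thesis using s'(3) sublinear_minus[OF sm y] by simp
  qed
  have addm: "m (\<lambda>z. g z + h z) = m g + m h" if "g \<in> V" "h \<in> V" for g h
  proof -
    have "m g \<le> m (\<lambda>z. g z + h z) + m (\<lambda>z. - h z)"
      using sublinear_add[OF sm add[OF that] uminus[OF that(2)]] by simp
    then show ?thesis
      using sublinear_add[OF sm that] neg[OF that(2)] by simp
  qed
  have "m (\<lambda>z. of_real t * g z) = t * m g" if g: "g \<in> V" for t g
  proof (cases "t \<ge> 0")
    case False
    have "m (\<lambda>z. - (of_real (- t) * g z)) = - m (\<lambda>z. of_real (- t) * g z)"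
      by (rule neg) (rule scale[OF g])
    also have "m (\<lambda>z. of_real (- t) * g z) = (- t) * m g"
      using False g by (intro sublinear_scale[OF sm]) auto
    finally show ?thesis by simp
  qed (use sublinear_scale[OF sm g] in auto)
  then show ?thesis using addm mq by blast
qed

text \<open>Reducing the seminorm q at g0 builds the separation into the sublinear functional: every
  linear l below the reduced one satisfies l (- g0) \<le> - q g0, hence l g0 \<ge> q g0. This
  replaces the extension from the line through g0. The factor 2 stems from bounding |L g| by the sum
  of its real and imaginary parts.\<close>

lemma hahn_banach:
  assumes q_add: "\<And>g h. g \<in> V \<Longrightarrow> h \<in> V \<Longrightarrow> q (\<lambda>z. g z + h z) \<le> q g + q h"
    and q_scale: "\<And>c g. g \<in> V \<Longrightarrow> q (\<lambda>z. c * g z) = norm c * q g"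
    and g0: "g0 \<in> V"
  shows "\<exists>L :: ('a \<Rightarrow> complex) \<Rightarrow> complex.
    (\<forall>g\<in>V. \<forall>h\<in>V. L (\<lambda>z. g z + h z) = L g + L h) \<and>
    (\<forall>c. \<forall>g\<in>V. L (\<lambda>z. c * g z) = c * L g) \<and>
    (\<forall>g\<in>V. norm (L g) \<le> 2 * q g) \<and> q g0 \<le> norm (L g0)"
proof -
  have q: "sublinear q"
    unfolding sublinear_def using q_add q_scale by auto
  obtain s where s: "sublinear s" "\<forall>g\<in>V. s g \<le> q g" "s (\<lambda>z. - g0 z) \<le> - q g0"
    using sublinear_reduce[OF q g0] by blast
  obtain l where l: "\<And>g h. g \<in> V \<Longrightarrow> h \<in> V \<Longrightarrow> l (\<lambda>z. g z + h z) = l g + l h"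
    "\<And>t g. g \<in> V \<Longrightarrow> l (\<lambda>z. of_real t * g z) = t * l g" "\<And>g. g \<in> V \<Longrightarrow> l g \<le> s g"
    using linear_below_sublinear[OF s(1)] by blast
  have neg: "l (\<lambda>z. - g z) = - l g" if "g \<in> V" for g
    using l(2)[OF that, of "-1"] by simp
  have abs: "\<bar>l g\<bar> \<le> q g" if "g \<in> V" for g
  proof -
    have "l g \<le> q g" using l(3)[OF that] s(2) that by force
    moreover have "- l g \<le> q (\<lambda>z. - g z)"
      using l(3)[OF uminus[OF that]] s(2) uminus[OF that] neg[OF that] by force
    moreover have "q (\<lambda>z. - g z) = q g" using q_scale[OF that, of "-1"] by simp
    ultimately show ?thesis by linarith
  qed
  \<comment> \<open>The complex-linear functional with real part l, namely l g - i l (i g).\<close>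
  define L where "L = (\<lambda>g. Complex (l g) (- l (\<lambda>z. \<i> * g z)))"
  have "L (\<lambda>z. g z + h z) = L g + L h" if "g \<in> V" "h \<in> V" for g h
    using l(1)[OF that] l(1)[OF scale[OF that(1), of \<i>] scale[OF that(2), of \<i>]]
    by (simp add: L_def complex_eq_iff distrib_left)
  moreover have "L (\<lambda>z. c * g z) = c * L g" if g: "g \<in> V" for c g
  proof -
    have ig: "(\<lambda>z. \<i> * g z) \<in> V" by (rule scale[OF g])
    have "(\<lambda>z. c * g z) = (\<lambda>z. of_real (Re c) * g z + of_real (Im c) * (\<i> * g z))"
      by (rule ext, subst complex_eq[of c]) (simp add: algebra_simps)
    then have 1: "l (\<lambda>z. c * g z) = Re c * l g + Im c * l (\<lambda>z. \<i> * g z)"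
      using l(1)[OF scale[OF g, of "of_real (Re c)"] scale[OF ig, of "of_real (Im c)"]] l(2)[OF g] l(2)[OF ig]
      by simp
    have "(\<lambda>z. \<i> * (c * g z)) = (\<lambda>z. of_real (Re c) * (\<i> * g z) + of_real (- Im c) * g z)"
      by (rule ext, subst complex_eq[of c]) (simp add: algebra_simps)
    then have 2: "l (\<lambda>z. \<i> * (c * g z)) = Re c * l (\<lambda>z. \<i> * g z) - Im c * l g"
      using l(1)[OF scale[OF ig, of "of_real (Re c)"] scale[OF g, of "of_real (- Im c)"]] l(2)[OF g, of "- Im c"] l(2)[OF ig]
      by simp
    show ?thesis
      by (simp add: L_def complex_eq_iff 1 2)
  qed
  moreover have "norm (L g) \<le> 2 * q g" if g: "g \<in> V" for g
  proof -
    have "norm (L g) \<le> \<bar>l g\<bar> + \<bar>l (\<lambda>z. \<i> * g z)\<bar>"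
      using cmod_le[of "L g"] by (simp add: L_def)
    then show ?thesis
      using abs[OF g] abs[OF scale[OF g, of \<i>]] q_scale[OF g, of \<i>] by simp
  qed
  moreover have "q g0 \<le> norm (L g0)"
  proof -
    have "q g0 \<le> l g0"
      using s(3) l(3)[OF uminus[OF g0]] neg[OF g0] by simp
    then show ?thesis using complex_Re_le_cmod[of "L g0"] by (simp add: L_def)
  qed
  ultimately show ?thesis by blast
qed

end

subsection \<open>The weighted area measure\<close>

text \<open>Both measures agree on boxes. This opens the way to iterated integrals, on which the
  invariance under shears and the area estimate near 1 rest.\<close>

lemma lborel_complex: "(lborel :: complex measure) = distr (lborel \<Otimes>\<^sub>M lborel) borel (\<lambda>(x, y). Complex x y)"
proof (rule lborel_eqI)
  have m[measurable]: "(\<lambda>(x, y). Complex x y) \<in> borel_measurable (lborel \<Otimes>\<^sub>M lborel)"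
    unfolding Complex_eq split_beta' by measurable
  fix l u :: complex assume lu: "\<And>b. b \<in> Basis \<Longrightarrow> l \<bullet> b \<le> u \<bullet> b"
  have "Re l \<le> Re u" "Im l \<le> Im u"
    using lu[of 1] lu[of \<i>] by (auto simp: Basis_complex_def inner_complex_def)
  have "(\<lambda>(x, y). Complex x y) -` box l u \<inter> space (lborel \<Otimes>\<^sub>M lborel) = {Re l <..< Re u} \<times> {Im l <..< Im u}"
    by (auto simp: in_box_complex_iff space_pair_measure)
  then have "emeasure (distr (lborel \<Otimes>\<^sub>M lborel) borel (\<lambda>(x, y). Complex x y)) (box l u) =
     emeasure (lborel \<Otimes>\<^sub>M lborel) ({Re l <..< Re u} \<times> {Im l <..< Im u})"
    by (subst emeasure_distr) auto
  also have "\<dots> = ennreal (Re u - Re l) * ennreal (Im u - Im l)"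
    using \<open>Re l \<le> Re u\<close> \<open>Im l \<le> Im u\<close> by (subst lborel.emeasure_pair_measure_Times) auto
  also have "\<dots> = (\<Prod>b\<in>Basis. (u - l) \<bullet> b)"
    using \<open>Re l \<le> Re u\<close> \<open>Im l \<le> Im u\<close> by (simp add: Basis_complex_def inner_complex_def ennreal_mult)
  finally show "emeasure (distr (lborel \<Otimes>\<^sub>M lborel) borel (\<lambda>(x, y). Complex x y)) (box l u) = (\<Prod>b\<in>Basis. (u - l) \<bullet> b)" .
qed simp

lemma
  fixes f :: "complex \<Rightarrow> ennreal"
  assumes [measurable]: "f \<in> borel_measurable borel"
  shows nn_integral_complex: "(\<integral>\<^sup>+z. f z \<partial>lborel) = (\<integral>\<^sup>+y. \<integral>\<^sup>+x. f (Complex x y) \<partial>lborel \<partial>lborel)"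
    and nn_integral_complex': "(\<integral>\<^sup>+z. f z \<partial>lborel) = (\<integral>\<^sup>+x. \<integral>\<^sup>+y. f (Complex x y) \<partial>lborel \<partial>lborel)"
proof -
  have m[measurable]: "(\<lambda>(x, y). Complex x y) \<in> borel_measurable (lborel \<Otimes>\<^sub>M lborel)"
    unfolding Complex_eq split_beta' by measurable
  have eq: "(\<integral>\<^sup>+z. f z \<partial>lborel) = (\<integral>\<^sup>+p. f (case p of (x, y) \<Rightarrow> Complex x y) \<partial>(lborel \<Otimes>\<^sub>M lborel))"
    by (subst lborel_complex, subst nn_integral_distr) auto
  have fm: "(\<lambda>p. f (case p of (x, y) \<Rightarrow> Complex x y)) \<in> borel_measurable (lborel \<Otimes>\<^sub>M lborel)"
    by measurable
  show "(\<integral>\<^sup>+z. f z \<partial>lborel) = (\<integral>\<^sup>+x. \<integral>\<^sup>+y. f (Complex x y) \<partial>lborel \<partial>lborel)"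
    unfolding eq using lborel.nn_integral_fst[OF fm] by simp
  show "(\<integral>\<^sup>+z. f z \<partial>lborel) = (\<integral>\<^sup>+y. \<integral>\<^sup>+x. f (Complex x y) \<partial>lborel \<partial>lborel)"
    unfolding eq using lborel_pair.nn_integral_snd[OF fm] by simp
qed

lemma borel_measurable_Complex[measurable (raw)]:
  assumes [measurable]: "f \<in> borel_measurable M" "g \<in> borel_measurable M"
  shows "(\<lambda>x. Complex (f x) (g x)) \<in> borel_measurable M"
  unfolding Complex_eq by measurable

lemma nn_integral_shear_Re:
  fixes f :: "complex \<Rightarrow> ennreal"
  assumes [measurable]: "f \<in> borel_measurable borel"
  shows "(\<integral>\<^sup>+z. f (Complex (Re z + a * Im z) (Im z)) \<partial>lborel) = (\<integral>\<^sup>+z. f z \<partial>lborel)"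
proof -
  have "(\<integral>\<^sup>+x. f (Complex (x + a * y) y) \<partial>lborel) = (\<integral>\<^sup>+x. f (Complex x y) \<partial>lborel)" for y
    using nn_integral_real_affine[of "\<lambda>x. f (Complex x y)" 1 "a * y"] by (simp add: add.commute)
  then show ?thesis
    by (subst (1 2) nn_integral_complex) auto
qed

lemma nn_integral_shear_Im:
  fixes f :: "complex \<Rightarrow> ennreal"
  assumes [measurable]: "f \<in> borel_measurable borel"
  shows "(\<integral>\<^sup>+z. f (Complex (Re z) (Im z + a * Re z)) \<partial>lborel) = (\<integral>\<^sup>+z. f z \<partial>lborel)"
proof -
  have "(\<integral>\<^sup>+y. f (Complex x (y + a * x)) \<partial>lborel) = (\<integral>\<^sup>+y. f (Complex x y) \<partial>lborel)" for x
    using nn_integral_real_affine[of "\<lambda>y. f (Complex x y)" 1 "a * x"] by (simp add: add.commute)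
  then show ?thesis
    by (subst (1 2) nn_integral_complex') auto
qed

text \<open>A rotation by an angle other than \<open>\<pi>\<close> is a product of three shears.\<close>

lemma nn_integral_rotate_aux:
  fixes f :: "complex \<Rightarrow> ennreal"
  assumes [measurable]: "f \<in> borel_measurable borel" and \<omega>: "norm \<omega> = 1" "\<omega> \<noteq> -1"
  shows "(\<integral>\<^sup>+z. f (\<omega> * z) \<partial>lborel) = (\<integral>\<^sup>+z. f z \<partial>lborel)"
proof -
  define c s where "c = Re \<omega>" and "s = Im \<omega>"
  have cs: "c\<^sup>2 + s\<^sup>2 = 1" using \<omega> by (simp add: c_def s_def cmod_power2[symmetric])
  have "c \<noteq> -1"
    using cs \<omega>(2) by (auto simp: c_def s_def complex_eq_iff)
  moreover have "\<bar>c\<bar> \<le> 1" using abs_Re_le_cmod[of \<omega>] \<omega> by (simp add: c_def)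
  ultimately have c: "1 + c > 0" by linarith
  define a where "a = - (s / (1 + c))"
  have ab: "1 + a * s = c" "a * (1 + c) = - s"
    using c cs by (auto simp: a_def field_simps power2_eq_square)
  have a2: "a + a * c = - s" using ab(2) by (simp add: algebra_simps)
  let ?X = "\<lambda>z. Complex (Re z + a * Im z) (Im z)"
  let ?Y = "\<lambda>z. Complex (Re z) (Im z + s * Re z)"
  have "\<omega> * z = ?X (?Y (?X z))" for z
  proof -
    have "Im (?Y (?X z)) = (1 + a * s) * Im z + s * Re z" by (simp add: algebra_simps)
    then have im: "Im (?Y (?X z)) = c * Im z + s * Re z" unfolding ab(1) .
    have "Re (?X (?Y (?X z))) = Re z + a * Im z + a * (c * Im z + s * Re z)"
      using im by simp
    also have "\<dots> = (1 + a * s) * Re z + (a + a * c) * Im z" by (simp add: algebra_simps)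
    also have "\<dots> = c * Re z - s * Im z" unfolding ab(1) a2 by simp
    finally show ?thesis using im by (simp add: complex_eq_iff c_def s_def)
  qed
  then have "(\<integral>\<^sup>+z. f (\<omega> * z) \<partial>lborel) = (\<integral>\<^sup>+z. f (?X (?Y (?X z))) \<partial>lborel)" by simp
  also have "\<dots> = (\<integral>\<^sup>+z. f (?X (?Y z)) \<partial>lborel)"
    by (rule nn_integral_shear_Re[where f = "\<lambda>z. f (?X (?Y z))"]) measurable
  also have "\<dots> = (\<integral>\<^sup>+z. f (?X z) \<partial>lborel)"
    by (rule nn_integral_shear_Im[where f = "\<lambda>z. f (?X z)"]) measurable
  also have "\<dots> = (\<integral>\<^sup>+z. f z \<partial>lborel)"
    by (rule nn_integral_shear_Re) measurable
  finally show ?thesis .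
qed

text \<open>The half turn, which is excluded from the product of shears, is two quarter
  turns.\<close>

lemma nn_integral_rotate:
  fixes f :: "complex \<Rightarrow> ennreal"
  assumes [measurable]: "f \<in> borel_measurable borel" and \<omega>: "norm \<omega> = 1"
  shows "(\<integral>\<^sup>+z. f (\<omega> * z) \<partial>lborel) = (\<integral>\<^sup>+z. f z \<partial>lborel)"
proof (cases "\<omega> = -1")
  case True
  have "(\<integral>\<^sup>+z. f (\<i> * (\<i> * z)) \<partial>lborel) = (\<integral>\<^sup>+z. f (\<i> * z) \<partial>lborel)"
    by (rule nn_integral_rotate_aux[where f = "\<lambda>z. f (\<i> * z)"]) (auto simp: complex_eq_iff)
  also have "\<dots> = (\<integral>\<^sup>+z. f z \<partial>lborel)"
    by (rule nn_integral_rotate_aux) (auto simp: complex_eq_iff)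
  finally show ?thesis using True by simp
qed (use nn_integral_rotate_aux assms in auto)

text \<open>The full density with respect to Lebesgue measure on the plane, including 1 / pi and the
  cut-off to the disc. It is Borel on the whole plane, so integrals against the weighted measure
  become plain Lebesgue integrals.\<close>

definition disc_weight :: "real \<Rightarrow> complex \<Rightarrow> ennreal" where
  "disc_weight \<alpha> z = ennreal (1 / pi) * ennreal ((1 + \<alpha>) * (1 - (norm z)\<^sup>2) powr \<alpha>) * indicator (ball 0 1) z"

lemma borel_measurable_disc_weight[measurable]: "disc_weight \<alpha> \<in> borel_measurable borel"
  unfolding disc_weight_def by (intro borel_measurable_times_ennreal borel_measurable_indicator) auto

lemma space_weighted_area [simp]: "space (weighted_area_measure \<alpha>) = ball 0 1"
  and sets_weighted_area [measurable_cong]: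
    "sets (weighted_area_measure \<alpha>) = sets (restrict_space borel (ball 0 1))"
  by (auto simp: weighted_area_measure_def area_measure_def space_restrict_space sets_restrict_space
      space_scale_measure)

lemma nn_integral_weighted_area:
  assumes [measurable]: "u \<in> borel_measurable (weighted_area_measure \<alpha>)"
  shows "(\<integral>\<^sup>+z. u z \<partial>weighted_area_measure \<alpha>) = (\<integral>\<^sup>+z. u z * disc_weight \<alpha> z \<partial>lborel)"
proof -
  have s: "sets area_measure = sets (restrict_space borel (ball 0 1))"
    by (simp add: area_measure_def sets_restrict_space)
  have u: "u \<in> borel_measurable area_measure"
    using assms by (simp add: weighted_area_measure_def)
  have m: "(\<lambda>z. ennreal ((1 + \<alpha>) * (1 - (norm z)\<^sup>2) powr \<alpha>) * u z) \<in> borel_measurable (restrict_space borel (ball 0 1))"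
  proof (rule borel_measurable_times_ennreal)
    show "(\<lambda>z. ennreal ((1 + \<alpha>) * (1 - (norm z)\<^sup>2) powr \<alpha>)) \<in> borel_measurable (restrict_space borel (ball 0 1))"
      by (rule measurable_restrict_space1) measurable
    show "u \<in> borel_measurable (restrict_space borel (ball 0 1))"
      using u by (simp add: measurable_cong_sets[OF s refl])
  qed
  have s2: "sets (restrict_space lborel (ball 0 1)) = sets (restrict_space borel (ball (0::complex) 1))"
    by (simp add: sets_restrict_space)
  have "(\<integral>\<^sup>+z. u z \<partial>weighted_area_measure \<alpha>) =
      (\<integral>\<^sup>+z. ennreal ((1 + \<alpha>) * (1 - (norm z)\<^sup>2) powr \<alpha>) * u z \<partial>area_measure)"
    unfolding weighted_area_measure_def
    by (rule nn_integral_density)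
       (auto simp: u measurable_cong_sets[OF s refl] intro!: measurable_restrict_space1)
  also have "\<dots> = ennreal (1 / pi) * (\<integral>\<^sup>+z. ennreal ((1 + \<alpha>) * (1 - (norm z)\<^sup>2) powr \<alpha>) * u z \<partial>(restrict_space lborel (ball 0 1)))"
    using m unfolding area_measure_def
    by (intro nn_integral_scale_measure) (simp add: measurable_cong_sets[OF s2 refl])
  also have "\<dots> = ennreal (1 / pi) * (\<integral>\<^sup>+z. ennreal ((1 + \<alpha>) * (1 - (norm z)\<^sup>2) powr \<alpha>) * u z * indicator (ball 0 1) z \<partial>lborel)"
    by (subst nn_integral_restrict_space) auto
  also have "\<dots> = (\<integral>\<^sup>+z. ennreal (1 / pi) * (ennreal ((1 + \<alpha>) * (1 - (norm z)\<^sup>2) powr \<alpha>) * u z * indicator (ball 0 1) z) \<partial>lborel)"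
  proof (rule nn_integral_cmult[symmetric])
    show "(\<lambda>z. ennreal ((1 + \<alpha>) * (1 - (norm z)\<^sup>2) powr \<alpha>) * u z * indicator (ball 0 1) z) \<in> borel_measurable lborel"
      using m by (subst (asm) borel_measurable_restrict_space_iff_ennreal) auto
  qed
  also have "\<dots> = (\<integral>\<^sup>+z. u z * disc_weight \<alpha> z \<partial>lborel)"
    by (simp add: disc_weight_def mult_ac)
  finally show ?thesis .
qed

lemma nn_integral_weighted_area_rotate:
  assumes u: "u \<in> borel_measurable (weighted_area_measure \<alpha>)" and \<omega>: "norm \<omega> = 1"
  shows "(\<integral>\<^sup>+z. u (\<omega> * z) \<partial>weighted_area_measure \<alpha>) = (\<integral>\<^sup>+z. u z \<partial>weighted_area_measure \<alpha>)"
proof -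
  have "(\<lambda>z. \<omega> * z) \<in> measurable (weighted_area_measure \<alpha>) (weighted_area_measure \<alpha>)"
    unfolding measurable_cong_sets[OF sets_weighted_area sets_weighted_area]
    by (rule measurable_restrict_space3) (auto simp: \<omega> norm_mult)
  from measurable_compose[OF this u] have u': "(\<lambda>z. u (\<omega> * z)) \<in> borel_measurable (weighted_area_measure \<alpha>)" .
  have w: "disc_weight \<alpha> z = disc_weight \<alpha> (\<omega> * z)" for z
    by (simp add: disc_weight_def norm_mult \<omega> indicator_def)
  \<comment> \<open>Nothing is known about u off the disc. Inserting the indicator gives a Borel
    function and changes nothing, since the weight vanishes there.\<close>
  have "(\<lambda>z. u z * indicator (ball 0 1) z) \<in> borel_measurable borel"
    using u unfolding measurable_cong_sets[OF sets_weighted_area refl]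
    by (subst (asm) borel_measurable_restrict_space_iff_ennreal) auto
  then have "(\<lambda>z. (u z * indicator (ball 0 1) z) * disc_weight \<alpha> z) \<in> borel_measurable borel"
    by measurable
  also have "(\<lambda>z. (u z * indicator (ball 0 1) z) * disc_weight \<alpha> z) = (\<lambda>z. u z * disc_weight \<alpha> z)"
    by (auto simp: disc_weight_def indicator_def)
  finally show ?thesis
    unfolding nn_integral_weighted_area[OF u] nn_integral_weighted_area[OF u']
    using nn_integral_rotate[OF _ \<omega>, of "\<lambda>z. u z * disc_weight \<alpha> z"] by (simp add: w[symmetric])
qed

lemma emeasure_weighted_area:
  assumes "A \<in> sets borel" "A \<subseteq> ball 0 1"
  shows "emeasure (weighted_area_measure \<alpha>) A = (\<integral>\<^sup>+z. indicator A z * disc_weight \<alpha> z \<partial>lborel)"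
proof -
  have A: "A \<in> sets (weighted_area_measure \<alpha>)"
    unfolding sets_weighted_area using assms by (auto simp: sets_restrict_space_iff)
  then have "emeasure (weighted_area_measure \<alpha>) A = (\<integral>\<^sup>+z. indicator A z \<partial>weighted_area_measure \<alpha>)"
    by simp
  also have "\<dots> = (\<integral>\<^sup>+z. indicator A z * disc_weight \<alpha> z \<partial>lborel)"
    by (rule nn_integral_weighted_area) (use A in measurable)
  finally show ?thesis .
qed

lemma nn_integral_powr_reflect:
  assumes "\<alpha> > -1" "s > 0"
  shows "(\<integral>\<^sup>+x. ennreal ((c - x) powr \<alpha>) * indicator {c - s..c} x \<partial>lborel) = ennreal (s powr (\<alpha> + 1) / (\<alpha> + 1))"
proof -
  have "((\<lambda>x. x powr \<alpha>) has_integral s powr (\<alpha> + 1) / (\<alpha> + 1)) {0..s}"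
    using has_integral_powr_from_0[of \<alpha> s] assms by simp
  then have *: "(\<integral>\<^sup>+x. ennreal (x powr \<alpha>) * indicator {0..s} x \<partial>lborel) = ennreal (s powr (\<alpha> + 1) / (\<alpha> + 1))"
    by (intro nn_integral_has_integral_lebesgue') auto
  have "(\<integral>\<^sup>+x. ennreal ((c - x) powr \<alpha>) * indicator {c - s..c} x \<partial>lborel) =
     (\<integral>\<^sup>+x. ennreal ((c - (c + (-1) * x)) powr \<alpha>) * indicator {c - s..c} (c + (-1) * x) \<partial>lborel)"
    by (subst nn_integral_real_affine[of _ "-1" c]) auto
  also have "\<dots> = (\<integral>\<^sup>+x. ennreal (x powr \<alpha>) * indicator {0..s} x \<partial>lborel)"
    by (intro nn_integral_cong) (auto simp: indicator_def)
  finally show ?thesis using * by simp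
qed

lemma powr_le_powr_mult:
  fixes d m :: real
  assumes d: "d > 0" and m: "1 \<le> m" "m \<le> 2"
  shows "(d * m) powr \<alpha> \<le> 2 powr \<bar>\<alpha>\<bar> * d powr \<alpha>"
proof -
  have "m powr \<alpha> \<le> m powr \<bar>\<alpha>\<bar>" using m by (intro powr_mono) auto
  also have "\<dots> \<le> 2 powr \<bar>\<alpha>\<bar>" using m by (intro powr_mono2) auto
  finally have "d powr \<alpha> * m powr \<alpha> \<le> d powr \<alpha> * 2 powr \<bar>\<alpha>\<bar>" by (intro mult_left_mono) auto
  then show ?thesis using d m by (simp add: powr_mult mult.commute)
qed

text \<open>On the horizontal chord at height y one has 1 - |z|^2 = (c - x) (c + x) with c = sqrt (1
  - y^2), and near 1 the second factor lies in [1, 2]. Integrating the \<alpha>-th power of c - x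
  over a segment of length s gives s^(\<alpha> + 1), and the range of y contributes the last power
  of s.\<close>

lemma emeasure_weighted_area_ball:
  assumes \<alpha>: "\<alpha> > -1"
  shows "\<exists>C\<ge>0. \<forall>s. 0 < s \<longrightarrow> s \<le> 1 / 2 \<longrightarrow>
    emeasure (weighted_area_measure \<alpha>) (ball 1 s \<inter> ball 0 1) \<le> ennreal (C * s powr (\<alpha> + 2))"
proof (intro exI conjI allI impI)
  define C where "C = 2 * 2 powr \<bar>\<alpha>\<bar> / pi"
  show "0 \<le> C" by (simp add: C_def)
  fix s :: real assume s: "0 < s" "s \<le> 1 / 2"
  define K where "K = (1 + \<alpha>) * 2 powr \<bar>\<alpha>\<bar> / pi"
  have K: "K \<ge> 0" using \<alpha> by (simp add: K_def)
  define h where "h = (\<lambda>y x. ennreal K * indicator {- s..s} y *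
      (ennreal ((sqrt (1 - y\<^sup>2) - x) powr \<alpha>) * indicator {sqrt (1 - y\<^sup>2) - s..sqrt (1 - y\<^sup>2)} x))"
  have pt: "indicator (ball 1 s \<inter> ball 0 1) z * disc_weight \<alpha> z \<le> h (Im z) (Re z)" for z
  proof (cases "z \<in> ball 1 s \<inter> ball 0 1")
    case True
    define x y where "x = Re z" and "y = Im z"
    have z: "norm (1 - z) < s" "norm z < 1" using True by (auto simp: dist_norm)
    have xy: "\<bar>1 - x\<bar> < s" "\<bar>y\<bar> < s" "x < 1"
      using z abs_Re_le_cmod[of "1 - z"] abs_Im_le_cmod[of "1 - z"] abs_Re_le_cmod[of z]
      by (auto simp: x_def y_def)
    have n2: "(norm z)\<^sup>2 = x\<^sup>2 + y\<^sup>2" by (simp add: x_def y_def cmod_power2)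
    have "(norm z)\<^sup>2 < 1" using z by (simp add: abs_square_less_1)
    then have "x\<^sup>2 < 1 - y\<^sup>2" using n2 by simp
    define c where "c = sqrt (1 - y\<^sup>2)"
    have "x < c" unfolding c_def using \<open>x\<^sup>2 < 1 - y\<^sup>2\<close> by (rule real_less_rsqrt)
    have c1: "c \<le> 1" by (simp add: c_def)
    have c2: "c\<^sup>2 = 1 - y\<^sup>2" unfolding c_def using \<open>x\<^sup>2 < 1 - y\<^sup>2\<close> by (smt (verit) real_sqrt_pow2 zero_le_power2)
    have x1: "x > 1 / 2" using xy s by linarith
    have eq: "1 - (norm z)\<^sup>2 = (c - x) * (c + x)"
      unfolding n2 using c2 by (simp add: algebra_simps power2_eq_square)
    have "(1 - (norm z)\<^sup>2) powr \<alpha> \<le> 2 powr \<bar>\<alpha>\<bar> * (c - x) powr \<alpha>"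
      unfolding eq using \<open>x < c\<close> c1 x1 by (intro powr_le_powr_mult) auto
    then have "1 / pi * ((1 + \<alpha>) * (1 - (norm z)\<^sup>2) powr \<alpha>) \<le> 1 / pi * ((1 + \<alpha>) * (2 powr \<bar>\<alpha>\<bar> * (c - x) powr \<alpha>))"
      using \<alpha> by (intro mult_left_mono) auto
    then have "ennreal (1 / pi * ((1 + \<alpha>) * (1 - (norm z)\<^sup>2) powr \<alpha>)) \<le> ennreal (K * (c - x) powr \<alpha>)"
      by (intro ennreal_leI) (simp add: K_def mult_ac)
    then have "disc_weight \<alpha> z \<le> ennreal K * ennreal ((c - x) powr \<alpha>)"
      using z \<alpha> K by (simp add: disc_weight_def flip: ennreal_mult'')
    moreover have "h y x = ennreal K * ennreal ((c - x) powr \<alpha>)"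
      using xy \<open>x < c\<close> c1 by (auto simp: h_def c_def[symmetric] indicator_def)
    ultimately show ?thesis using True by (simp add: x_def y_def)
  qed auto
  have [measurable]: "(\<lambda>z. h (Im z) (Re z)) \<in> borel_measurable borel"
    unfolding h_def indicator_def atLeastAtMost_iff by measurable
  have inner: "(\<integral>\<^sup>+x. h y x \<partial>lborel) = ennreal (K * (s powr (\<alpha> + 1) / (\<alpha> + 1))) * indicator {- s..s} y" for y
  proof -
    have "(\<integral>\<^sup>+x. h y x \<partial>lborel) = ennreal K * indicator {- s..s} y * ennreal (s powr (\<alpha> + 1) / (\<alpha> + 1))"
      unfolding h_def using nn_integral_powr_reflect[OF \<alpha> s(1), of "sqrt (1 - y\<^sup>2)"]
      by (subst nn_integral_cmult) auto
    moreover have "ennreal (K * (s powr (\<alpha> + 1) / (\<alpha> + 1))) = ennreal K * ennreal (s powr (\<alpha> + 1) / (\<alpha> + 1))"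
      using K \<alpha> by (intro ennreal_mult) auto
    ultimately show ?thesis by (simp only: mult_ac)
  qed
  have "emeasure (weighted_area_measure \<alpha>) (ball 1 s \<inter> ball 0 1) = (\<integral>\<^sup>+z. indicator (ball 1 s \<inter> ball 0 1) z * disc_weight \<alpha> z \<partial>lborel)"
    by (rule emeasure_weighted_area) auto
  also have "\<dots> \<le> (\<integral>\<^sup>+z. h (Im z) (Re z) \<partial>lborel)"
    by (intro nn_integral_mono pt)
  also have "\<dots> = (\<integral>\<^sup>+y. \<integral>\<^sup>+x. h y x \<partial>lborel \<partial>lborel)"
    by (subst nn_integral_complex) auto
  also have "\<dots> = ennreal (K * (s powr (\<alpha> + 1) / (\<alpha> + 1))) * ennreal (2 * s)"
    unfolding inner using s by (subst nn_integral_cmult) auto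
  also have "\<dots> = ennreal (K * (s powr (\<alpha> + 1) / (\<alpha> + 1)) * (2 * s))"
    using K \<alpha> s by (intro ennreal_mult[symmetric]) auto
  also have "K * (s powr (\<alpha> + 1) / (\<alpha> + 1)) * (2 * s) = C * s powr (\<alpha> + 2)"
  proof -
    have "K / (\<alpha> + 1) = 2 powr \<bar>\<alpha>\<bar> / pi"
      using \<alpha> by (simp add: K_def add.commute)
    moreover have "s powr (\<alpha> + 2) = s powr (\<alpha> + 1) * s"
      using s powr_add[of s "\<alpha> + 1" 1] by (simp add: add.commute add.left_commute)
    moreover have "K * (s powr (\<alpha> + 1) / (\<alpha> + 1)) * (2 * s) = K / (\<alpha> + 1) * 2 * (s powr (\<alpha> + 1) * s)"
      by simp
    ultimately show ?thesis by (simp add: C_def)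
  qed
  finally show "emeasure (weighted_area_measure \<alpha>) (ball 1 s \<inter> ball 0 1) \<le> ennreal (C * s powr (\<alpha> + 2))" .
qed

text \<open>A neighbourhood of the circle is covered by finitely many rotated copies of the ball of
  radius 1/2 at 1, whose measure is already estimated; on the remaining part, |z| < 3/4, the weight
  is bounded.\<close>

lemma finite_weighted_area:
  assumes \<alpha>: "\<alpha> > -1"
  shows "finite_measure (weighted_area_measure \<alpha>)"
proof (rule finite_measureI)
  let ?W = "weighted_area_measure \<alpha>"
  have sW: "A \<inter> ball 0 1 \<in> sets ?W" if "A \<in> sets borel" for A
    unfolding sets_weighted_area using that by (auto simp: sets_restrict_space_iff)
  obtain C where C: "C \<ge> 0" "\<And>s. 0 < s \<Longrightarrow> s \<le> 1 / 2 \<Longrightarrow>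
      emeasure ?W (ball 1 s \<inter> ball 0 1) \<le> ennreal (C * s powr (\<alpha> + 2))"
    using emeasure_weighted_area_ball[OF \<alpha>] by blast
  have fin1: "emeasure ?W (ball \<zeta> (1 / 2) \<inter> ball 0 1) < \<infinity>" if "norm \<zeta> = 1" for \<zeta>
  proof -
    have "emeasure ?W (ball \<zeta> (1 / 2) \<inter> ball 0 1) = (\<integral>\<^sup>+z. indicator (ball \<zeta> (1 / 2) \<inter> ball 0 1) z \<partial>?W)"
      using sW[of "ball \<zeta> (1 / 2)"] by simp
    also have "\<dots> = (\<integral>\<^sup>+z. indicator (ball \<zeta> (1 / 2) \<inter> ball 0 1) (\<zeta> * z) \<partial>?W)"
      using sW[of "ball \<zeta> (1 / 2)"] that by (intro nn_integral_weighted_area_rotate[symmetric]) auto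
    also have "\<dots> = (\<integral>\<^sup>+z. indicator (ball 1 (1 / 2) \<inter> ball 0 1) z \<partial>?W)"
    proof (rule nn_integral_cong)
      fix z
      have "dist \<zeta> (\<zeta> * z) = norm (\<zeta> * (1 - z))" by (simp add: dist_norm algebra_simps)
      also have "\<dots> = dist 1 z" using that by (simp add: norm_mult dist_norm)
      finally show "indicator (ball \<zeta> (1 / 2) \<inter> ball 0 1) (\<zeta> * z) = (indicator (ball 1 (1 / 2) \<inter> ball 0 1) z :: ennreal)"
        using that by (simp add: indicator_def norm_mult)
    qed
    also have "\<dots> = emeasure ?W (ball 1 (1 / 2) \<inter> ball 0 1)"
      using sW[of "ball 1 (1 / 2)"] by simp
    also have "\<dots> < \<infinity>" using C(2)[of "1 / 2"] by (auto intro: le_less_trans)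
    finally show ?thesis .
  qed
  \<comment> \<open>A net of mesh 1/4 on the circle suffices for balls of radius 1/2: a point with
    |z| \<ge> 3/4 is within 1/4 of its radial projection.\<close>
  have "sphere 0 1 \<subseteq> (\<Union>\<zeta>\<in>sphere (0::complex) 1. ball \<zeta> (1 / 4))"
    by force
  then obtain T where T: "T \<subseteq> sphere (0::complex) 1" "finite T" "sphere 0 1 \<subseteq> (\<Union>\<zeta>\<in>T. ball \<zeta> (1 / 4))"
    using compactE_image[of "sphere (0::complex) 1" "sphere 0 1" "\<lambda>\<zeta>. ball \<zeta> (1 / 4)"] by auto
  have cover: "ball 0 1 \<subseteq> (ball 0 (3 / 4) \<inter> ball 0 1) \<union> (\<Union>\<zeta>\<in>T. ball \<zeta> (1 / 2) \<inter> ball 0 1)"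
  proof
    fix z :: complex assume z: "z \<in> ball 0 1"
    show "z \<in> (ball 0 (3 / 4) \<inter> ball 0 1) \<union> (\<Union>\<zeta>\<in>T. ball \<zeta> (1 / 2) \<inter> ball 0 1)"
    proof (cases "norm z < 3 / 4")
      case False
      define e where "e = z / of_real (norm z)"
      have "e \<in> sphere 0 1" using False by (auto simp: e_def norm_divide)
      then obtain \<zeta> where \<zeta>: "\<zeta> \<in> T" "dist \<zeta> e < 1 / 4" using T(3) by auto
      have "dist e z = norm (e * (1 - of_real (norm z)))"
        using False by (auto simp: e_def dist_norm right_diff_distrib)
      also have "\<dots> = norm (1 - complex_of_real (norm z))"
        using \<open>e \<in> sphere 0 1\<close> by (simp add: norm_mult)
      also have "\<dots> = \<bar>1 - norm z\<bar>"
        by (metis norm_of_real of_real_1 of_real_diff)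
      also have "\<dots> = 1 - norm z" using z by simp
      finally have "dist e z \<le> 1 / 4" using False by simp
      then have "dist \<zeta> z < 1 / 2" using \<zeta> dist_triangle[of \<zeta> z e] by linarith
      then show ?thesis using \<zeta> z by auto
    qed (use z in auto)
  qed
  have fin0: "emeasure ?W (ball 0 (3 / 4) \<inter> ball 0 1) < \<infinity>"
  proof -
    have "emeasure ?W (ball 0 (3 / 4) \<inter> ball 0 1) = (\<integral>\<^sup>+z. indicator (ball 0 (3 / 4) \<inter> ball 0 1) z * disc_weight \<alpha> z \<partial>lborel)"
      by (rule emeasure_weighted_area) auto
    \<comment> \<open>The number 7/16 is the value of 1 - |z|^2 at |z| = 3/4 and serves negative
      \<alpha>; the summand 1 serves \<alpha> \<ge> 0.\<close>
    also have "\<dots> \<le> (\<integral>\<^sup>+z. ennreal ((1 + \<alpha>) * ((7 / 16) powr \<alpha> + 1)) * indicator (ball (0::complex) 1) z \<partial>lborel)"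
    proof (rule nn_integral_mono)
      fix z :: complex
      show "indicator (ball 0 (3 / 4) \<inter> ball 0 1) z * disc_weight \<alpha> z \<le> ennreal ((1 + \<alpha>) * ((7 / 16) powr \<alpha> + 1)) * indicator (ball 0 1) z"
      proof (cases "z \<in> ball 0 (3 / 4) \<inter> ball 0 1")
        case True
        then have "(norm z)\<^sup>2 \<le> (3 / 4)\<^sup>2" by (intro power_mono) auto
        then have n: "7 / 16 \<le> 1 - (norm z)\<^sup>2" "1 - (norm z)\<^sup>2 \<le> 1" by (auto simp: power2_eq_square)
        have "(1 - (norm z)\<^sup>2) powr \<alpha> \<le> (7 / 16) powr \<alpha> + 1"
        proof (cases "\<alpha> \<ge> 0")
          case True
          have "(1 - (norm z)\<^sup>2) powr \<alpha> \<le> 1 powr \<alpha>"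
            using n True by (intro powr_mono2) auto
          then show ?thesis by (simp add: add_increasing)
        next
          case False
          then show ?thesis using n powr_mono2'[of \<alpha> "7 / 16" "1 - (norm z)\<^sup>2"] by simp
        qed
        then have "1 / pi * ((1 + \<alpha>) * (1 - (norm z)\<^sup>2) powr \<alpha>) \<le> 1 * ((1 + \<alpha>) * ((7 / 16) powr \<alpha> + 1))"
          using \<alpha> pi_ge_two by (intro mult_mono) auto
        then have "ennreal (1 / pi * ((1 + \<alpha>) * (1 - (norm z)\<^sup>2) powr \<alpha>)) \<le> ennreal ((1 + \<alpha>) * ((7 / 16) powr \<alpha> + 1))"
          by (intro ennreal_leI) simp
        then show ?thesis using True \<alpha> by (simp add: disc_weight_def flip: ennreal_mult'')
      qed auto
    qed
    also have "\<dots> = ennreal ((1 + \<alpha>) * ((7 / 16) powr \<alpha> + 1)) * emeasure lborel (ball (0::complex) 1)"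
      by (rule nn_integral_cmult_indicator) auto
    also have "\<dots> < \<infinity>" using emeasure_lborel_ball_finite[of "0::complex" 1] by (simp add: ennreal_mult_less_top)
    finally show ?thesis .
  qed
  have "emeasure ?W (space ?W) \<le> emeasure ?W ((ball 0 (3 / 4) \<inter> ball 0 1) \<union> (\<Union>\<zeta>\<in>T. ball \<zeta> (1 / 2) \<inter> ball 0 1))"
    using cover sW T by (intro emeasure_mono sets.Un sets.finite_UN) auto
  also have "\<dots> \<le> emeasure ?W (ball 0 (3 / 4) \<inter> ball 0 1) + (\<Sum>\<zeta>\<in>T. emeasure ?W (ball \<zeta> (1 / 2) \<inter> ball 0 1))"
    using sW T by (intro order_trans[OF emeasure_subadditive] add_mono order_refl emeasure_subadditive_finite sets.finite_UN) auto
  also have "\<dots> < \<infinity>"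
    using fin0 fin1 T by (auto simp: ennreal_add_eq_top less_top[symmetric] subset_eq)
  finally show "emeasure ?W (space ?W) \<noteq> \<infinity>" by simp
qed

subsection \<open>Lp seminorms\<close>

lemma powr_add_le:
  fixes a b p :: real
  assumes "a \<ge> 0" "b \<ge> 0" "p \<ge> 0"
  shows "(a + b) powr p \<le> 2 powr p * (a powr p + b powr p)"
proof -
  have "(a + b) powr p \<le> (2 * max a b) powr p"
    using assms by (intro powr_mono2) auto
  also have "\<dots> = 2 powr p * (max a b) powr p"
    using assms by (simp add: powr_mult)
  also have "\<dots> \<le> 2 powr p * (a powr p + b powr p)"
    by (intro mult_left_mono) (auto simp: max_def)
  finally show ?thesis .
qed

text \<open>Extends the convexity on the open half-line to the endpoint 0, where it amounts to t^p
  \<le> t for 0 < t < 1.\<close>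

lemma convex_on_powr_nonneg:
  fixes p :: real
  assumes p: "p \<ge> 1"
  shows "convex_on {0..} (\<lambda>x. x powr p)"
proof (rule convex_onI)
  have scale: "(t * x) powr p \<le> t * x powr p" if "0 < t" "t < 1" "x \<ge> 0" for t x :: real
  proof -
    have "t powr p \<le> t powr 1" using that p by (intro powr_mono') auto
    then have "t powr p * x powr p \<le> t * x powr p" using that by (intro mult_right_mono) auto
    then show ?thesis using that by (simp add: powr_mult)
  qed
  fix t x y :: real assume t: "0 < t" "t < 1" and "x \<in> {0..}" "y \<in> {0..}"
  then consider "x > 0" "y > 0" | "x = 0" "y \<ge> 0" | "x \<ge> 0" "y = 0" by fastforce
  then show "((1 - t) *\<^sub>R x + t *\<^sub>R y) powr p \<le> (1 - t) * x powr p + t * y powr p"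
  proof cases
    case 1
    then show ?thesis
      using convex_onD[OF powr_convex[OF p], of t x y] t by simp
  next
    case 2
    then show ?thesis using scale[of t y] t p by simp
  next
    case 3
    then show ?thesis using scale[of "1 - t" x] t p by simp
  qed
qed simp

lemma convex_powr:
  fixes a b p x y :: real
  assumes "p \<ge> 1" "a \<ge> 0" "b \<ge> 0" "x \<ge> 0" "y \<ge> 0" "a + b = 1"
  shows "(a * x + b * y) powr p \<le> a * x powr p + b * y powr p"
  using convex_onD[OF convex_on_powr_nonneg[OF assms(1)], of b x y] assms
  by (simp add: eq_diff_eq[symmetric])

text \<open>Built on the Bochner integral, which is 0 for a non-integrable integrand; comparisons
  such as \<open>Lp_minkowski\<close> and \<open>Lp_norm_mono\<close> therefore carry integrability
  assumptions.\<close>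

definition Lp_norm :: "'a measure \<Rightarrow> real \<Rightarrow> ('a \<Rightarrow> real) \<Rightarrow> real" where
  "Lp_norm M p u = (\<integral>x. \<bar>u x\<bar> powr p \<partial>M) powr (1 / p)"

lemma Lp_norm_nonneg [simp]: "0 \<le> Lp_norm M p u"
  by (simp add: Lp_norm_def)

lemma Lp_norm_powr:
  assumes "p > 0"
  shows "Lp_norm M p u powr p = (\<integral>x. \<bar>u x\<bar> powr p \<partial>M)"
  using assms by (simp add: Lp_norm_def powr_powr)

lemma Lp_norm_leI:
  assumes "p > 0" "C \<ge> 0" "(\<integral>x. \<bar>u x\<bar> powr p \<partial>M) \<le> C powr p"
  shows "Lp_norm M p u \<le> C"
proof -
  have "Lp_norm M p u \<le> (C powr p) powr (1 / p)"
    unfolding Lp_norm_def using assms by (intro powr_mono2) auto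
  then show ?thesis using assms by (simp add: powr_powr)
qed

lemma Lp_norm_scale:
  assumes "p > 0"
  shows "Lp_norm M p (\<lambda>x. c * u x) = \<bar>c\<bar> * Lp_norm M p u"
  using assms by (simp add: Lp_norm_def abs_mult powr_mult powr_powr)

lemma Lp_integrable_add:
  fixes u v :: "'a \<Rightarrow> real" and p :: real
  assumes p: "p \<ge> 1" and [measurable]: "u \<in> borel_measurable M" "v \<in> borel_measurable M"
    and u: "integrable M (\<lambda>x. \<bar>u x\<bar> powr p)" and v: "integrable M (\<lambda>x. \<bar>v x\<bar> powr p)"
  shows "integrable M (\<lambda>x. \<bar>u x + v x\<bar> powr p)"
proof (rule Bochner_Integration.integrable_bound)
  show "integrable M (\<lambda>x. 2 powr p * (\<bar>u x\<bar> powr p + \<bar>v x\<bar> powr p))"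
    using u v by auto
  have "\<bar>u x + v x\<bar> powr p \<le> 2 powr p * (\<bar>u x\<bar> powr p + \<bar>v x\<bar> powr p)" for x
    using p powr_add_le[of "\<bar>u x\<bar>" "\<bar>v x\<bar>" p] powr_mono2[of p "\<bar>u x + v x\<bar>" "\<bar>u x\<bar> + \<bar>v x\<bar>"]
    by fastforce
  then show "AE x in M. norm (\<bar>u x + v x\<bar> powr p) \<le> norm (2 powr p * (\<bar>u x\<bar> powr p + \<bar>v x\<bar> powr p))"
    by simp
qed measurable

text \<open>For a and b strictly above the two norms, u + v is a + b times a convex combination of u
  / a and v / b, and convexity of the power bounds its p-th moment by (a + b)^p. Strictness keeps a
  and b positive when a norm is 0.\<close>

lemma Lp_minkowski:
  assumes p: "p \<ge> 1" and [measurable]: "u \<in> borel_measurable M" "v \<in> borel_measurable M"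
    and u: "integrable M (\<lambda>x. \<bar>u x\<bar> powr p)" and v: "integrable M (\<lambda>x. \<bar>v x\<bar> powr p)"
  shows "Lp_norm M p (\<lambda>x. u x + v x) \<le> Lp_norm M p u + Lp_norm M p v"
proof -
  have key: "Lp_norm M p (\<lambda>x. u x + v x) \<le> a + b" if a: "Lp_norm M p u < a" and b: "Lp_norm M p v < b" for a b
  proof -
    have ab: "a > 0" "b > 0"
      using a b Lp_norm_nonneg[of M p u] Lp_norm_nonneg[of M p v] by linarith+
    have pt: "\<bar>u x + v x\<bar> powr p \<le> (a + b) powr p * (a / (a + b) * (\<bar>u x\<bar> powr p / a powr p) + b / (a + b) * (\<bar>v x\<bar> powr p / b powr p))" for x
    proof -
      have "\<bar>u x + v x\<bar> powr p \<le> (\<bar>u x\<bar> + \<bar>v x\<bar>) powr p"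
        using p by (intro powr_mono2) auto
      also have "\<bar>u x\<bar> + \<bar>v x\<bar> = (a + b) * (a / (a + b) * (\<bar>u x\<bar> / a) + b / (a + b) * (\<bar>v x\<bar> / b))"
        using ab by (simp flip: add_divide_distrib)
      also have "\<dots> powr p = (a + b) powr p * (a / (a + b) * (\<bar>u x\<bar> / a) + b / (a + b) * (\<bar>v x\<bar> / b)) powr p"
        by (rule powr_mult)
      also have "\<dots> \<le> (a + b) powr p * (a / (a + b) * (\<bar>u x\<bar> / a) powr p + b / (a + b) * (\<bar>v x\<bar> / b) powr p)"
        using ab p by (intro mult_left_mono convex_powr) (auto simp flip: add_divide_distrib)
      finally show ?thesis using ab by (simp add: powr_divide)
    qed
    have iu: "(\<integral>x. \<bar>u x\<bar> powr p \<partial>M) / a powr p \<le> 1"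
      using a p ab powr_mono2[of p "Lp_norm M p u" a] by (simp add: Lp_norm_powr)
    have iv: "(\<integral>x. \<bar>v x\<bar> powr p \<partial>M) / b powr p \<le> 1"
      using b p ab powr_mono2[of p "Lp_norm M p v" b] by (simp add: Lp_norm_powr)
    have "(\<integral>x. \<bar>u x + v x\<bar> powr p \<partial>M) \<le>
      (\<integral>x. (a + b) powr p * (a / (a + b) * (\<bar>u x\<bar> powr p / a powr p) + b / (a + b) * (\<bar>v x\<bar> powr p / b powr p)) \<partial>M)"
      using u v pt by (intro integral_mono Lp_integrable_add p) auto
    also have "\<dots> = (a + b) powr p * (a / (a + b) * ((\<integral>x. \<bar>u x\<bar> powr p \<partial>M) / a powr p) + b / (a + b) * ((\<integral>x. \<bar>v x\<bar> powr p \<partial>M) / b powr p))"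
      using u v by simp
    also have "\<dots> \<le> (a + b) powr p * (a / (a + b) * 1 + b / (a + b) * 1)"
      using ab iu iv by (intro mult_left_mono add_mono) auto
    also have "\<dots> = (a + b) powr p"
      using ab by (simp flip: add_divide_distrib)
    finally show ?thesis
      using ab p by (intro Lp_norm_leI) auto
  qed
  show ?thesis
  proof (rule field_le_epsilon)
    fix e :: real assume "e > 0"
    then show "Lp_norm M p (\<lambda>x. u x + v x) \<le> Lp_norm M p u + Lp_norm M p v + e"
      using key[of "Lp_norm M p u + e / 2" "Lp_norm M p v + e / 2"] by simp
  qed
qed

lemma Lp_norm_mono:
  assumes p: "p > 0" and "integrable M (\<lambda>x. \<bar>v x\<bar> powr p)" and [measurable]: "u \<in> borel_measurable M"
    and le: "\<And>x. x \<in> space M \<Longrightarrow> \<bar>u x\<bar> \<le> v x"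
  shows "integrable M (\<lambda>x. \<bar>u x\<bar> powr p)" "Lp_norm M p u \<le> Lp_norm M p v"
proof -
  have pt: "\<bar>u x\<bar> powr p \<le> \<bar>v x\<bar> powr p" if "x \<in> space M" for x
    using le[OF that] p by (intro powr_mono2) auto
  show i: "integrable M (\<lambda>x. \<bar>u x\<bar> powr p)"
    by (rule Bochner_Integration.integrable_bound[OF assms(2)]) (use pt in auto)
  show "Lp_norm M p u \<le> Lp_norm M p v"
    unfolding Lp_norm_def using p by (intro powr_mono2 integral_mono i assms(2) pt) auto
qed

text \<open>Fatou's lemma is applied to \<open>2\<^sup>p (\<bar>g\<^sub>n\<bar>\<^sup>p + \<bar>g\<bar>\<^sup>p) - \<bar>g\<^sub>n - g\<bar>\<^sup>p \<ge> 0\<close>.\<close>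

lemma Lp_tendsto_of_norm_le:
  fixes g :: "'a \<Rightarrow> complex"
  assumes p: "p > 0" and [measurable]: "\<And>n. G n \<in> borel_measurable M" "g \<in> borel_measurable M"
    and iG: "\<And>n. integrable M (\<lambda>x. norm (G n x) powr p)" and ig: "integrable M (\<lambda>x. norm (g x) powr p)"
    and le: "\<And>n. (\<integral>x. norm (G n x) powr p \<partial>M) \<le> (\<integral>x. norm (g x) powr p \<partial>M)"
    and lim: "\<And>x. x \<in> space M \<Longrightarrow> (\<lambda>n. G n x) \<longlonglongrightarrow> g x"
  shows "(\<lambda>n. \<integral>x. norm (G n x - g x) powr p \<partial>M) \<longlonglongrightarrow> 0"
proof -
  define a where "a = (\<lambda>n x. 2 powr p * (norm (G n x) powr p + norm (g x) powr p) - norm (G n x - g x) powr p)"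
  define I where "I = (\<integral>x. norm (g x) powr p \<partial>M)"
  have pt: "norm (G n x - g x) powr p \<le> 2 powr p * (norm (G n x) powr p + norm (g x) powr p)" for n x
    using p powr_add_le[of "norm (G n x)" "norm (g x)" p] norm_triangle_ineq4[of "G n x" "g x"]
      powr_mono2[of p "norm (G n x - g x)" "norm (G n x) + norm (g x)"] by fastforce
  have id: "integrable M (\<lambda>x. norm (G n x - g x) powr p)" for n
    by (rule Bochner_Integration.integrable_bound[of _ "\<lambda>x. 2 powr p * (norm (G n x) powr p + norm (g x) powr p)"])
       (use iG ig pt in auto)
  have a0: "a n x \<ge> 0" for n x using pt[of n x] by (simp add: a_def)
  have ia: "integrable M (a n)" for n
    unfolding a_def using iG ig id by auto
  have am: "a n \<in> borel_measurable M" for n using ia by auto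
  define e where "e = (\<lambda>n. \<integral>x. norm (G n x - g x) powr p \<partial>M)"
  have inta: "(\<integral>x. a n x \<partial>M) \<le> 2 * 2 powr p * I - e n" for n
  proof -
    have "(\<integral>x. a n x \<partial>M) = 2 powr p * ((\<integral>x. norm (G n x) powr p \<partial>M) + I) - e n"
      unfolding a_def e_def I_def using iG ig id by simp
    also have "\<dots> \<le> 2 powr p * (I + I) - e n"
      using le[of n] by (simp add: I_def)
    finally show ?thesis by simp
  qed
  have alim: "(\<lambda>n. a n x) \<longlonglongrightarrow> 2 * 2 powr p * norm (g x) powr p" if "x \<in> space M" for x
  proof -
    have "(\<lambda>n. a n x) \<longlonglongrightarrow> 2 powr p * (norm (g x) powr p + norm (g x) powr p) - norm (g x - g x) powr p"
      unfolding a_def using p lim[OF that] by (intro tendsto_intros) auto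
    then show ?thesis using p by (simp add: mult_ac)
  qed
  have "ennreal (2 * 2 powr p * I) = (\<integral>\<^sup>+x. ennreal (2 * 2 powr p * norm (g x) powr p) \<partial>M)"
    unfolding I_def using ig by (subst nn_integral_eq_integral) auto
  also have "\<dots> = (\<integral>\<^sup>+x. liminf (\<lambda>n. ennreal (a n x)) \<partial>M)"
  proof (rule nn_integral_cong)
    fix x assume "x \<in> space M"
    then have "(\<lambda>n. ennreal (a n x)) \<longlonglongrightarrow> ennreal (2 * 2 powr p * norm (g x) powr p)"
      using alim by (intro tendsto_ennrealI)
    then show "ennreal (2 * 2 powr p * norm (g x) powr p) = liminf (\<lambda>n. ennreal (a n x))"
      by (simp add: lim_imp_Liminf)
  qed
  also have "\<dots> \<le> liminf (\<lambda>n. \<integral>\<^sup>+x. ennreal (a n x) \<partial>M)"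
    using am by (intro nn_integral_liminf) auto
  also have "\<dots> = liminf (\<lambda>n. ennreal (\<integral>x. a n x \<partial>M))"
    using ia a0 by (simp add: nn_integral_eq_integral)
  finally have lim: "ennreal (2 * 2 powr p * I) \<le> liminf (\<lambda>n. ennreal (\<integral>x. a n x \<partial>M))" .
  have e0: "e n \<ge> 0" for n by (simp add: e_def)
  \<comment> \<open>Since \<open>ennreal\<close> clips negative reals to 0, the lower bound on the
    liminf can be read off in the reals only if 2 * 2^p I - \<epsilon> is nonnegative; otherwise the
    claim already follows from a \<ge> 0.\<close>
  have "eventually (\<lambda>n. e n < \<epsilon>) sequentially" if \<epsilon>: "\<epsilon> > 0" for \<epsilon>
  proof (cases "2 * 2 powr p * I - \<epsilon> < 0")
    case True
    have "e n < \<epsilon>" for n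
    proof -
      have "0 \<le> (\<integral>x. a n x \<partial>M)" using a0 by simp
      then show ?thesis using inta[of n] True by linarith
    qed
    then show ?thesis by simp
  next
    case False
    then have "ennreal (2 * 2 powr p * I - \<epsilon>) < ennreal (2 * 2 powr p * I)"
      using \<epsilon> by (intro ennreal_lessI) linarith+
    then have "ennreal (2 * 2 powr p * I - \<epsilon>) < liminf (\<lambda>n. ennreal (\<integral>x. a n x \<partial>M))"
      using lim by (rule less_le_trans)
    then have "eventually (\<lambda>n. ennreal (2 * 2 powr p * I - \<epsilon>) < ennreal (\<integral>x. a n x \<partial>M)) sequentially"
      by (simp add: less_LiminfD)
    then show ?thesis
    proof eventually_elim
      case (elim n)
      then have "2 * 2 powr p * I - \<epsilon> < (\<integral>x. a n x \<partial>M)"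
        using False by (simp add: ennreal_less_iff)
      then show ?case using inta[of n] by linarith
    qed
  qed
  then show ?thesis
    unfolding e_def[symmetric] using e0 by (intro order_tendstoI) (auto intro: always_eventually less_le_trans)
qed

subsection \<open>Besov-Dirichlet spaces\<close>

lemma powr_add_superadditive:
  fixes a b p :: real
  assumes "a \<ge> 0" "b \<ge> 0" "p \<ge> 1"
  shows "a powr p + b powr p \<le> (a + b) powr p"
proof -
  have *: "x powr p \<le> x * (a + b) powr (p - 1)" if "0 \<le> x" "x \<le> a + b" for x
  proof (cases "x = 0")
    case False
    have "x powr p = x * x powr (p - 1)"
      using that False powr_add[of x 1 "p - 1"] by simp
    also have "\<dots> \<le> x * (a + b) powr (p - 1)"
      using that assms by (intro mult_left_mono powr_mono2) auto
    finally show ?thesis .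
  qed (use assms in auto)
  have "a powr p + b powr p \<le> (a + b) * (a + b) powr (p - 1)"
    using *[of a] *[of b] assms by (simp add: algebra_simps)
  also have "\<dots> = (a + b) powr p"
    using assms powr_add[of "a + b" 1 "p - 1"] by (cases "a + b = 0") auto
  finally show ?thesis .
qed

locale besov =
  fixes p \<alpha> :: real
  assumes alpha: "\<alpha> > -1" and p: "p > 1"
begin

abbreviation W :: "complex measure" where "W \<equiv> weighted_area_measure \<alpha>"
abbreviation V :: "(complex \<Rightarrow> complex) set" where "V \<equiv> besov_dirichlet p \<alpha>"
abbreviation disc :: "complex set" where "disc \<equiv> ball 0 1"

definition seminorm :: "(complex \<Rightarrow> complex) \<Rightarrow> real" where
  "seminorm g = Lp_norm W p (\<lambda>z. norm (deriv g z))"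

text \<open>An equivalent norm, whose triangle inequality comes directly from Minkowski's.
  Convergence is proved in it and passed on to \<open>besov_dirichlet_norm\<close>, which defines
  closedness, by domination.\<close>

definition sum_norm :: "(complex \<Rightarrow> complex) \<Rightarrow> real" where
  "sum_norm g = norm (g 0) + seminorm g"

text \<open>The p-th root of the total mass of the measure, and the seminorm of the identity
  function; a derivative bounded by c gives a seminorm of at most c times this.\<close>

definition mass :: real where
  "mass = Lp_norm W p (\<lambda>z. 1)"

lemma seminorm_nonneg [simp]: "0 \<le> seminorm g"
  by (simp add: seminorm_def)

lemma mass_nonneg [simp]: "0 \<le> mass"
  by (simp add: mass_def)

lemma sum_norm_nonneg [simp]: "0 \<le> sum_norm g"
  by (simp add: sum_norm_def)

lemma finite_W: "finite_measure W"
  by (rule finite_weighted_area[OF alpha])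

lemma integrable_const_W [simp]: "integrable W (\<lambda>z. c :: real)"
  by (rule finite_measure.integrable_const[OF finite_W])

lemma measurable_W_continuous:
  "continuous_on disc g \<Longrightarrow> g \<in> borel_measurable W"
  unfolding measurable_cong_sets[OF sets_weighted_area refl]
  by (rule borel_measurable_continuous_on_restrict)

lemma measurable_W_deriv: "g holomorphic_on disc \<Longrightarrow> deriv g \<in> borel_measurable W"
  by (intro measurable_W_continuous holomorphic_on_imp_continuous_on holomorphic_deriv) auto

lemma deriv_cong_disc:
  assumes "\<And>z. z \<in> disc \<Longrightarrow> g z = h z" "z \<in> disc"
  shows "deriv g z = deriv h z"
  by (rule deriv_cong_ev) (use assms eventually_nhds_in_open[of disc z] in \<open>auto elim: eventually_mono\<close>)

lemma V_iff: "g \<in> V \<longleftrightarrow> g holomorphic_on disc \<and> integrable W (\<lambda>z. norm (deriv g z) powr p)"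
proof -
  have "dirichlet_integral p \<alpha> g < \<infinity> \<longleftrightarrow> integrable W (\<lambda>z. norm (deriv g z) powr p)" if "g holomorphic_on disc"
    using measurable_W_deriv[OF that] by (simp add: dirichlet_integral_def integrable_iff_bounded)
  then show ?thesis by (auto simp: besov_dirichlet_def)
qed

lemma V_holomorphic: "g \<in> V \<Longrightarrow> g holomorphic_on disc"
  by (simp add: V_iff)

lemma V_integrable: "g \<in> V \<Longrightarrow> integrable W (\<lambda>z. norm (deriv g z) powr p)"
  by (simp add: V_iff)

lemma V_field_differentiable: "g \<in> V \<Longrightarrow> z \<in> disc \<Longrightarrow> g field_differentiable at z"
  using V_holomorphic holomorphic_on_imp_differentiable_at open_ball by blast

lemma seminorm_powr: "seminorm g powr p = (\<integral>z. norm (deriv g z) powr p \<partial>W)"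
  unfolding seminorm_def using p by (subst Lp_norm_powr) auto

lemma besov_dirichlet_norm_le:
  assumes "g \<in> V"
  shows "besov_dirichlet_norm p \<alpha> g \<le> sum_norm g"
proof -
  have "dirichlet_integral p \<alpha> g = ennreal (seminorm g powr p)"
    unfolding dirichlet_integral_def seminorm_powr
    using V_integrable[OF assms] by (intro nn_integral_eq_integral) auto
  then have "besov_dirichlet_norm p \<alpha> g = (norm (g 0) powr p + seminorm g powr p) powr (1 / p)"
    by (simp add: besov_dirichlet_norm_def)
  also have "\<dots> \<le> ((norm (g 0) + seminorm g) powr p) powr (1 / p)"
    using p by (intro powr_mono2 powr_add_superadditive) auto
  also have "\<dots> = sum_norm g"
    using p by (simp add: powr_powr sum_norm_def)
  finally show ?thesis .
qed

text \<open>A pointwise bound on the derivative gives membership and a seminorm bound together, by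
  monotonicity and Minkowski's inequality. Sums, products, reciprocals and difference quotients are
  all handled through it.\<close>

lemma V_dominated:
  assumes g: "g holomorphic_on disc" and h: "h1 \<in> V" "h2 \<in> V" and abc: "a \<ge> 0" "b \<ge> 0" "c \<ge> 0"
    and le: "\<And>z. z \<in> disc \<Longrightarrow> norm (deriv g z) \<le> a * norm (deriv h1 z) + b * norm (deriv h2 z) + c"
  shows "g \<in> V" "seminorm g \<le> a * seminorm h1 + b * seminorm h2 + c * mass"
proof -
  define u1 u2 where "u1 = (\<lambda>z. a * norm (deriv h1 z))" and "u2 = (\<lambda>z. b * norm (deriv h2 z))"
  have [measurable]: "deriv g \<in> borel_measurable W" "deriv h1 \<in> borel_measurable W" "deriv h2 \<in> borel_measurable W"
    using g h by (auto intro!: measurable_W_deriv V_holomorphic)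
  have [measurable]: "u1 \<in> borel_measurable W" "u2 \<in> borel_measurable W"
    unfolding u1_def u2_def by auto
  have i1: "integrable W (\<lambda>z. \<bar>u1 z\<bar> powr p)" and i2: "integrable W (\<lambda>z. \<bar>u2 z\<bar> powr p)"
    using V_integrable[OF h(1)] V_integrable[OF h(2)] abc by (auto simp: u1_def u2_def abs_mult powr_mult)
  have i12: "integrable W (\<lambda>z. \<bar>u1 z + u2 z\<bar> powr p)"
    using p by (intro Lp_integrable_add i1 i2) auto
  have i3: "integrable W (\<lambda>z. \<bar>c\<bar> powr p)" by simp
  have i: "integrable W (\<lambda>z. \<bar>u1 z + u2 z + c\<bar> powr p)"
    using p by (intro Lp_integrable_add[where u = "\<lambda>z. u1 z + u2 z" and v = "\<lambda>z. c"] i12 i3) auto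
  have le': "\<bar>norm (deriv g z)\<bar> \<le> u1 z + u2 z + c" if "z \<in> space W" for z
    using le[of z] that by (simp add: u1_def u2_def)
  have m: "(\<lambda>z. norm (deriv g z)) \<in> borel_measurable W" by measurable
  have p0: "p > 0" and p1: "p \<ge> 1" using p by auto
  show "g \<in> V"
    using Lp_norm_mono(1)[OF p0 i m le'] g by (simp add: V_iff)
  have "seminorm g \<le> Lp_norm W p (\<lambda>z. u1 z + u2 z + c)"
    unfolding seminorm_def by (rule Lp_norm_mono(2)[OF p0 i m le'])
  also have "\<dots> \<le> Lp_norm W p (\<lambda>z. u1 z + u2 z) + Lp_norm W p (\<lambda>z. c)"
    by (rule Lp_minkowski[OF p1 _ _ i12 i3]) auto
  also have "Lp_norm W p (\<lambda>z. u1 z + u2 z) \<le> Lp_norm W p u1 + Lp_norm W p u2"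
    by (rule Lp_minkowski[OF p1 _ _ i1 i2]) auto
  also have "Lp_norm W p u1 = a * seminorm h1"
    unfolding u1_def seminorm_def using abc by (simp add: Lp_norm_scale[OF p0])
  also have "Lp_norm W p u2 = b * seminorm h2"
    unfolding u2_def seminorm_def using abc by (simp add: Lp_norm_scale[OF p0])
  also have "Lp_norm W p (\<lambda>z. c) = c * mass"
    using Lp_norm_scale[OF p0, of W c "\<lambda>z. 1"] abc by (simp add: mass_def)
  finally show "seminorm g \<le> a * seminorm h1 + b * seminorm h2 + c * mass" by simp
qed

lemma V_bounded_deriv:
  assumes "g holomorphic_on disc" "c \<ge> 0" "\<And>z. z \<in> disc \<Longrightarrow> norm (deriv g z) \<le> c"
  shows "g \<in> V" "seminorm g \<le> c * mass"
proof -
  have "(\<lambda>z. 0) \<in> V" using p by (simp add: V_iff)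
  then show "g \<in> V" "seminorm g \<le> c * mass"
    using V_dominated[of g "\<lambda>z. 0" "\<lambda>z. 0" 0 0 c] assms by auto
qed

sublocale function_space V
proof
  show "(\<lambda>z. 0) \<in> V" using p by (simp add: V_iff)
  show "(\<lambda>z. g z + h z) \<in> V" if "g \<in> V" "h \<in> V" for g h
  proof (rule V_dominated(1)[of _ g h 1 1 0])
    show "(\<lambda>z. g z + h z) holomorphic_on disc"
      using that by (intro holomorphic_intros V_holomorphic)
    show "norm (deriv (\<lambda>z. g z + h z) z) \<le> 1 * norm (deriv g z) + 1 * norm (deriv h z) + 0" if "z \<in> disc" for z
      using V_field_differentiable[OF \<open>g \<in> V\<close> that] V_field_differentiable[OF \<open>h \<in> V\<close> that]
      by (simp add: norm_triangle_ineq)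
  qed (use that in auto)
  show "(\<lambda>z. c * g z) \<in> V" if "g \<in> V" for c g
  proof (rule V_dominated(1)[of _ g g "norm c" 0 0])
    show "(\<lambda>z. c * g z) holomorphic_on disc"
      using that by (intro holomorphic_intros V_holomorphic)
    show "norm (deriv (\<lambda>z. c * g z) z) \<le> norm c * norm (deriv g z) + 0 * norm (deriv g z) + 0" if "z \<in> disc" for z
      using V_field_differentiable[OF \<open>g \<in> V\<close> that] by (simp add: norm_mult)
  qed (use that in auto)
qed

lemma diff: "g \<in> V \<Longrightarrow> h \<in> V \<Longrightarrow> (\<lambda>z. g z - h z) \<in> V"
  using add[of g "\<lambda>z. - h z"] uminus[of h] by simp

lemma seminorm_add:
  assumes "g \<in> V" "h \<in> V"
  shows "seminorm (\<lambda>z. g z + h z) \<le> seminorm g + seminorm h"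
proof -
  have "norm (deriv (\<lambda>z. g z + h z) z) \<le> 1 * norm (deriv g z) + 1 * norm (deriv h z) + 0" if "z \<in> disc" for z
    using V_field_differentiable[OF \<open>g \<in> V\<close> that] V_field_differentiable[OF \<open>h \<in> V\<close> that]
    by (simp add: norm_triangle_ineq)
  then show ?thesis
    using V_dominated(2)[OF V_holomorphic[OF add[OF assms]] assms, of 1 1 0] by simp
qed

lemma seminorm_scale:
  assumes "g \<in> V"
  shows "seminorm (\<lambda>z. c * g z) = norm c * seminorm g"
proof -
  have "seminorm (\<lambda>z. c * g z) = Lp_norm W p (\<lambda>z. norm c * norm (deriv g z))"
    unfolding seminorm_def Lp_norm_def
    by (intro arg_cong[of _ _ "\<lambda>x. x powr (1 / p)"] Bochner_Integration.integral_cong refl)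
       (simp add: norm_mult V_field_differentiable[OF assms])
  then show ?thesis
    using p by (simp add: Lp_norm_scale seminorm_def)
qed

lemma sum_norm_add: "g \<in> V \<Longrightarrow> h \<in> V \<Longrightarrow> sum_norm (\<lambda>z. g z + h z) \<le> sum_norm g + sum_norm h"
  using seminorm_add[of g h] norm_triangle_ineq[of "g 0" "h 0"] by (simp add: sum_norm_def)

lemma sum_norm_scale: "g \<in> V \<Longrightarrow> sum_norm (\<lambda>z. c * g z) = norm c * sum_norm g"
  by (simp add: sum_norm_def seminorm_scale norm_mult distrib_left)

lemma V_cong:
  assumes "\<And>z. z \<in> disc \<Longrightarrow> g z = h z" "g \<in> V"
  shows "h \<in> V"
proof -
  have "h holomorphic_on disc"
    using assms V_holomorphic holomorphic_cong by (metis (no_types, lifting))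
  moreover have "norm (deriv h z) \<le> 1 * norm (deriv g z) + 0 * norm (deriv g z) + 0" if "z \<in> disc" for z
    using deriv_cong_disc[of g h z] assms that by simp
  ultimately show ?thesis
    using V_dominated(1)[of h g g 1 0 0] assms by simp
qed

lemma sum_norm_cong:
  assumes "\<And>z. z \<in> disc \<Longrightarrow> g z = h z"
  shows "sum_norm g = sum_norm h"
proof -
  have "deriv g z = deriv h z" if "z \<in> disc" for z
    using deriv_cong_disc[of g h z] assms that by simp
  then have "seminorm g = seminorm h"
    unfolding seminorm_def Lp_norm_def
    by (intro arg_cong[of _ _ "\<lambda>x. x powr (1 / p)"] Bochner_Integration.integral_cong refl) simp
  then show ?thesis using assms[of 0] by (simp add: sum_norm_def)
qed

text \<open>These functions form an algebra, because each term of the Leibniz rule is a derivative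
  times a bounded function; membership in \<open>V\<close> alone does not control such products.
  Multipliers of f and inverses modulo f are taken from here.\<close>

definition bounded_V :: "(complex \<Rightarrow> complex) set" where
  "bounded_V = {h \<in> V. \<exists>K. \<forall>z\<in>disc. norm (h z) \<le> K}"

lemma bounded_V_D: "h \<in> bounded_V \<Longrightarrow> h \<in> V"
  by (simp add: bounded_V_def)

lemma bounded_V_I: "h \<in> V \<Longrightarrow> (\<And>z. z \<in> disc \<Longrightarrow> norm (h z) \<le> K) \<Longrightarrow> h \<in> bounded_V"
  unfolding bounded_V_def by blast

lemma bounded_V_E:
  assumes "h \<in> bounded_V"
  obtains K where "K > 0" "\<And>z. z \<in> disc \<Longrightarrow> norm (h z) \<le> K"
proof -
  obtain K where K: "\<And>z. z \<in> disc \<Longrightarrow> norm (h z) \<le> K"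
    using assms unfolding bounded_V_def by blast
  show ?thesis
    by (rule that[of "\<bar>K\<bar> + 1"]) (use K in force)+
qed

lemma bounded_V_mult:
  assumes g: "g \<in> bounded_V" and h: "h \<in> bounded_V"
  shows "(\<lambda>z. g z * h z) \<in> bounded_V"
proof -
  obtain K where K: "K > 0" "\<And>z. z \<in> disc \<Longrightarrow> norm (g z) \<le> K" using bounded_V_E[OF g] by blast
  obtain L where L: "L > 0" "\<And>z. z \<in> disc \<Longrightarrow> norm (h z) \<le> L" using bounded_V_E[OF h] by blast
  have "(\<lambda>z. g z * h z) \<in> V"
  proof (rule V_dominated(1)[of _ g h L K 0])
    show "(\<lambda>z. g z * h z) holomorphic_on disc"
      using g h by (intro holomorphic_intros V_holomorphic bounded_V_D)
    fix z :: complex assume z: "z \<in> disc"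
    have "deriv (\<lambda>z. g z * h z) z = deriv g z * h z + g z * deriv h z"
      using V_field_differentiable[OF bounded_V_D[OF g] z] V_field_differentiable[OF bounded_V_D[OF h] z]
      by (simp add: algebra_simps)
    also have "norm \<dots> \<le> norm (deriv g z) * L + K * norm (deriv h z)"
      using K(2)[OF z] L(2)[OF z]
      by (intro norm_triangle_mono) (auto simp: norm_mult intro: mult_left_mono mult_right_mono)
    finally show "norm (deriv (\<lambda>z. g z * h z) z) \<le> L * norm (deriv g z) + K * norm (deriv h z) + 0"
      by (simp add: mult.commute)
  qed (use g h K L bounded_V_D in auto)
  moreover have "norm (g z * h z) \<le> K * L" if "z \<in> disc" for z
    using K(2)[OF that] L(2)[OF that] K L unfolding norm_mult by (intro mult_mono) auto
  ultimately show ?thesis by (rule bounded_V_I)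
qed

lemma bounded_V_add:
  assumes g: "g \<in> bounded_V" and h: "h \<in> bounded_V"
  shows "(\<lambda>z. g z + h z) \<in> bounded_V"
proof -
  obtain K where K: "K > 0" "\<And>z. z \<in> disc \<Longrightarrow> norm (g z) \<le> K" using bounded_V_E[OF g] by blast
  obtain L where L: "L > 0" "\<And>z. z \<in> disc \<Longrightarrow> norm (h z) \<le> L" using bounded_V_E[OF h] by blast
  have "norm (g z + h z) \<le> K + L" if "z \<in> disc" for z
    using K(2)[OF that] L(2)[OF that] by (rule norm_triangle_mono)
  with add[OF bounded_V_D[OF g] bounded_V_D[OF h]] show ?thesis by (rule bounded_V_I)
qed

lemma bounded_V_holomorphic:
  assumes h: "h holomorphic_on ball 0 R" and R: "R > 1"
  shows "h \<in> bounded_V"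
proof -
  have sub: "cball 0 1 \<subseteq> ball (0::complex) R" using R by auto
  have "continuous_on (cball 0 1) h" "continuous_on (cball 0 1) (deriv h)"
    by (rule holomorphic_on_imp_continuous_on holomorphic_on_subset[OF _ sub] holomorphic_deriv h open_ball)+
  then have "bounded (h ` cball 0 1)" "bounded (deriv h ` cball 0 1)"
    by (auto intro!: compact_imp_bounded compact_continuous_image)
  then obtain A B where A: "\<And>z. z \<in> cball 0 1 \<Longrightarrow> norm (h z) \<le> A" and B: "B > 0" "\<And>z. z \<in> cball 0 1 \<Longrightarrow> norm (deriv h z) \<le> B"
    unfolding bounded_pos by blast
  have "disc \<subseteq> ball 0 R" using R by auto
  then have "h \<in> V"
    using B h by (intro V_bounded_deriv(1)[of h B]) (auto intro: holomorphic_on_subset)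
  then show ?thesis using A by (intro bounded_V_I[of _ A]) auto
qed

lemma bounded_V_const [simp]: "(\<lambda>z. c) \<in> bounded_V"
  by (rule bounded_V_holomorphic[of _ 2]) auto

lemma bounded_V_uminus: "g \<in> bounded_V \<Longrightarrow> (\<lambda>z. - g z) \<in> bounded_V"
  using bounded_V_mult[OF bounded_V_const[of "-1"], of g] by simp

lemma bounded_V_diff: "g \<in> bounded_V \<Longrightarrow> h \<in> bounded_V \<Longrightarrow> (\<lambda>z. g z - h z) \<in> bounded_V"
  using bounded_V_add[OF _ bounded_V_uminus, of g h] by simp

lemma bounded_V_power: "g \<in> bounded_V \<Longrightarrow> (\<lambda>z. g z ^ n) \<in> bounded_V"
  by (induction n) (auto intro: bounded_V_mult)

lemma bounded_V_inverse:
  assumes u: "u \<in> bounded_V" and c: "c > 0" "\<And>z. z \<in> disc \<Longrightarrow> c \<le> norm (u z)"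
  shows "(\<lambda>z. 1 / u z) \<in> bounded_V"
proof -
  have nz: "u z \<noteq> 0" if "z \<in> disc" for z using c(1) c(2)[OF that] by auto
  have "(\<lambda>z. 1 / u z) \<in> V"
  proof (rule V_dominated(1)[of _ u u "1 / c\<^sup>2" 0 0])
    show "(\<lambda>z. 1 / u z) holomorphic_on disc"
      using u nz by (intro holomorphic_intros V_holomorphic bounded_V_D)
    fix z :: complex assume z: "z \<in> disc"
    have "deriv (\<lambda>z. 1 / u z) z = - deriv u z / (u z)\<^sup>2"
      using V_field_differentiable[OF bounded_V_D[OF u] z] nz[OF z] by (subst deriv_divide) auto
    moreover have "c\<^sup>2 \<le> norm (u z) ^ 2" using c(1) c(2)[OF z] by (intro power_mono) auto
    ultimately show "norm (deriv (\<lambda>z. 1 / u z) z) \<le> 1 / c\<^sup>2 * norm (deriv u z) + 0 * norm (deriv u z) + 0"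
      using c(1) by (simp add: norm_divide norm_power frac_le)
  qed (use u c bounded_V_D in auto)
  moreover have "norm (1 / u z) \<le> 1 / c" if "z \<in> disc" for z
    using c(1) c(2)[OF that] by (simp add: norm_divide frac_le)
  ultimately show ?thesis by (rule bounded_V_I)
qed

end

subsection \<open>Fejer means\<close>

lemma tannery_bounded:
  fixes c :: "nat \<Rightarrow> complex" and \<theta> :: "nat \<Rightarrow> nat \<Rightarrow> complex"
  assumes c: "summable (\<lambda>k. norm (c k))"
    and \<theta>: "\<And>k n. norm (\<theta> n k) \<le> 1" and lim: "\<And>k. (\<lambda>n. \<theta> n k) \<longlonglongrightarrow> \<phi> k"
  shows "(\<lambda>n. \<Sum>k. \<theta> n k * c k) \<longlonglongrightarrow> (\<Sum>k. \<phi> k * c k)"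
proof -
  have "norm (\<theta> n k * c k) \<le> norm (c k)" for n k
    using \<theta>[of n k] by (simp add: norm_mult mult_left_le_one_le)
  then show ?thesis
    by (intro tannerys_theorem[of "\<lambda>k n. \<theta> n k * c k" "\<lambda>k. \<phi> k * c k" sequentially "\<lambda>k. norm (c k)",
          THEN conjunct2, THEN conjunct2] tendsto_mult lim tendsto_const c)
       (auto intro: always_eventually)
qed

text \<open>Orthogonality of the characters of Z/N: a geometric sum whose ratio is an N-th root of
  unity.\<close>

lemma sum_cis_multiple:
  fixes N :: nat and k :: int
  assumes N: "N > 0"
  shows "(\<Sum>j<N. cis (2 * pi * real j * of_int k / real N)) = (if int N dvd k then of_nat N else 0)"
proof -
  define x where "x = cis (2 * pi * of_int k / real N)"
  have xj: "cis (2 * pi * real j * of_int k / real N) = x ^ j" for j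
    by (simp add: x_def Complex.DeMoivre mult_ac)
  have one: "x = 1 \<longleftrightarrow> int N dvd k"
  proof
    assume "x = 1"
    then have "cos (2 * pi * of_int k / real N) = 1" by (simp add: x_def complex_eq_iff)
    then obtain m :: int where "2 * pi * of_int k / real N = of_int m * 2 * pi"
      by (auto simp: cos_one_2pi_int)
    then have "real_of_int k = of_int m * real N" using N by (simp add: field_simps)
    then have "k = m * int N" by (metis of_int_eq_iff of_int_mult of_int_of_nat_eq)
    then show "int N dvd k" by simp
  next
    assume "int N dvd k"
    then obtain m where "k = int N * m" by auto
    then have "2 * pi * of_int k / real N = 2 * pi * of_int m" using N by simp
    then show "x = 1" unfolding x_def by (metis cis_multiple_2pi Ints_of_int)
  qed
  have "x ^ N = cis (2 * pi * of_int k)" using N by (simp add: x_def Complex.DeMoivre)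
  then have xN: "x ^ N = 1" by (simp add: cis_multiple_2pi)
  show ?thesis
    unfolding xj using geometric_sum[of x N] one xN by auto
qed

definition taylor_coeff :: "(complex \<Rightarrow> complex) \<Rightarrow> nat \<Rightarrow> complex" where
  "taylor_coeff h k = (deriv ^^ k) h 0 / fact k"

lemma taylor_sums:
  assumes "h holomorphic_on ball 0 1" "z \<in> ball 0 1"
  shows "(\<lambda>k. taylor_coeff h k * z ^ k) sums h z"
  using holomorphic_power_series[OF assms] by (simp add: taylor_coeff_def)

lemma taylor_abs_summable:
  assumes h: "h holomorphic_on ball 0 1" and z: "z \<in> ball 0 1"
  shows "summable (\<lambda>k. norm (taylor_coeff h k * z ^ k))"
proof -
  define r where "r = (1 + norm z) / 2"
  have r: "norm z < r" "r < 1" "r > 0" using z by (auto simp: r_def add_nonneg_pos add_pos_nonneg)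
  have "summable (\<lambda>k. taylor_coeff h k * complex_of_real r ^ k)"
    using taylor_sums[OF h, of "of_real r"] r by (auto simp: sums_iff)
  then show ?thesis
    by (rule powser_insidea) (use r in auto)
qed

text \<open>Averaging over the N-th roots of unity against the character of frequency d keeps the
  Taylor terms with k congruent to d modulo N. As N grows only k = d survives, and nothing for
  negative d. Such averages stand in for circle integrals, so that convexity and rotation invariance
  are applied to finite sums.\<close>

lemma rotation_average_tendsto:
  fixes d :: int
  assumes h: "h holomorphic_on ball 0 1" and z: "z \<in> ball 0 1"
  shows "(\<lambda>N. (\<Sum>j<N. cis (- (2 * pi * real j * of_int d / real N)) * h (z * cis (2 * pi * real j / real N))) / of_nat N)
     \<longlonglongrightarrow> (if d \<ge> 0 then taylor_coeff h (nat d) * z ^ nat d else 0)"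
proof -
  define c where "c = (\<lambda>k. taylor_coeff h k * z ^ k)"
  define \<theta> where "\<theta> = (\<lambda>N k. if int N dvd int k - d then 1 else 0 :: complex)"
  have eq: "(\<Sum>j<N. cis (- (2 * pi * real j * of_int d / real N)) * h (z * cis (2 * pi * real j / real N))) / of_nat N =
      (\<Sum>k. \<theta> N k * c k)" if N: "N > 0" for N
  proof -
    have "(\<lambda>k. cis (- (2 * pi * real j * of_int d / real N)) * (taylor_coeff h k * (z * cis (2 * pi * real j / real N)) ^ k)) sums
        (cis (- (2 * pi * real j * of_int d / real N)) * h (z * cis (2 * pi * real j / real N)))" for j
      using z by (intro sums_mult taylor_sums[OF h]) (auto simp: norm_mult)
    moreover have "cis (- (2 * pi * real j * of_int d / real N)) * (taylor_coeff h k * (z * cis (2 * pi * real j / real N)) ^ k) =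
        c k * cis (2 * pi * real j * of_int (int k - d) / real N)" for j k
    proof -
      have "cis (- (2 * pi * real j * of_int d / real N)) * cis (real k * (2 * pi * real j / real N)) =
          cis (2 * pi * real j * of_int (int k - d) / real N)"
        using N by (simp add: cis_mult field_simps)
      then show ?thesis
        by (simp add: c_def power_mult_distrib Complex.DeMoivre mult_ac)
    qed
    ultimately have "(\<lambda>k. \<Sum>j<N. c k * cis (2 * pi * real j * of_int (int k - d) / real N)) sums
        (\<Sum>j<N. cis (- (2 * pi * real j * of_int d / real N)) * h (z * cis (2 * pi * real j / real N)))"
      by (intro sums_sum) simp
    then have "(\<lambda>k. (\<Sum>j<N. c k * cis (2 * pi * real j * of_int (int k - d) / real N)) / of_nat N) sums
        ((\<Sum>j<N. cis (- (2 * pi * real j * of_int d / real N)) * h (z * cis (2 * pi * real j / real N))) / of_nat N)"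
      by (rule sums_divide)
    moreover have "(\<Sum>j<N. c k * cis (2 * pi * real j * of_int (int k - d) / real N)) / of_nat N = \<theta> N k * c k" for k
      unfolding sum_distrib_left[symmetric] sum_cis_multiple[OF N] using N by (simp add: \<theta>_def)
    ultimately show ?thesis by (simp add: sums_iff)
  qed
  have lim: "(\<lambda>N. \<theta> N k) \<longlonglongrightarrow> (if int k = d then 1 else 0)" for k
  proof (rule tendsto_eventually)
    have "eventually (\<lambda>N. N > nat \<bar>int k - d\<bar>) sequentially" by (rule eventually_gt_at_top)
    then show "eventually (\<lambda>N. \<theta> N k = (if int k = d then 1 else 0)) sequentially"
    proof eventually_elim
      case (elim N)
      then have "\<not> int N \<le> \<bar>int k - d\<bar>" by linarith
      then have "int N dvd int k - d \<longleftrightarrow> int k = d"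
        using dvd_imp_le_int[of "int k - d" "int N"] by auto
      then show ?case by (simp add: \<theta>_def)
    qed
  qed
  have "(\<lambda>N. \<Sum>k. \<theta> N k * c k) \<longlonglongrightarrow> (\<Sum>k. (if int k = d then 1 else 0) * c k)"
    unfolding c_def by (intro tannery_bounded taylor_abs_summable h z lim) (auto simp: \<theta>_def)
  moreover have "(\<Sum>k. (if int k = d then 1 else 0) * c k) = (if d \<ge> 0 then c (nat d) else 0)"
  proof (cases "d \<ge> 0")
    case True
    have "(\<Sum>k. (if int k = d then 1 else 0) * c k) = (\<Sum>k\<in>{nat d}. (if int k = d then 1 else 0) * c k)"
      by (rule suminf_finite) (use True in auto)
    then show ?thesis using True by simp
  next
    case False
    then have "(if int k = d then 1 else 0) * c k = 0" for k by auto
    then show ?thesis using False by simp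
  qed
  ultimately have "(\<lambda>N. \<Sum>k. \<theta> N k * c k) \<longlonglongrightarrow> (if d \<ge> 0 then c (nat d) else 0)" by simp
  moreover have "eventually (\<lambda>N. (\<Sum>k. \<theta> N k * c k) =
      (\<Sum>j<N. cis (- (2 * pi * real j * of_int d / real N)) * h (z * cis (2 * pi * real j / real N))) / of_nat N) sequentially"
    using eventually_gt_at_top[of 0] by eventually_elim (simp add: eq)
  ultimately show ?thesis
    unfolding c_def by (rule Lim_transform_eventually)
qed

text \<open>The Fejer kernel of order n at the angle 2 pi j / N, divided by N: a discrete
  probability weight once N \<ge> n > 0.\<close>

definition fejer_weight :: "nat \<Rightarrow> nat \<Rightarrow> nat \<Rightarrow> real" where
  "fejer_weight n N j = (norm (\<Sum>m<n. cis (2 * pi * real j * real m / real N)))\<^sup>2 / (real n * real N)"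

lemma fejer_weight_nonneg [simp]: "fejer_weight n N j \<ge> 0"
  by (simp add: fejer_weight_def)

lemma fejer_weight_eq:
  "complex_of_real (fejer_weight n N j) =
     (\<Sum>m<n. \<Sum>l<n. cis (- (2 * pi * real j * of_int (int l - int m) / real N))) / (of_nat n * of_nat N)"
proof -
  define S where "S = (\<Sum>m<n. cis (2 * pi * real j * real m / real N))"
  have "complex_of_real ((norm S)\<^sup>2) = S * cnj S" by (rule complex_norm_square)
  also have "\<dots> = (\<Sum>m<n. \<Sum>l<n. cis (2 * pi * real j * real m / real N) * cis (- (2 * pi * real j * real l / real N)))"
    by (simp add: S_def cnj_sum cis_cnj sum_product)
  also have "\<dots> = (\<Sum>m<n. \<Sum>l<n. cis (- (2 * pi * real j * of_int (int l - int m) / real N)))"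
    by (intro sum.cong refl) (simp add: cis_mult diff_divide_distrib algebra_simps)
  finally show ?thesis
    by (simp add: fejer_weight_def S_def)
qed

lemma sum_swap3:
  fixes F :: "'a \<Rightarrow> 'b \<Rightarrow> 'c \<Rightarrow> complex"
  shows "(\<Sum>j\<in>A. \<Sum>m\<in>B. \<Sum>l\<in>C. F j m l) = (\<Sum>m\<in>B. \<Sum>l\<in>C. \<Sum>j\<in>A. F j m l)"
proof -
  have "(\<Sum>j\<in>A. \<Sum>m\<in>B. \<Sum>l\<in>C. F j m l) = (\<Sum>m\<in>B. \<Sum>j\<in>A. \<Sum>l\<in>C. F j m l)"
    by (rule sum.swap)
  also have "\<dots> = (\<Sum>m\<in>B. \<Sum>l\<in>C. \<Sum>j\<in>A. F j m l)"
    by (rule sum.cong[OF refl sum.swap])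
  finally show ?thesis .
qed

text \<open>For N \<ge> n all frequencies m - l with m, l < n are smaller than N in modulus, so only
  the diagonal contributes.\<close>

lemma fejer_weight_sum:
  assumes "n > 0" "N \<ge> n"
  shows "(\<Sum>j<N. fejer_weight n N j) = 1"
proof -
  have N: "N > 0" using assms by simp
  have "complex_of_real (\<Sum>j<N. fejer_weight n N j) =
      (\<Sum>j<N. \<Sum>m<n. \<Sum>l<n. cis (2 * pi * real j * of_int (int m - int l) / real N)) / (of_nat n * of_nat N)"
    unfolding of_real_sum fejer_weight_eq sum_divide_distrib[symmetric]
    by (intro arg_cong2[of _ _ _ _ "(/)"] sum.cong refl arg_cong[of _ _ cis]) (simp add: field_simps)
  also have "(\<Sum>j<N. \<Sum>m<n. \<Sum>l<n. cis (2 * pi * real j * of_int (int m - int l) / real N)) =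
      (\<Sum>m<n. \<Sum>l<n. \<Sum>j<N. cis (2 * pi * real j * of_int (int m - int l) / real N))"
    by (rule sum_swap3)
  also have "\<dots> = (\<Sum>m<n. \<Sum>l<n. if l = m then of_nat N else 0)"
  proof (intro sum.cong refl)
    fix m l assume "m \<in> {..<n}" "l \<in> {..<n}"
    then have "\<not> int N \<le> \<bar>int m - int l\<bar>" using assms by auto
    then have "int N dvd int m - int l \<longleftrightarrow> l = m"
      using assms dvd_imp_le_int[of "int m - int l" "int N"] by auto
    then show "(\<Sum>j<N. cis (2 * pi * real j * of_int (int m - int l) / real N)) = (if l = m then of_nat N else 0)"
      unfolding sum_cis_multiple[OF N] by simp
  qed
  also have "\<dots> = of_nat n * of_nat N" by simp
  finally have "complex_of_real (\<Sum>j<N. fejer_weight n N j) = 1" using assms by simp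
  then show ?thesis by (metis of_real_eq_1_iff)
qed

text \<open>Each difference k = l - m occurs for n - k pairs, which is the source of the Cesaro
  weights.\<close>

lemma sum_pairs_diff:
  fixes g :: "nat \<Rightarrow> complex"
  shows "(\<Sum>m<n. \<Sum>l<n. if m \<le> l then g (l - m) else 0) = (\<Sum>k<n. of_nat (n - k) * g k)"
proof -
  have "(\<Sum>m<n. \<Sum>l<n. if m \<le> l then g (l - m) else 0) = (\<Sum>l<n. \<Sum>m<n. if m \<le> l then g (l - m) else 0)"
    by (rule sum.swap)
  also have "\<dots> = (\<Sum>l<n. \<Sum>m\<le>l. g (l - m))"
    by (intro sum.cong refl sum.mono_neutral_cong_right) auto
  also have "\<dots> = (\<Sum>l<n. \<Sum>k\<le>l. g k)"
  proof (rule sum.cong[OF refl])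
    show "(\<Sum>m\<le>l. g (l - m)) = (\<Sum>k\<le>l. g k)" for l
      by (rule sum.reindex_bij_witness[of _ "\<lambda>k. l - k" "\<lambda>k. l - k"]) auto
  qed
  also have "\<dots> = (\<Sum>k<n. of_nat (n - k) * g k)"
  proof (induction n)
    case (Suc n)
    have "(\<Sum>k<Suc n. of_nat (Suc n - k) * g k) = (\<Sum>k<Suc n. of_nat (n - k) * g k + g k)"
      by (intro sum.cong refl) (auto simp: Suc_diff_le algebra_simps)
    also have "\<dots> = (\<Sum>k<n. of_nat (n - k) * g k) + (\<Sum>k\<le>n. g k)"
      by (simp add: sum.distrib) (simp add: lessThan_Suc_atMost[symmetric])
    finally show ?case using Suc by simp
  qed simp
  finally show ?thesis .
qed

text \<open>The trigonometric average is a Riemann sum for the convolution with the Fejer kernel.\<close>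

lemma fejer_average_tendsto:
  assumes h: "h holomorphic_on ball 0 1" and z: "z \<in> ball 0 1" and n: "n > 0"
  shows "(\<lambda>N. \<Sum>j<N. of_real (fejer_weight n N j) * (cis (2 * pi * real j * real e / real N) * h (z * cis (2 * pi * real j / real N))))
     \<longlonglongrightarrow> (\<Sum>k<n. of_nat (n - k) / of_nat n * (if e \<le> k then taylor_coeff h (k - e) * z ^ (k - e) else 0))"
proof -
  \<comment> \<open>Terms of negative degree are 0. The shift e is 0 for a function itself and 1 for
    a derivative, because differentiating h (z \<omega>) produces an extra factor \<omega>.\<close>
  define T where "T = (\<lambda>d::int. if d \<ge> 0 then taylor_coeff h (nat d) * z ^ nat d else 0)"
  have eq: "(\<Sum>j<N. of_real (fejer_weight n N j) * (cis (2 * pi * real j * real e / real N) * h (z * cis (2 * pi * real j / real N)))) =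
    (\<Sum>m<n. \<Sum>l<n. ((\<Sum>j<N. cis (- (2 * pi * real j * of_int (int l - int m - int e) / real N)) * h (z * cis (2 * pi * real j / real N))) / of_nat N)) / of_nat n" for N
  proof -
    have "of_real (fejer_weight n N j) * (cis (2 * pi * real j * real e / real N) * h (z * cis (2 * pi * real j / real N))) =
      (\<Sum>m<n. \<Sum>l<n. cis (- (2 * pi * real j * of_int (int l - int m - int e) / real N)) * h (z * cis (2 * pi * real j / real N))) / (of_nat n * of_nat N)" for j
    proof -
      have "cis (- (2 * pi * real j * of_int (int l - int m) / real N)) * cis (2 * pi * real j * real e / real N) =
          cis (- (2 * pi * real j * of_int (int l - int m - int e) / real N))" for l m
        unfolding cis_mult by (rule arg_cong[of _ _ cis]) (simp add: diff_divide_distrib right_diff_distrib)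
      then show ?thesis
        unfolding fejer_weight_eq times_divide_eq_left sum_distrib_right mult.assoc[symmetric] by simp
    qed
    then have "(\<Sum>j<N. of_real (fejer_weight n N j) * (cis (2 * pi * real j * real e / real N) * h (z * cis (2 * pi * real j / real N)))) =
      (\<Sum>j<N. \<Sum>m<n. \<Sum>l<n. cis (- (2 * pi * real j * of_int (int l - int m - int e) / real N)) * h (z * cis (2 * pi * real j / real N))) / (of_nat n * of_nat N)"
      by (simp add: sum_divide_distrib)
    also have "(\<Sum>j<N. \<Sum>m<n. \<Sum>l<n. cis (- (2 * pi * real j * of_int (int l - int m - int e) / real N)) * h (z * cis (2 * pi * real j / real N))) =
      (\<Sum>m<n. \<Sum>l<n. \<Sum>j<N. cis (- (2 * pi * real j * of_int (int l - int m - int e) / real N)) * h (z * cis (2 * pi * real j / real N)))"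
      by (rule sum_swap3)
    finally show ?thesis by (simp add: sum_divide_distrib mult.commute)
  qed
  have "(\<lambda>N. (\<Sum>m<n. \<Sum>l<n. ((\<Sum>j<N. cis (- (2 * pi * real j * of_int (int l - int m - int e) / real N)) * h (z * cis (2 * pi * real j / real N))) / of_nat N)) / of_nat n)
     \<longlonglongrightarrow> (\<Sum>m<n. \<Sum>l<n. T (int l - int m - int e)) / of_nat n"
    unfolding T_def using n by (intro tendsto_divide tendsto_sum rotation_average_tendsto h z tendsto_const) auto
  moreover have "(\<Sum>m<n. \<Sum>l<n. T (int l - int m - int e)) =
      (\<Sum>m<n. \<Sum>l<n. if m \<le> l then (if e \<le> l - m then taylor_coeff h (l - m - e) * z ^ (l - m - e) else 0) else 0)"
  proof (intro sum.cong refl)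
    fix m l :: nat
    show "T (int l - int m - int e) = (if m \<le> l then (if e \<le> l - m then taylor_coeff h (l - m - e) * z ^ (l - m - e) else 0) else 0)"
    proof (cases "m \<le> l \<and> e \<le> l - m")
      case True
      then have "int l - int m - int e = int (l - m - e)" by linarith
      then have "T (int l - int m - int e) = T (int (l - m - e))" by (rule arg_cong)
      also have "\<dots> = taylor_coeff h (l - m - e) * z ^ (l - m - e)" by (simp add: T_def)
      finally show ?thesis using True by simp
    qed (auto simp: T_def)
  qed
  ultimately show ?thesis
    unfolding eq sum_pairs_diff[of "\<lambda>k. if e \<le> k then taylor_coeff h (k - e) * z ^ (k - e) else 0"]
    by (simp add: sum_divide_distrib)
qed

text \<open>The n-th Cesaro mean of the Taylor series at 0. For n = 0 it is 0, hence
  \<open>fejer (Suc n)\<close> in the norm limits.\<close>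

definition fejer :: "nat \<Rightarrow> (complex \<Rightarrow> complex) \<Rightarrow> complex \<Rightarrow> complex" where
  "fejer n h z = (\<Sum>k<n. of_nat (n - k) / of_nat n * (taylor_coeff h k * z ^ k))"

text \<open>Terms of the differentiated series are indexed by the degree before differentiation, so
  that each keeps the Cesaro weight of its original term.\<close>

definition deriv_term :: "(complex \<Rightarrow> complex) \<Rightarrow> complex \<Rightarrow> nat \<Rightarrow> complex" where
  "deriv_term h z k = (if 1 \<le> k then taylor_coeff (deriv h) (k - 1) * z ^ (k - 1) else 0)"

lemma deriv_fejer: "deriv (fejer n h) z = (\<Sum>k<n. of_nat (n - k) / of_nat n * deriv_term h z k)"
proof (rule DERIV_imp_deriv)
  have *: "taylor_coeff h k * (of_nat k * z ^ (k - Suc 0)) = deriv_term h z k" for k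
  proof (cases k)
    case (Suc j)
    have "(deriv ^^ j) (deriv h) 0 = (deriv ^^ Suc j) h 0"
      by (simp del: funpow.simps add: funpow_Suc_right)
    moreover have "X / (c * F) * (c * w) = X / F * w" if "c \<noteq> 0" for X c F w :: complex
      using that by simp
    ultimately show ?thesis
      using Suc of_nat_neq_0[of j, where 'a = complex]
      by (simp add: deriv_term_def taylor_coeff_def fact_Suc[where 'a = complex] del: funpow.simps of_nat_Suc)
  qed (simp add: deriv_term_def)
  have "(fejer n h has_field_derivative (\<Sum>k<n. of_nat (n - k) / of_nat n * (taylor_coeff h k * (of_nat k * z ^ (k - Suc 0))))) (at z)"
    unfolding fejer_def by (auto intro!: derivative_eq_intros sum.cong simp: mult_ac)
  then show "(fejer n h has_field_derivative (\<Sum>k<n. of_nat (n - k) / of_nat n * deriv_term h z k)) (at z)"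
    unfolding * .
qed

lemma fejer_0: "n > 0 \<Longrightarrow> fejer n h 0 = h 0"
proof -
  assume n: "n > 0"
  have "fejer n h 0 = (\<Sum>k\<in>{0}. of_nat (n - k) / of_nat n * (taylor_coeff h k * 0 ^ k))"
    unfolding fejer_def using n by (intro sum.mono_neutral_right) auto
  then show ?thesis using n by (simp add: taylor_coeff_def)
qed

text \<open>Truncated subtraction makes the weight vanish for k \<ge> n, so the finite sum is a full
  series whose weights are bounded by 1 and tend to 1.\<close>

lemma fejer_tendsto_aux:
  assumes c: "summable (\<lambda>k. norm (c k))"
  shows "(\<lambda>n. \<Sum>k<n. of_nat (n - k) / of_nat n * c k) \<longlonglongrightarrow> (\<Sum>k. c k :: complex)"
proof -
  have lim: "(\<lambda>n. complex_of_nat (n - k) / of_nat n) \<longlonglongrightarrow> 1" for k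
  proof -
    have "(\<lambda>n. real (n - k) / real n) \<longlonglongrightarrow> 1" by real_asymp
    then have "(\<lambda>n. complex_of_real (real (n - k) / real n)) \<longlonglongrightarrow> complex_of_real 1" by (rule tendsto_of_real)
    then show ?thesis by simp
  qed
  have "norm (complex_of_nat (n - k) / of_nat n) \<le> 1" for n k
    by (cases "n = 0") (auto simp: norm_divide)
  then have "(\<lambda>n. \<Sum>k. complex_of_nat (n - k) / of_nat n * c k) \<longlonglongrightarrow> (\<Sum>k. 1 * c k)"
    by (intro tannery_bounded c lim)
  moreover have "(\<Sum>k. complex_of_nat (n - k) / of_nat n * c k) = (\<Sum>k<n. of_nat (n - k) / of_nat n * c k)" for n
    by (rule suminf_finite) auto
  ultimately show ?thesis by simp
qed

lemma fejer_tendsto: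
  assumes h: "h holomorphic_on ball 0 1" and z: "z \<in> ball 0 1"
  shows "(\<lambda>n. fejer n h z) \<longlonglongrightarrow> h z"
  unfolding fejer_def
  using fejer_tendsto_aux[OF taylor_abs_summable[OF h z]] taylor_sums[OF h z] by (simp add: sums_iff)

lemma deriv_fejer_tendsto:
  assumes h: "h holomorphic_on ball 0 1" and z: "z \<in> ball 0 1"
  shows "(\<lambda>n. deriv (fejer n h) z) \<longlonglongrightarrow> deriv h z"
proof -
  have h': "deriv h holomorphic_on ball 0 1" using h by (auto intro: holomorphic_deriv)
  have t: "deriv_term h z (Suc k) = taylor_coeff (deriv h) k * z ^ k" for k
    by (simp add: deriv_term_def)
  have "summable (\<lambda>k. norm (deriv_term h z (Suc k)))"
    unfolding t by (rule taylor_abs_summable[OF h' z])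
  then have s: "summable (\<lambda>k. norm (deriv_term h z k))" using summable_Suc_iff[of "\<lambda>k. norm (deriv_term h z k)"] by simp
  have "(\<lambda>k. deriv_term h z (Suc k)) sums deriv h z"
    unfolding t by (rule taylor_sums[OF h' z])
  then have "deriv_term h z sums (deriv h z + deriv_term h z 0)" by (simp add: sums_Suc_iff)
  then have "deriv_term h z sums deriv h z" by (simp add: deriv_term_def[of _ _ 0])
  then have "(\<Sum>k. deriv_term h z k) = deriv h z" by (simp add: sums_iff)
  then show ?thesis
    unfolding deriv_fejer using fejer_tendsto_aux[OF s] by simp
qed

text \<open>The mean is a limit of convex combinations of rotations of h and so inherits the sup
  bound. Plain Taylor polynomials have no such uniform bound, which is the reason for Cesaro
  means.\<close>

lemma norm_fejer_le:
  assumes h: "h holomorphic_on ball 0 1" and z: "z \<in> ball 0 1" and n: "n > 0"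
    and K: "\<And>z. z \<in> ball 0 1 \<Longrightarrow> norm (h z) \<le> K"
  shows "norm (fejer n h z) \<le> K"
proof -
  have "(\<lambda>N. \<Sum>j<N. of_real (fejer_weight n N j) * (cis (2 * pi * real j * real 0 / real N) * h (z * cis (2 * pi * real j / real N))))
     \<longlonglongrightarrow> fejer n h z"
    using fejer_average_tendsto[OF h z n, of 0] by (simp add: fejer_def)
  moreover have "eventually (\<lambda>N. norm (\<Sum>j<N. of_real (fejer_weight n N j) * (cis (2 * pi * real j * real 0 / real N) * h (z * cis (2 * pi * real j / real N)))) \<le> K) sequentially"
    using eventually_ge_at_top[of n]
  proof eventually_elim
    case (elim N)
    have "norm (\<Sum>j<N. of_real (fejer_weight n N j) * (cis (2 * pi * real j * real 0 / real N) * h (z * cis (2 * pi * real j / real N)))) \<le>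
      (\<Sum>j<N. fejer_weight n N j * K)"
      using z by (intro order_trans[OF norm_sum] sum_mono) (auto simp: norm_mult intro!: mult_left_mono K)
    also have "\<dots> = K" using fejer_weight_sum[OF n elim] by (simp flip: sum_distrib_right)
    finally show ?case .
  qed
  ultimately show ?thesis
    by (rule Lim_norm_ubound[rotated]) simp
qed

section \<open>Fejer means in the Besov-Dirichlet space, and products in invariant subspaces\<close>

context besov
begin

lemma fejer_holomorphic: "fejer n h holomorphic_on A"
  unfolding fejer_def by (intro holomorphic_intros)

lemma fejer_in_bounded_V: "fejer n h \<in> bounded_V"
  by (rule bounded_V_holomorphic[of _ 2]) (auto intro: fejer_holomorphic)

text \<open>Jensen's inequality for the p-th power under the weights w, followed by rotation
  invariance of the measure.\<close>

lemma nn_integral_rotation_average_le: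
  assumes h: "h holomorphic_on disc" and w: "\<And>j. j < N \<Longrightarrow> w j \<ge> 0" "(\<Sum>j<N. w j) = 1"
    and \<omega>: "\<And>j. norm (\<omega> j) = 1"
  shows "(\<integral>\<^sup>+z. ennreal (norm (\<Sum>j<N. of_real (w j) * (\<omega> j * deriv h (z * \<omega> j))) powr p) \<partial>W)
    \<le> (\<integral>\<^sup>+z. ennreal (norm (deriv h z) powr p) \<partial>W)"
proof -
  have [measurable]: "deriv h \<in> borel_measurable W" by (rule measurable_W_deriv[OF h])
  have rot: "(\<lambda>z. z * \<omega> j) \<in> measurable W W" for j
    unfolding measurable_cong_sets[OF sets_weighted_area sets_weighted_area]
    by (rule measurable_restrict_space3) (auto simp: \<omega> norm_mult)
  have hm [measurable]: "(\<lambda>z. deriv h (z * \<omega> j)) \<in> borel_measurable W" for j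
    by (rule measurable_compose[OF rot]) measurable
  have N: "{..<N} \<noteq> {}" using w(2) by auto
  have pt: "norm (\<Sum>j<N. of_real (w j) * (\<omega> j * deriv h (z * \<omega> j))) powr p \<le> (\<Sum>j<N. w j * norm (deriv h (z * \<omega> j)) powr p)" for z
  proof -
    have "norm (\<Sum>j<N. of_real (w j) * (\<omega> j * deriv h (z * \<omega> j))) \<le> (\<Sum>j<N. w j *\<^sub>R norm (deriv h (z * \<omega> j)))"
      using w(1) by (intro order_trans[OF norm_sum] sum_mono) (auto simp: norm_mult \<omega>)
    then have "norm (\<Sum>j<N. of_real (w j) * (\<omega> j * deriv h (z * \<omega> j))) powr p \<le> (\<Sum>j<N. w j *\<^sub>R norm (deriv h (z * \<omega> j))) powr p"
      using p by (intro powr_mono2) auto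
    also have "\<dots> \<le> (\<Sum>j<N. w j * norm (deriv h (z * \<omega> j)) powr p)"
      using p w N by (intro convex_on_sum[OF _ _ convex_on_powr_nonneg]) auto
    finally show ?thesis .
  qed
  have "(\<integral>\<^sup>+z. ennreal (norm (\<Sum>j<N. of_real (w j) * (\<omega> j * deriv h (z * \<omega> j))) powr p) \<partial>W)
    \<le> (\<integral>\<^sup>+z. (\<Sum>j<N. ennreal (w j) * ennreal (norm (deriv h (z * \<omega> j)) powr p)) \<partial>W)"
  proof (rule nn_integral_mono)
    fix z
    have "ennreal (norm (\<Sum>j<N. of_real (w j) * (\<omega> j * deriv h (z * \<omega> j))) powr p) \<le> ennreal (\<Sum>j<N. w j * norm (deriv h (z * \<omega> j)) powr p)"
      by (rule ennreal_leI[OF pt])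
    also have "\<dots> = (\<Sum>j<N. ennreal (w j * norm (deriv h (z * \<omega> j)) powr p))"
      using w(1) by (intro sum_ennreal[symmetric]) auto
    also have "\<dots> = (\<Sum>j<N. ennreal (w j) * ennreal (norm (deriv h (z * \<omega> j)) powr p))"
      using w(1) by (intro sum.cong refl ennreal_mult) auto
    finally show "ennreal (norm (\<Sum>j<N. of_real (w j) * (\<omega> j * deriv h (z * \<omega> j))) powr p) \<le> (\<Sum>j<N. ennreal (w j) * ennreal (norm (deriv h (z * \<omega> j)) powr p))" .
  qed
  also have "\<dots> = (\<Sum>j<N. ennreal (w j) * (\<integral>\<^sup>+z. ennreal (norm (deriv h (z * \<omega> j)) powr p) \<partial>W))"
    by (simp add: nn_integral_sum nn_integral_cmult)
  also have "\<dots> = (\<Sum>j<N. ennreal (w j) * (\<integral>\<^sup>+z. ennreal (norm (deriv h z) powr p) \<partial>W))"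
    using nn_integral_weighted_area_rotate[of "\<lambda>z. ennreal (norm (deriv h z) powr p)" \<alpha>, OF _ \<omega>]
    by (simp add: mult.commute)
  also have "\<dots> = (\<Sum>j<N. ennreal (w j)) * (\<integral>\<^sup>+z. ennreal (norm (deriv h z) powr p) \<partial>W)"
    by (simp add: sum_distrib_right)
  also have "(\<Sum>j<N. ennreal (w j)) = ennreal (\<Sum>j<N. w j)"
    using w(1) by (intro sum_ennreal) auto
  finally show ?thesis by (simp add: w(2))
qed

text \<open>Fatou's lemma passes the contraction property from the averages over roots of unity to
  their limit. Together with pointwise convergence it yields norm convergence through
  \<open>Lp_tendsto_of_norm_le\<close>.\<close>

lemma integral_deriv_fejer_le:
  assumes h: "h \<in> V" and n: "n > 0"
  shows "(\<integral>z. norm (deriv (fejer n h) z) powr p \<partial>W) \<le> (\<integral>z. norm (deriv h z) powr p \<partial>W)"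
proof -
  have hol: "h holomorphic_on disc" by (rule V_holomorphic[OF h])
  have hol': "deriv h holomorphic_on disc" using hol by (auto intro: holomorphic_deriv)
  define A where "A = (\<lambda>N z. \<Sum>j<N. of_real (fejer_weight n N j) * (cis (2 * pi * real j / real N) * deriv h (z * cis (2 * pi * real j / real N))))"
  have Alim: "(\<lambda>N. A N z) \<longlonglongrightarrow> deriv (fejer n h) z" if "z \<in> disc" for z
    using fejer_average_tendsto[OF hol' that n, of 1] by (simp add: A_def deriv_fejer deriv_term_def)
  have Am [measurable]: "A N \<in> borel_measurable W" for N
    unfolding A_def
    by (intro measurable_W_continuous continuous_intros continuous_on_compose2[OF holomorphic_on_imp_continuous_on[OF hol']])
       (auto simp: norm_mult)
  have "(\<integral>\<^sup>+z. ennreal (norm (deriv (fejer n h) z) powr p) \<partial>W) = (\<integral>\<^sup>+z. liminf (\<lambda>N. ennreal (norm (A N z) powr p)) \<partial>W)"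
  proof (rule nn_integral_cong)
    fix z assume "z \<in> space W"
    then have "(\<lambda>N. norm (A N z) powr p) \<longlonglongrightarrow> norm (deriv (fejer n h) z) powr p"
      using p by (intro tendsto_powr' tendsto_norm tendsto_const Alim) auto
    then have "(\<lambda>N. ennreal (norm (A N z) powr p)) \<longlonglongrightarrow> ennreal (norm (deriv (fejer n h) z) powr p)"
      by (rule tendsto_ennrealI)
    then show "ennreal (norm (deriv (fejer n h) z) powr p) = liminf (\<lambda>N. ennreal (norm (A N z) powr p))"
      by (intro lim_imp_Liminf[symmetric]) auto
  qed
  also have "\<dots> \<le> liminf (\<lambda>N. \<integral>\<^sup>+z. ennreal (norm (A N z) powr p) \<partial>W)"
    by (intro nn_integral_liminf) measurable
  also have "\<dots> \<le> (\<integral>\<^sup>+z. ennreal (norm (deriv h z) powr p) \<partial>W)"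
  proof (rule Liminf_le)
    show "eventually (\<lambda>N. (\<integral>\<^sup>+z. ennreal (norm (A N z) powr p) \<partial>W) \<le> (\<integral>\<^sup>+z. ennreal (norm (deriv h z) powr p) \<partial>W)) sequentially"
      using eventually_ge_at_top[of n]
    proof eventually_elim
      case (elim N)
      show ?case
        unfolding A_def
        by (rule nn_integral_rotation_average_le[OF hol, of N "fejer_weight n N" "\<lambda>j. cis (2 * pi * real j / real N)"])
           (use fejer_weight_sum[OF n elim] in auto)
    qed
  qed simp
  finally have "(\<integral>\<^sup>+z. ennreal (norm (deriv (fejer n h) z) powr p) \<partial>W) \<le> (\<integral>\<^sup>+z. ennreal (norm (deriv h z) powr p) \<partial>W)" .
  then show ?thesis
    using V_integrable[OF h] V_integrable[OF bounded_V_D[OF fejer_in_bounded_V]]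
    by (subst (asm) (1 2) nn_integral_eq_integral) auto
qed

lemma Lp_norm_tendsto_0I:
  assumes "(\<lambda>n. \<integral>x. \<bar>u n x\<bar> powr p \<partial>M) \<longlonglongrightarrow> 0"
  shows "(\<lambda>n. Lp_norm M p (u n)) \<longlonglongrightarrow> 0"
  unfolding Lp_norm_def using tendsto_powr'[OF assms tendsto_const[of "1 / p"]] p by simp

lemma Lp_deriv_fejer_diff_tendsto:
  assumes h: "h \<in> V"
  shows "(\<lambda>n. Lp_norm W p (\<lambda>z. norm (deriv (fejer (Suc n) h) z - deriv h z))) \<longlonglongrightarrow> 0"
proof (rule Lp_norm_tendsto_0I)
  have "(\<lambda>n. \<integral>z. norm (deriv (fejer (Suc n) h) z - deriv h z) powr p \<partial>W) \<longlonglongrightarrow> 0"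
  proof (rule Lp_tendsto_of_norm_le)
    show "(\<lambda>n. deriv (fejer (Suc n) h) z) \<longlonglongrightarrow> deriv h z" if "z \<in> space W" for z
      using LIMSEQ_Suc[OF deriv_fejer_tendsto[OF V_holomorphic[OF h]]] that by simp
  qed (use p h V_integrable bounded_V_D fejer_in_bounded_V integral_deriv_fejer_le measurable_W_deriv V_holomorphic in auto)
  then show "(\<lambda>n. \<integral>z. \<bar>norm (deriv (fejer (Suc n) h) z - deriv h z)\<bar> powr p \<partial>W) \<longlonglongrightarrow> 0" by simp
qed

lemma sum_norm_fejer_diff_tendsto:
  assumes h: "h \<in> V"
  shows "(\<lambda>n. sum_norm (\<lambda>z. fejer (Suc n) h z - h z)) \<longlonglongrightarrow> 0"
proof -
  have "seminorm (\<lambda>z. fejer (Suc n) h z - h z) = Lp_norm W p (\<lambda>z. norm (deriv (fejer (Suc n) h) z - deriv h z))" for n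
    unfolding seminorm_def Lp_norm_def
    using V_field_differentiable[OF bounded_V_D[OF fejer_in_bounded_V]] V_field_differentiable[OF h]
    by (intro arg_cong[of _ _ "\<lambda>x. x powr (1 / p)"] Bochner_Integration.integral_cong refl) simp
  then show ?thesis
    using Lp_deriv_fejer_diff_tendsto[OF h] by (simp add: sum_norm_def fejer_0)
qed

text \<open>With \<sigma> the Fejer mean of h, the term f' (\<sigma> - h) of the derivative tends to
  0 by dominated convergence, as the means share a sup bound with h, and the term f (\<sigma> - h)'
  tends to 0 in norm because f is bounded. The values at 0 coincide.\<close>

lemma sum_norm_mult_fejer_diff_tendsto:
  assumes f: "f \<in> bounded_V" and h: "h \<in> bounded_V"
  shows "(\<lambda>n. sum_norm (\<lambda>z. f z * fejer (Suc n) h z - f z * h z)) \<longlonglongrightarrow> 0"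
proof -
  obtain K where K: "K > 0" "\<And>z. z \<in> disc \<Longrightarrow> norm (f z) \<le> K" using bounded_V_E[OF f] by blast
  obtain L where L: "L > 0" "\<And>z. z \<in> disc \<Longrightarrow> norm (h z) \<le> L" using bounded_V_E[OF h] by blast
  have fV: "f \<in> V" and hV: "h \<in> V" using f h bounded_V_D by auto
  define u where "u = (\<lambda>n z. norm (deriv f z) * norm (fejer (Suc n) h z - h z))"
  define v where "v = (\<lambda>n z. K * norm (deriv (fejer (Suc n) h) z - deriv h z))"
  have [measurable]: "deriv f \<in> borel_measurable W" "deriv h \<in> borel_measurable W" "deriv (fejer n h) \<in> borel_measurable W" for n
    by (intro measurable_W_deriv V_holomorphic fV hV fejer_holomorphic)+
  have [measurable]: "h \<in> borel_measurable W" "fejer n h \<in> borel_measurable W" for n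
    by (intro measurable_W_continuous holomorphic_on_imp_continuous_on V_holomorphic hV fejer_holomorphic)+
  have um [measurable]: "u n \<in> borel_measurable W" and vm [measurable]: "v n \<in> borel_measurable W" for n
    unfolding u_def v_def by measurable
  have ub: "\<bar>u n z\<bar> powr p \<le> (2 * L) powr p * norm (deriv f z) powr p" if "z \<in> disc" for n z
  proof -
    have "norm (fejer (Suc n) h z - h z) \<le> L + L"
      using norm_fejer_le[OF V_holomorphic[OF hV] that _ L(2), of "Suc n"] L(2)[OF that]
      by (intro norm_triangle_le_diff) auto
    then have "\<bar>u n z\<bar> \<le> norm (deriv f z) * (2 * L)"
      unfolding u_def by (simp add: abs_mult mult_left_mono)
    then have "\<bar>u n z\<bar> powr p \<le> (norm (deriv f z) * (2 * L)) powr p"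
      using p by (intro powr_mono2) auto
    then show ?thesis using L by (simp add: powr_mult mult_ac)
  qed
  have dom: "integrable W (\<lambda>z. (2 * L) powr p * norm (deriv f z) powr p)"
    using V_integrable[OF fV] by simp
  have ui: "integrable W (\<lambda>z. \<bar>u n z\<bar> powr p)" for n
    by (rule Bochner_Integration.integrable_bound[OF dom]) (use ub in auto)
  have vi: "integrable W (\<lambda>z. \<bar>v n z\<bar> powr p)" for n
  proof -
    have "(\<lambda>z. fejer (Suc n) h z - h z) \<in> V"
      by (intro diff bounded_V_D fejer_in_bounded_V h)
    then have "integrable W (\<lambda>z. norm (deriv (\<lambda>z. fejer (Suc n) h z - h z) z) powr p)" by (rule V_integrable)
    also have "?this \<longleftrightarrow> integrable W (\<lambda>z. norm (deriv (fejer (Suc n) h) z - deriv h z) powr p)"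
      using V_field_differentiable[OF bounded_V_D[OF fejer_in_bounded_V]] V_field_differentiable[OF hV]
      by (intro Bochner_Integration.integrable_cong refl) simp
    finally show ?thesis using K by (simp add: v_def abs_mult powr_mult)
  qed
  have p0: "p > 0" and p1: "p \<ge> 1" using p by auto
  have le: "sum_norm (\<lambda>z. f z * fejer (Suc n) h z - f z * h z) \<le> Lp_norm W p (u n) + Lp_norm W p (v n)" for n
  proof -
    let ?g = "\<lambda>z. f z * fejer (Suc n) h z - f z * h z"
    have gV: "?g \<in> V"
      by (intro diff bounded_V_D bounded_V_mult f h fejer_in_bounded_V)
    have d: "norm (deriv ?g z) \<le> u n z + v n z" if z: "z \<in> disc" for z
    proof -
      have fd: "f field_differentiable at z" "h field_differentiable at z" "fejer (Suc n) h field_differentiable at z"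
        using V_field_differentiable[OF _ z] fV hV bounded_V_D[OF fejer_in_bounded_V] by auto
      have "deriv ?g z = deriv f z * (fejer (Suc n) h z - h z) + f z * (deriv (fejer (Suc n) h) z - deriv h z)"
        using fd by (simp add: algebra_simps field_differentiable_mult)
      also have "norm \<dots> \<le> u n z + v n z"
        unfolding u_def v_def using K(2)[OF z]
        by (intro norm_triangle_mono) (auto simp: norm_mult intro: mult_right_mono)
      finally show ?thesis .
    qed
    have iuv: "integrable W (\<lambda>z. \<bar>u n z + v n z\<bar> powr p)"
      by (rule Lp_integrable_add[OF p1 _ _ ui vi]) auto
    have gm: "(\<lambda>z. norm (deriv ?g z)) \<in> borel_measurable W"
      using measurable_W_deriv[OF V_holomorphic[OF gV]] by measurable
    have "seminorm ?g \<le> Lp_norm W p (\<lambda>z. u n z + v n z)"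
      unfolding seminorm_def by (rule Lp_norm_mono(2)[OF p0 iuv gm]) (use d in auto)
    also have "\<dots> \<le> Lp_norm W p (u n) + Lp_norm W p (v n)"
      by (rule Lp_minkowski[OF p1 _ _ ui vi]) auto
    finally show ?thesis by (simp add: sum_norm_def fejer_0)
  qed
  have "(\<lambda>n. \<integral>z. \<bar>u n z\<bar> powr p \<partial>W) \<longlonglongrightarrow> (\<integral>z. 0 \<partial>W)"
  proof (rule integral_dominated_convergence[OF _ _ dom])
    have "(\<lambda>n. \<bar>u n z\<bar> powr p) \<longlonglongrightarrow> 0" if z: "z \<in> disc" for z
    proof -
      have "(\<lambda>n. \<bar>u n z\<bar> powr p) \<longlonglongrightarrow> \<bar>norm (deriv f z) * norm (h z - h z)\<bar> powr p"
        unfolding u_def using p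
        by (intro tendsto_powr' tendsto_rabs tendsto_mult tendsto_norm tendsto_diff tendsto_const
            LIMSEQ_Suc[OF fejer_tendsto[OF V_holomorphic[OF hV] z]]) auto
      then show ?thesis using p by simp
    qed
    then show "AE z in W. (\<lambda>n. \<bar>u n z\<bar> powr p) \<longlonglongrightarrow> 0" by (intro AE_I2) auto
  qed (use ub in auto)
  then have ulim: "(\<lambda>n. Lp_norm W p (u n)) \<longlonglongrightarrow> 0" by (intro Lp_norm_tendsto_0I) simp
  have "Lp_norm W p (v n) = K * Lp_norm W p (\<lambda>z. norm (deriv (fejer (Suc n) h) z - deriv h z))" for n
    unfolding v_def using K by (simp add: Lp_norm_scale[OF p0])
  then have "(\<lambda>n. Lp_norm W p (v n)) \<longlonglongrightarrow> 0"
    using tendsto_mult_left[OF Lp_deriv_fejer_diff_tendsto[OF hV], of K] by simp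
  from tendsto_add[OF ulim this] have "(\<lambda>n. Lp_norm W p (u n) + Lp_norm W p (v n)) \<longlonglongrightarrow> 0" by simp
  then show ?thesis
    by (rule tendsto_sandwich[OF _ _ tendsto_const, rotated 2]) (use le in auto)
qed

lemma closed_subspace_scale: "closed_subspace p \<alpha> M \<Longrightarrow> h \<in> M \<Longrightarrow> (\<lambda>z. c * h z) \<in> M"
  and closed_subspace_add: "closed_subspace p \<alpha> M \<Longrightarrow> g \<in> M \<Longrightarrow> h \<in> M \<Longrightarrow> (\<lambda>z. g z + h z) \<in> M"
  and closed_subspace_V: "closed_subspace p \<alpha> M \<Longrightarrow> h \<in> M \<Longrightarrow> h \<in> V"
  by (auto simp: closed_subspace_def)

lemma closed_subspace_limit:
  assumes M: "closed_subspace p \<alpha> M" and g: "g \<in> V" and h: "\<And>n. h n \<in> M"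
    and lim: "(\<lambda>n. sum_norm (\<lambda>z. h n z - g z)) \<longlonglongrightarrow> 0"
  shows "g \<in> M"
proof -
  have "h n \<in> V" for n by (rule closed_subspace_V[OF M h])
  then have "besov_dirichlet_norm p \<alpha> (\<lambda>z. h n z - g z) \<le> sum_norm (\<lambda>z. h n z - g z)" for n
    using g by (intro besov_dirichlet_norm_le diff)
  then have "(\<lambda>n. besov_dirichlet_norm p \<alpha> (\<lambda>z. h n z - g z)) \<longlonglongrightarrow> 0"
    by (intro tendsto_sandwich[OF _ _ tendsto_const lim]) (auto simp: besov_dirichlet_norm_def)
  then show ?thesis using M g h unfolding closed_subspace_def by blast
qed

lemma closed_subspace_sum:
  fixes n :: nat
  assumes M: "closed_subspace p \<alpha> M" and g: "\<And>k. k < n \<Longrightarrow> g k \<in> M"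
  shows "(\<lambda>z. \<Sum>k<n. g k z) \<in> M"
  using g
proof (induction n)
  case (Suc n)
  then have "(\<lambda>z. \<Sum>k<n. g k z) \<in> M" "g n \<in> M" by auto
  then have "(\<lambda>z. (\<Sum>k<n. g k z) + g n z) \<in> M" by (rule closed_subspace_add[OF M])
  then show ?case by simp
qed (use M in \<open>simp add: closed_subspace_def\<close>)

text \<open>Shift invariance puts the product of f with every polynomial into M. The Fejer means of
  h provide polynomials whose products with f converge to f h in norm, and M is closed.\<close>

lemma mult_in_invariant_subspace:
  assumes M: "closed_subspace p \<alpha> M" and S: "shift ` M \<subseteq> M"
    and fM: "f \<in> M" and f: "f \<in> bounded_V" and h: "h \<in> bounded_V"
  shows "(\<lambda>z. f z * h z) \<in> M"
proof (rule closed_subspace_limit[OF M _ _ sum_norm_mult_fejer_diff_tendsto[OF f h]])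
  show "(\<lambda>z. f z * h z) \<in> V" by (intro bounded_V_D bounded_V_mult f h)
  have zk: "(\<lambda>z. z ^ k * f z) \<in> M" for k
  proof (induction k)
    case (Suc k)
    then have "shift (\<lambda>z. z ^ k * f z) \<in> M" using S by auto
    then show ?case by (simp add: shift_def mult.assoc)
  qed (use fM in simp)
  show "(\<lambda>z. f z * fejer (Suc n) h z) \<in> M" for n
  proof -
    have "(\<lambda>z. c * (z ^ k * f z)) \<in> M" for c k
      by (rule closed_subspace_scale[OF M zk])
    then have "(\<lambda>z. \<Sum>k<Suc n. (of_nat (Suc n - k) / of_nat (Suc n) * taylor_coeff h k) * (z ^ k * f z)) \<in> M"
      by (intro closed_subspace_sum[OF M])
    also have "(\<lambda>z. \<Sum>k<Suc n. (of_nat (Suc n - k) / of_nat (Suc n) * taylor_coeff h k) * (z ^ k * f z)) =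
        (\<lambda>z. f z * fejer (Suc n) h z)"
      unfolding fejer_def sum_distrib_left by (intro ext sum.cong refl) (simp only: mult_ac)
    finally show ?thesis .
  qed
qed

end

subsection \<open>Outer functions\<close>

lemma measurable_cis_arc: "cis \<in> measurable (restrict_space lborel {0..<2 * pi}) (restrict_space borel (sphere 0 1))"
proof (rule measurable_restrict_space2)
  have "continuous_on UNIV cis" by (rule continuous_on_cis) (rule continuous_on_id)
  then have "cis \<in> borel_measurable lborel" by (simp add: borel_measurable_continuous_onI)
  then show "cis \<in> borel_measurable (restrict_space lborel {0..<2 * pi})"
    by (rule measurable_restrict_space1)
qed auto

lemma space_arc_length [simp]: "space arc_length = sphere 0 1"
  by (simp add: arc_length_def space_restrict_space)

lemma sets_arc_length: "sets arc_length = sets (restrict_space borel (sphere 0 1))"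
  by (simp add: arc_length_def)

lemma measurable_arc_length: "continuous_on (sphere 0 1) g \<Longrightarrow> g \<in> borel_measurable arc_length"
  unfolding measurable_cong_sets[OF sets_arc_length refl]
  by (rule borel_measurable_continuous_on_restrict)

lemma emeasure_arc_length: "emeasure arc_length (sphere 0 1) = ennreal (2 * pi)"
proof -
  have s: "sphere 0 1 \<in> sets (restrict_space borel (sphere (0::complex) 1))"
    by (auto simp: sets_restrict_space_iff)
  have "emeasure arc_length (sphere 0 1) =
      emeasure (restrict_space lborel {0..<2 * pi}) (cis -` sphere 0 1 \<inter> space (restrict_space lborel {0..<2 * pi}))"
    unfolding arc_length_def by (rule emeasure_distr[OF measurable_cis_arc s])
  also have "cis -` sphere 0 1 \<inter> space (restrict_space lborel {0..<2 * pi}) = {0..<2 * pi}"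
    by (auto simp: space_restrict_space)
  also have "emeasure (restrict_space lborel {0..<2 * pi}) {0..<2 * pi} = ennreal (2 * pi)"
    by (subst emeasure_restrict_space) auto
  finally show ?thesis .
qed

lemma finite_arc_length: "finite_measure arc_length"
  by (rule finite_measureI) (simp add: emeasure_arc_length)

lemma measure_arc_length: "measure arc_length (sphere 0 1) = 2 * pi"
  by (simp add: measure_def emeasure_arc_length)

lemma integral_arc_length_cnj_power:
  assumes n: "n > 0"
  shows "(\<integral>\<zeta>. cnj \<zeta> ^ n \<partial>arc_length) = 0"
proof -
  let ?f = "\<lambda>t. cis (- (real n * t))"
  let ?F = "\<lambda>t. \<i> / of_nat n * cis (- (real n * t))"
  have m: "(\<lambda>\<zeta>. cnj \<zeta> ^ n) \<in> borel_measurable (restrict_space borel (sphere 0 1))"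
    by (intro borel_measurable_continuous_on_restrict continuous_intros)
  have "(\<integral>\<zeta>. cnj \<zeta> ^ n \<partial>arc_length) = (\<integral>t. cnj (cis t) ^ n \<partial>restrict_space lborel {0..<2 * pi})"
    unfolding arc_length_def by (rule integral_distr[OF measurable_cis_arc m])
  also have "\<dots> = (\<integral>t. ?f t \<partial>restrict_space lborel {0..<2 * pi})"
    by (simp add: cis_cnj Complex.DeMoivre)
  also have "\<dots> = (\<integral>t. indicator {0..<2 * pi} t *\<^sub>R ?f t \<partial>lborel)"
    by (rule integral_restrict_space) auto
  \<comment> \<open>Adding the endpoint changes only a null set and gives the compact interval on
    which the fundamental theorem of calculus is applied.\<close>
  also have "\<dots> = (\<integral>t. indicator {0..2 * pi} t *\<^sub>R ?f t \<partial>lborel)"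
  proof (rule integral_cong_AE)
    show "AE t in lborel. indicator {0..<2 * pi} t *\<^sub>R ?f t = indicator {0..2 * pi} t *\<^sub>R ?f t"
      using AE_lborel_singleton[of "2 * pi"] by eventually_elim (auto simp: indicator_def)
    have "continuous_on UNIV ?f" by (intro continuous_intros)
    then have [measurable]: "?f \<in> borel_measurable borel" by (rule borel_measurable_continuous_onI)
    show "(\<lambda>t. indicator {0..<2 * pi} t *\<^sub>R ?f t) \<in> borel_measurable lborel"
      "(\<lambda>t. indicator {0..2 * pi} t *\<^sub>R ?f t) \<in> borel_measurable lborel"
      by measurable
  qed
  also have "\<dots> = ?F (2 * pi) - ?F 0"
  proof (rule integral_FTC_Icc)
    show "(?F has_vector_derivative ?f t) (at t within {0..2 * pi})" for t
    proof -
      have "(cis has_vector_derivative \<i> * cis x) (at x)" for x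
        by (rule has_vector_derivative_eq_rhs[OF has_vector_derivative_real_field[of "\<lambda>z. exp (\<i> * z)" _ x, unfolded cis_conv_exp[symmetric]]])
           (auto intro!: derivative_eq_intros simp: cis_conv_exp)
      then have "((cis \<circ> (\<lambda>t. - (real n * t))) has_vector_derivative (- real n) *\<^sub>R (\<i> * cis (- (real n * t)))) (at t)"
        by (intro vector_diff_chain_at) (auto intro!: derivative_eq_intros simp: has_real_derivative_iff_has_vector_derivative[symmetric])
      then have "(?F has_vector_derivative \<i> / of_nat n * ((- real n) *\<^sub>R (\<i> * cis (- (real n * t))))) (at t)"
        unfolding o_def by (rule has_vector_derivative_mult_right)
      moreover have "\<i> / of_nat n * ((- real n) *\<^sub>R (\<i> * cis (- (real n * t)))) = ?f t"
        using n by (simp add: scaleR_conv_of_real)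
      ultimately show ?thesis by (simp add: has_vector_derivative_at_within)
    qed
    show "continuous_on {0..2 * pi} ?f" by (intro continuous_intros)
  qed auto
  also have "\<dots> = 0"
    using cis_multiple_2pi[of "- real n"] by (simp add: mult_ac)
  finally show ?thesis .
qed

lemma poisson_kernel_bounds:
  assumes z: "norm z < 1" and w: "norm \<zeta> = 1"
  shows "0 \<le> Re ((\<zeta> + z) / (\<zeta> - z))" "norm ((\<zeta> + z) / (\<zeta> - z)) \<le> 2 / (1 - norm z)"
proof -
  have "Re ((\<zeta> + z) / (\<zeta> - z)) = ((norm \<zeta>)\<^sup>2 - (norm z)\<^sup>2) / (norm (\<zeta> - z))\<^sup>2"
    by (simp add: Re_divide cmod_power2) (simp add: power2_eq_square algebra_simps)
  also have "\<dots> \<ge> 0" using z w by (simp add: abs_square_le_1)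
  finally show "0 \<le> Re ((\<zeta> + z) / (\<zeta> - z))" .
  have "1 - norm z \<le> norm (\<zeta> - z)" using norm_triangle_ineq2[of \<zeta> z] w by simp
  moreover have "norm (\<zeta> + z) \<le> 2" using norm_triangle_ineq[of \<zeta> z] z w by simp
  ultimately show "norm ((\<zeta> + z) / (\<zeta> - z)) \<le> 2 / (1 - norm z)"
    unfolding norm_divide using z by (intro frac_le) auto
qed

lemma continuous_on_poisson:
  fixes z :: complex
  assumes "norm z < 1"
  shows "continuous_on (sphere 0 1) (\<lambda>\<zeta>. (\<zeta> + z) / (\<zeta> - z))"
  using assms by (intro continuous_intros) auto

text \<open>The kernel is 1 + 2 \<Sum> (z cnj \<zeta>)^n over n \<ge> 1, and the positive powers of
  \<open>cnj \<zeta>\<close> integrate to 0. The series is cut at N with the explicit remainder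
  \<open>R N\<close>, whose integral tends to 0.\<close>

lemma poisson_integral:
  assumes z: "norm z < 1"
  shows "(\<integral>\<zeta>. (\<zeta> + z) / (\<zeta> - z) \<partial>arc_length) = 2 * pi"
proof -
  interpret finite_measure arc_length by (rule finite_arc_length)
  have intb: "integrable arc_length g" if "continuous_on (sphere 0 1) g" for g :: "complex \<Rightarrow> complex"
  proof -
    have "bounded (g ` sphere 0 1)"
      using that by (intro compact_imp_bounded compact_continuous_image) auto
    then obtain B where "\<And>\<zeta>. \<zeta> \<in> sphere 0 1 \<Longrightarrow> norm (g \<zeta>) \<le> B" unfolding bounded_iff by blast
    then show ?thesis
      using measurable_arc_length[OF that] by (intro integrable_const_bound[of _ B]) auto
  qed
  define R where "R = (\<lambda>N \<zeta>. 2 * ((z * cnj \<zeta>) ^ Suc N / (1 - z * cnj \<zeta>)))"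
  have nz: "1 - z * cnj \<zeta> \<noteq> 0" if "\<zeta> \<in> sphere 0 1" for \<zeta>
  proof
    assume "1 - z * cnj \<zeta> = 0"
    then have "norm (z * cnj \<zeta>) = 1" by (metis norm_one right_minus_eq)
    then show False using that z by (simp add: norm_mult)
  qed
  have contR: "continuous_on (sphere 0 1) (R N)" for N
    unfolding R_def using nz by (intro continuous_intros) auto
  have dec: "(\<zeta> + z) / (\<zeta> - z) = 1 + (\<Sum>n<N. 2 * z ^ Suc n * cnj \<zeta> ^ Suc n) + R N \<zeta>" if "\<zeta> \<in> sphere 0 1" for \<zeta> N
  proof -
    define q where "q = z * cnj \<zeta>"
    have q1: "q \<noteq> 1" using nz[OF that] by (simp add: q_def)
    have "\<zeta> * cnj \<zeta> = 1" using that by (simp add: complex_norm_square[symmetric])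
    then have "\<zeta> - z = \<zeta> * (1 - q)" "\<zeta> + z = \<zeta> * (1 + q)"
      by (simp_all add: q_def algebra_simps)
    moreover have "\<zeta> \<noteq> 0" using that by auto
    ultimately have "(\<zeta> + z) / (\<zeta> - z) = (1 + q) / (1 - q)" by simp
    also have "\<dots> = 1 + 2 * (q * ((q ^ N - 1) / (q - 1))) + 2 * (q ^ Suc N / (1 - q))"
      using q1 by (simp add: field_simps)
    also have "(q ^ N - 1) / (q - 1) = (\<Sum>n<N. q ^ n)" using geometric_sum[OF q1] by simp
    also have "2 * (q * (\<Sum>n<N. q ^ n)) = (\<Sum>n<N. 2 * z ^ Suc n * cnj \<zeta> ^ Suc n)"
      unfolding sum_distrib_left by (intro sum.cong refl) (simp add: q_def power_mult_distrib mult_ac)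
    finally show ?thesis by (simp add: R_def q_def)
  qed
  have "(\<integral>\<zeta>. (\<zeta> + z) / (\<zeta> - z) \<partial>arc_length) = 2 * pi + (\<integral>\<zeta>. R N \<zeta> \<partial>arc_length)" for N
  proof -
    have ip: "integrable arc_length (\<lambda>\<zeta>. 2 * z ^ Suc n * cnj \<zeta> ^ Suc n)" for n
      by (intro intb continuous_intros)
    have "(\<integral>\<zeta>. (\<zeta> + z) / (\<zeta> - z) \<partial>arc_length) = (\<integral>\<zeta>. (1 + (\<Sum>n<N. 2 * z ^ Suc n * cnj \<zeta> ^ Suc n)) + R N \<zeta> \<partial>arc_length)"
      by (intro Bochner_Integration.integral_cong refl dec) auto
    also have "\<dots> = (\<integral>\<zeta>. 1 + (\<Sum>n<N. 2 * z ^ Suc n * cnj \<zeta> ^ Suc n) \<partial>arc_length) + (\<integral>\<zeta>. R N \<zeta> \<partial>arc_length)"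
      by (intro Bochner_Integration.integral_add intb contR continuous_intros)
    also have "(\<integral>\<zeta>. 1 + (\<Sum>n<N. 2 * z ^ Suc n * cnj \<zeta> ^ Suc n) \<partial>arc_length) =
        (\<integral>\<zeta>. 1 \<partial>arc_length) + (\<integral>\<zeta>. (\<Sum>n<N. 2 * z ^ Suc n * cnj \<zeta> ^ Suc n) \<partial>arc_length)"
      by (intro Bochner_Integration.integral_add intb continuous_intros)
    also have "(\<integral>\<zeta>. (\<Sum>n<N. 2 * z ^ Suc n * cnj \<zeta> ^ Suc n) \<partial>arc_length) = (\<Sum>n<N. \<integral>\<zeta>. 2 * z ^ Suc n * cnj \<zeta> ^ Suc n \<partial>arc_length)"
      by (intro Bochner_Integration.integral_sum ip)
    also have "\<dots> = 0"
    proof (rule sum.neutral, rule ballI)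
      fix n
      have "(\<integral>\<zeta>. 2 * z ^ Suc n * cnj \<zeta> ^ Suc n \<partial>arc_length) = 2 * z ^ Suc n * (\<integral>\<zeta>. cnj \<zeta> ^ Suc n \<partial>arc_length)"
        by (rule Bochner_Integration.integral_mult_right_zero)
      then show "(\<integral>\<zeta>. 2 * z ^ Suc n * cnj \<zeta> ^ Suc n \<partial>arc_length) = 0"
        using integral_arc_length_cnj_power[of "Suc n"] by simp
    qed
    also have "(\<integral>\<zeta>. 1 \<partial>arc_length) = complex_of_real (2 * pi)"
      using measure_arc_length by (simp add: scaleR_conv_of_real)
    finally show ?thesis by simp
  qed
  moreover have "(\<lambda>N. \<integral>\<zeta>. R N \<zeta> \<partial>arc_length) \<longlonglongrightarrow> 0"
  proof (rule Lim_null_comparison)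
    have Rle: "norm (R N \<zeta>) \<le> 2 * (norm z ^ Suc N / (1 - norm z))" if "\<zeta> \<in> sphere 0 1" for N \<zeta>
    proof -
      have "1 - norm z \<le> norm (1 - z * cnj \<zeta>)"
        using norm_triangle_ineq2[of 1 "z * cnj \<zeta>"] that by (simp add: norm_mult)
      then show ?thesis
        using that z unfolding R_def norm_mult norm_divide norm_power by (simp add: norm_mult frac_le)
    qed
    have "norm (\<integral>\<zeta>. R N \<zeta> \<partial>arc_length) \<le> 2 * pi * (2 * (norm z ^ Suc N / (1 - norm z)))" for N
    proof -
      have "norm (\<integral>\<zeta>. R N \<zeta> \<partial>arc_length) \<le> (\<integral>\<zeta>. norm (R N \<zeta>) \<partial>arc_length)"
        by (rule integral_norm_bound)
      also have "\<dots> \<le> (\<integral>\<zeta>. 2 * (norm z ^ Suc N / (1 - norm z)) \<partial>arc_length)"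
        using intb[OF contR] Rle by (intro integral_mono integrable_norm) auto
      finally show ?thesis using measure_arc_length by simp
    qed
    then show "eventually (\<lambda>N. norm (\<integral>\<zeta>. R N \<zeta> \<partial>arc_length) \<le> 2 * pi * (2 * (norm z ^ Suc N / (1 - norm z)))) sequentially"
      by simp
    have "(\<lambda>N. 2 * pi * (2 * (norm z ^ Suc N / (1 - norm z)))) \<longlonglongrightarrow> 2 * pi * (2 * (0 / (1 - norm z)))"
      using z by (intro tendsto_intros LIMSEQ_Suc[OF LIMSEQ_power_zero]) auto
    then show "(\<lambda>N. 2 * pi * (2 * (norm z ^ Suc N / (1 - norm z)))) \<longlonglongrightarrow> 0" by simp
  qed
  ultimately have "(\<lambda>N. \<integral>\<zeta>. (\<zeta> + z) / (\<zeta> - z) \<partial>arc_length) \<longlonglongrightarrow> 2 * pi + 0"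
    using tendsto_add[OF tendsto_const[of "complex_of_real (2 * pi)" sequentially]] by fastforce
  then show ?thesis by (simp add: LIMSEQ_const_iff)
qed

text \<open>Truncating \<open>log \<phi>\<close> at a high level leaves a remainder of small \<open>L\<^sup>1\<close> norm, on which the Poisson
  kernel is estimated by its maximum.\<close>

lemma outer_lower_bound:
  assumes f: "outer f" and \<epsilon>: "\<epsilon> > 0"
  shows "\<exists>C. \<forall>z. norm z < 1 \<longrightarrow> exp (- C - \<epsilon> / (1 - norm z)) \<le> norm (f z)"
proof -
  obtain \<phi> where g: "integrable arc_length (\<lambda>\<zeta>. ln (\<phi> \<zeta>))"
    and fz: "\<And>z. z \<in> ball 0 1 \<Longrightarrow> f z = exp (1 / (2 * complex_of_real pi) *
                (\<integral>\<zeta>. (\<zeta> + z) / (\<zeta> - z) * complex_of_real (ln (\<phi> \<zeta>)) \<partial>arc_length))"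
    using f unfolding outer_def by blast
  define g where "g = (\<lambda>\<zeta>. ln (\<phi> \<zeta>))"
  have g: "integrable arc_length g" using g by (simp add: g_def)
  have gm [measurable]: "g \<in> borel_measurable arc_length" using g by auto
  \<comment> \<open>The part of |g| above the level n; its integral tends to 0 by dominated
    convergence. The part below costs n times the total Poisson mass, which is the same for every
    z.\<close>
  define T where "T = (\<lambda>n \<zeta>. if real n < \<bar>g \<zeta>\<bar> then \<bar>g \<zeta>\<bar> else 0)"
  have Tm [measurable]: "T n \<in> borel_measurable arc_length" for n unfolding T_def by measurable
  have Ti: "integrable arc_length (T n)" for n
    by (rule Bochner_Integration.integrable_bound[OF g]) (auto simp: T_def)
  have "(\<lambda>n. \<integral>\<zeta>. T n \<zeta> \<partial>arc_length) \<longlonglongrightarrow> (\<integral>\<zeta>. 0 \<partial>arc_length)"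
  proof (rule integral_dominated_convergence[where w = "\<lambda>\<zeta>. \<bar>g \<zeta>\<bar>"])
    have "(\<lambda>n. T n \<zeta>) \<longlonglongrightarrow> 0" for \<zeta>
    proof (rule tendsto_eventually)
      obtain n0 where "\<bar>g \<zeta>\<bar> \<le> real n0" using real_arch_simple by blast
      then show "eventually (\<lambda>n. T n \<zeta> = 0) sequentially"
        by (intro eventually_sequentiallyI[of n0]) (auto simp: T_def)
    qed
    then show "AE \<zeta> in arc_length. (\<lambda>n. T n \<zeta>) \<longlonglongrightarrow> 0" by simp
  qed (use g in \<open>auto simp: T_def\<close>)
  then have "eventually (\<lambda>n. (\<integral>\<zeta>. T n \<zeta> \<partial>arc_length) < \<epsilon>) sequentially"
    using \<epsilon> by (intro order_tendstoD) auto
  then obtain n where n: "(\<integral>\<zeta>. T n \<zeta> \<partial>arc_length) < \<epsilon>" by (auto simp: eventually_sequentially)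
  have "exp (- real n - \<epsilon> / (1 - norm z)) \<le> norm (f z)" if z: "norm z < 1" for z
  proof -
    define k where "k = (\<lambda>\<zeta>. (\<zeta> + z) / (\<zeta> - z))"
    have km [measurable]: "k \<in> borel_measurable arc_length"
      unfolding k_def by (rule measurable_arc_length[OF continuous_on_poisson[OF z]])
    have kb: "0 \<le> Re (k \<zeta>)" "norm (k \<zeta>) \<le> 2 / (1 - norm z)" if "\<zeta> \<in> sphere 0 1" for \<zeta>
      using poisson_kernel_bounds[OF z, of \<zeta>] that by (auto simp: k_def)
    have Rk: "Re (k \<zeta>) \<le> 2 / (1 - norm z)" if "\<zeta> \<in> sphere 0 1" for \<zeta>
      using kb(2)[OF that] complex_Re_le_cmod[of "k \<zeta>"] by linarith
    have ik: "integrable arc_length k"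
      using kb by (intro finite_measure.integrable_const_bound[OF finite_arc_length, of _ "2 / (1 - norm z)"]) auto
    have ikg: "integrable arc_length (\<lambda>\<zeta>. k \<zeta> * complex_of_real (g \<zeta>))"
    proof (rule Bochner_Integration.integrable_bound)
      show "integrable arc_length (\<lambda>\<zeta>. 2 / (1 - norm z) * g \<zeta>)" using g by simp
      have "norm (k \<zeta> * complex_of_real (g \<zeta>)) \<le> norm (2 / (1 - norm z) * g \<zeta>)" if "\<zeta> \<in> sphere 0 1" for \<zeta>
        using mult_right_mono[OF kb(2)[OF that], of "\<bar>g \<zeta>\<bar>"] z by (simp add: norm_mult abs_mult)
      then show "AE \<zeta> in arc_length. norm (k \<zeta> * complex_of_real (g \<zeta>)) \<le> norm (2 / (1 - norm z) * g \<zeta>)"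
        by (intro AE_I2) simp
    qed measurable
    define J where "J = (\<integral>\<zeta>. Re (k \<zeta> * complex_of_real (g \<zeta>)) \<partial>arc_length)"
    have nf: "norm (f z) = exp (J / (2 * pi))"
    proof -
      have "norm (f z) = exp (Re (1 / (2 * complex_of_real pi) * (\<integral>\<zeta>. k \<zeta> * complex_of_real (g \<zeta>) \<partial>arc_length)))"
        using fz[of z] z by (simp add: k_def g_def)
      also have "1 / (2 * complex_of_real pi) = complex_of_real (1 / (2 * pi))" by simp
      also have "Re (complex_of_real (1 / (2 * pi)) * (\<integral>\<zeta>. k \<zeta> * complex_of_real (g \<zeta>) \<partial>arc_length)) = J / (2 * pi)"
        using integral_Re[OF ikg] by (simp add: J_def)
      finally show ?thesis .
    qed
    have iR: "integrable arc_length (\<lambda>\<zeta>. Re (k \<zeta>))" using ik by (rule integrable_Re)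
    have "(\<integral>\<zeta>. - (real n * Re (k \<zeta>) + 2 / (1 - norm z) * T n \<zeta>) \<partial>arc_length) \<le> J"
      unfolding J_def
    proof (rule integral_mono)
      show "integrable arc_length (\<lambda>\<zeta>. - (real n * Re (k \<zeta>) + 2 / (1 - norm z) * T n \<zeta>))"
        using iR Ti by auto
      show "integrable arc_length (\<lambda>\<zeta>. Re (k \<zeta> * complex_of_real (g \<zeta>)))"
        by (rule integrable_Re[OF ikg])
      fix \<zeta> assume "\<zeta> \<in> space arc_length"
      then have \<zeta>: "\<zeta> \<in> sphere 0 1" by simp
      have T0: "T n \<zeta> \<ge> 0" "\<bar>g \<zeta>\<bar> \<le> real n + T n \<zeta>" by (auto simp: T_def)
      have "Re (k \<zeta>) * (- g \<zeta>) \<le> Re (k \<zeta>) * \<bar>g \<zeta>\<bar>"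
        using kb(1)[OF \<zeta>] by (intro mult_left_mono) auto
      also have "\<dots> \<le> Re (k \<zeta>) * (real n + T n \<zeta>)"
        using kb(1)[OF \<zeta>] T0 by (intro mult_left_mono) auto
      also have "\<dots> \<le> real n * Re (k \<zeta>) + 2 / (1 - norm z) * T n \<zeta>"
        using mult_right_mono[OF Rk[OF \<zeta>] T0(1)] by (simp add: algebra_simps)
      finally show "- (real n * Re (k \<zeta>) + 2 / (1 - norm z) * T n \<zeta>) \<le> Re (k \<zeta> * complex_of_real (g \<zeta>))"
        by simp
    qed
    also have "(\<integral>\<zeta>. - (real n * Re (k \<zeta>) + 2 / (1 - norm z) * T n \<zeta>) \<partial>arc_length) =
      - (real n * (\<integral>\<zeta>. Re (k \<zeta>) \<partial>arc_length) + 2 / (1 - norm z) * (\<integral>\<zeta>. T n \<zeta> \<partial>arc_length))"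
      using iR Ti by simp
    also have "(\<integral>\<zeta>. Re (k \<zeta>) \<partial>arc_length) = 2 * pi"
      using integral_Re[OF ik] poisson_integral[OF z] by (simp add: k_def)
    finally have "- (real n * (2 * pi) + 2 / (1 - norm z) * (\<integral>\<zeta>. T n \<zeta> \<partial>arc_length)) \<le> J" .
    moreover have "2 / (1 - norm z) * (\<integral>\<zeta>. T n \<zeta> \<partial>arc_length) \<le> 2 / (1 - norm z) * \<epsilon>"
      using n z by (intro mult_left_mono) auto
    ultimately have "- (real n * (2 * pi) + 2 / (1 - norm z) * \<epsilon>) \<le> J" by linarith
    \<comment> \<open>A factor 1 / pi is given away here, to keep the clean form \<epsilon> / (1 -
      |z|).\<close>
    moreover have "\<epsilon> / (1 - norm z) * 2 \<le> \<epsilon> / (1 - norm z) * (2 * pi)"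
      using z \<epsilon> pi_ge_two by (intro mult_left_mono) auto
    then have "2 / (1 - norm z) * \<epsilon> \<le> \<epsilon> / (1 - norm z) * (2 * pi)"
      by (simp add: mult.commute)
    ultimately have "(- real n - \<epsilon> / (1 - norm z)) * (2 * pi) \<le> J" by (simp add: algebra_simps)
    then have "- real n - \<epsilon> / (1 - norm z) \<le> J / (2 * pi)"
      by (simp add: pos_le_divide_eq)
    then show ?thesis by (simp add: nf)
  qed
  then show ?thesis by blast
qed

subsection \<open>The resolvent modulo an invariant subspace\<close>

text \<open>Let d = 1 - |l|. At distance at least d / 2 from l the denominator gives the bound on k,
  and the maximum modulus principle carries it inside. For the derivative, the relation (z - l) k' =
  f' - k is solved for k' at distance at least d / 4, and Cauchy's inequality on a disc of radius d
  / 4 is used closer to l.\<close>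

lemma difference_quotient_bounds:
  fixes f :: "complex \<Rightarrow> complex"
  assumes f: "f holomorphic_on ball 0 1" and K: "\<And>z. z \<in> ball 0 1 \<Longrightarrow> norm (f z) \<le> K"
    and l: "norm l < 1"
  defines "k \<equiv> \<lambda>z. if z = l then deriv f l else (f z - f l) / (z - l)"
  shows "k holomorphic_on ball 0 1"
    and "z \<in> ball 0 1 \<Longrightarrow> norm (k z) \<le> 4 * K / (1 - norm l)"
    and "z \<in> ball 0 1 \<Longrightarrow> norm (deriv k z) \<le> 4 / (1 - norm l) * norm (deriv f z) + 16 * K / (1 - norm l)\<^sup>2"
proof -
  define d where "d = 1 - norm l"
  have d: "d > 0" using l by (simp add: d_def)
  have lD: "l \<in> ball 0 1" using l by simp
  have K0: "K \<ge> 0" using K[OF lD] norm_ge_zero order_trans by blast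
  show hol: "k holomorphic_on ball 0 1"
    unfolding k_def by (rule pole_lemma_open[OF f open_ball])
  have far: "norm (k z) \<le> 4 * K / d" if z: "z \<in> ball 0 1" and dist: "d / 2 \<le> norm (z - l)" for z
  proof -
    have "z \<noteq> l" using dist d by auto
    moreover have "norm (f z - f l) \<le> K + K" using K[OF z] K[OF lD] by (intro norm_triangle_le_diff) auto
    ultimately have "norm (k z) \<le> (K + K) / (d / 2)"
      unfolding k_def using dist d K0 by (simp add: norm_divide del: divide_divide_eq_right) (intro frac_le, auto)
    then show ?thesis by simp
  qed
  have inD: "z \<in> ball 0 1" if "norm (z - l) < d" for z
    using norm_triangle_ineq[of "z - l" l] that by (simp add: d_def)
  have kb: "norm (k z) \<le> 4 * K / d" if z: "z \<in> ball 0 1" for z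
  proof (cases "d / 2 \<le> norm (z - l)")
    case False
    show ?thesis
    proof (rule maximum_modulus_compact[of "cball l (d / 2)" "ball l (d / 2)" k])
      have "cball l (d / 2) \<subseteq> ball 0 1" using inD d by (auto simp: dist_norm norm_minus_commute)
      then show "k holomorphic_on cball l (d / 2)" using hol holomorphic_on_subset by blast
      fix v assume "v \<in> cball l (d / 2) - ball l (d / 2)"
      then have "norm (v - l) = d / 2" by (auto simp: dist_norm norm_minus_commute)
      then show "norm (k v) \<le> 4 * K / d" using d by (intro far inD) auto
    qed (use False in \<open>auto simp: dist_norm norm_minus_commute\<close>)
  qed (rule far[OF z])
  show "norm (k z) \<le> 4 * K / (1 - norm l)" if "z \<in> ball 0 1" for z
    using kb[OF that] by (simp add: d_def)
  show "norm (deriv k z) \<le> 4 / (1 - norm l) * norm (deriv f z) + 16 * K / (1 - norm l)\<^sup>2" if z: "z \<in> ball 0 1" for z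
  proof (cases "d / 4 \<le> norm (z - l)")
    case True
    have "deriv (\<lambda>z. (z - l) * k z) z = deriv (\<lambda>z. f z - f l) z"
      by (rule deriv_cong_ev) (auto simp: k_def intro!: always_eventually)
    moreover have "(k has_field_derivative deriv k z) (at z)" "(f has_field_derivative deriv f z) (at z)"
      using hol f z by (auto intro: holomorphic_derivI)
    then have "deriv (\<lambda>z. (z - l) * k z) z = k z + (z - l) * deriv k z" "deriv (\<lambda>z. f z - f l) z = deriv f z"
      by (auto intro!: DERIV_imp_deriv derivative_eq_intros)
    ultimately have eq: "(z - l) * deriv k z = deriv f z - k z"
      by (simp add: eq_diff_eq add.commute)
    have "norm (z - l) * norm (deriv k z) \<le> norm (deriv f z) + 4 * K / d"
      unfolding norm_mult[symmetric] eq using kb[OF z] by (intro norm_triangle_le_diff) auto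
    moreover have "d / 4 * norm (deriv k z) \<le> norm (z - l) * norm (deriv k z)"
      using True by (intro mult_right_mono) auto
    ultimately have "d / 4 * norm (deriv k z) \<le> norm (deriv f z) + 4 * K / d" by linarith
    then have "4 / d * (d / 4 * norm (deriv k z)) \<le> 4 / d * (norm (deriv f z) + 4 * K / d)"
      using d by (intro mult_left_mono) auto
    then show ?thesis
      using d by (simp add: d_def[symmetric] power2_eq_square distrib_left)
  next
    case False
    have sub: "cball z (d / 4) \<subseteq> ball 0 1"
    proof
      fix v assume "v \<in> cball z (d / 4)"
      then have "norm (v - z) \<le> d / 4" by (simp add: dist_norm norm_minus_commute)
      then have "norm (v - l) < d"
        using norm_triangle_ineq[of "v - z" "z - l"] False d by simp
      then show "v \<in> ball 0 1" by (rule inD)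
    qed
    have "norm ((deriv ^^ 1) k z) \<le> fact 1 * (4 * K / d) / (d / 4) ^ 1"
    proof (rule Cauchy_inequality)
      have "ball z (d / 4) \<subseteq> ball 0 1" using sub ball_subset_cball by blast
      then show "k holomorphic_on ball z (d / 4)" using hol holomorphic_on_subset by blast
      show "continuous_on (cball z (d / 4)) k"
        using hol sub holomorphic_on_imp_continuous_on continuous_on_subset by blast
      show "norm (k x) \<le> 4 * K / d" if "norm (z - x) = d / 4" for x
        using that sub by (intro kb) (auto simp: dist_norm)
    qed (use d in auto)
    then have "norm (deriv k z) \<le> 16 * K / d\<^sup>2"
      using d by (simp add: power2_eq_square field_simps)
    moreover have "0 \<le> 4 / d * norm (deriv f z)" using d by simp
    ultimately show ?thesis by (simp add: d_def)
  qed
qed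

text \<open>\<open>L\<close> is constrained on \<open>V\<close> only and arbitrary elsewhere. The
  constant 2 is the one from \<open>hahn_banach\<close>.\<close>

locale annihilator = besov +
  fixes f :: "complex \<Rightarrow> complex" and L :: "(complex \<Rightarrow> complex) \<Rightarrow> complex"
  assumes f: "f \<in> bounded_V"
    and L_add: "g \<in> V \<Longrightarrow> h \<in> V \<Longrightarrow> L (\<lambda>z. g z + h z) = L g + L h"
    and L_scale: "g \<in> V \<Longrightarrow> L (\<lambda>z. c * g z) = c * L g"
    and L_bound: "g \<in> V \<Longrightarrow> norm (L g) \<le> 2 * sum_norm g"
    and L_f: "h \<in> bounded_V \<Longrightarrow> L (\<lambda>z. f z * h z) = 0"
begin

lemma L_diff: "g \<in> V \<Longrightarrow> h \<in> V \<Longrightarrow> L (\<lambda>z. g z - h z) = L g - L h"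
  using L_add[of g "\<lambda>z. - h z"] L_scale[of h "-1"] uminus[of h] by simp

lemma L_cong:
  assumes "g \<in> V" "\<And>z. z \<in> disc \<Longrightarrow> g z = h z"
  shows "L g = L h"
proof -
  have h: "h \<in> V" by (rule V_cong[OF assms(2,1)])
  have "norm (L (\<lambda>z. g z - h z)) \<le> 2 * sum_norm (\<lambda>z. g z - h z)"
    by (intro L_bound diff assms h)
  also have "sum_norm (\<lambda>z. g z - h z) = sum_norm (\<lambda>z. 0)"
    by (rule sum_norm_cong) (simp add: assms(2))
  also have "\<dots> = 0"
    using sum_norm_scale[OF zero, of 0] by simp
  finally show ?thesis using L_diff[OF assms(1) h] by simp
qed

text \<open>In the algebra \<open>bounded_V\<close>, g is inverse to z - l modulo the ideal
  generated by f, an ideal that \<open>L\<close> annihilates.\<close>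

definition inverse_mod :: "complex \<Rightarrow> (complex \<Rightarrow> complex) \<Rightarrow> bool" where
  "inverse_mod l g \<longleftrightarrow> g \<in> bounded_V \<and> (\<exists>b\<in>bounded_V. \<forall>z\<in>disc. (z - l) * g z = 1 + f z * b z)"

text \<open>Evaluating the product g1 (z - l) g2 in two ways shows that g1 - g2 is a multiple of
  f.\<close>

lemma inverse_mod_unique:
  assumes "inverse_mod l g1" "inverse_mod l g2"
  shows "L g1 = L g2"
proof -
  obtain b1 b2 where g: "g1 \<in> bounded_V" "g2 \<in> bounded_V" and b: "b1 \<in> bounded_V" "b2 \<in> bounded_V"
    and e: "\<And>z. z \<in> disc \<Longrightarrow> (z - l) * g1 z = 1 + f z * b1 z" "\<And>z. z \<in> disc \<Longrightarrow> (z - l) * g2 z = 1 + f z * b2 z"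
    using assms unfolding inverse_mod_def by blast
  have "g1 z - g2 z = f z * (b1 z * g2 z - b2 z * g1 z)" if "z \<in> disc" for z
  proof -
    have "g1 z * ((z - l) * g2 z) = g2 z * ((z - l) * g1 z)" by simp
    then show ?thesis unfolding e[OF that] by (simp add: algebra_simps)
  qed
  then have "L (\<lambda>z. g1 z - g2 z) = L (\<lambda>z. f z * (b1 z * g2 z - b2 z * g1 z))"
    using g by (intro L_cong diff bounded_V_D)
  also have "\<dots> = 0" using g b by (intro L_f bounded_V_diff bounded_V_mult)
  finally show ?thesis using L_diff[of g1 g2] g bounded_V_D by simp
qed

definition Phi :: "complex \<Rightarrow> complex" where
  "Phi l = L (SOME g. inverse_mod l g)"

lemma Phi_eq: "inverse_mod l g \<Longrightarrow> Phi l = L g"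
  unfolding Phi_def using someI[of "inverse_mod l" g] by (auto intro: inverse_mod_unique)

text \<open>If g inverts z - l modulo f, then g / (1 - \<delta> g) inverts z - l - \<delta>, and it
  equals g + \<delta> g^2 + \<delta>^2 r with r = g^3 / (1 - \<delta> g). The derivative is
  therefore L (g^2), once r is bounded in norm uniformly for small \<delta>.\<close>

lemma Phi_has_derivative:
  assumes g: "inverse_mod l g"
  shows "Phi field_differentiable at l"
proof -
  obtain b where gB: "g \<in> bounded_V" and b: "b \<in> bounded_V" and e: "\<And>z. z \<in> disc \<Longrightarrow> (z - l) * g z = 1 + f z * b z"
    using g unfolding inverse_mod_def by blast
  have gV: "g \<in> V" by (rule bounded_V_D[OF gB])
  obtain G where G: "G > 0" "\<And>z. z \<in> disc \<Longrightarrow> norm (g z) \<le> G" using bounded_V_E[OF gB] by blast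
  \<comment> \<open>For |\<delta>| \<le> 1 / (2 G) one has |1 - \<delta> g| \<ge> 1/2. Hence |r|
    \<le> 2 G^3, and |r'| is at most 6 + 2 times G^2 |g'|; the outer factor 2 is the bound of
    \<open>L\<close>.\<close>
  define C where "C = 2 * (2 * G ^ 3 + 8 * G\<^sup>2 * seminorm g)"
  have key: "norm (Phi (l + \<delta>) - Phi l - \<delta> * L (\<lambda>z. (g z)\<^sup>2)) \<le> (norm \<delta>)\<^sup>2 * C" if \<delta>: "norm \<delta> \<le> 1 / (2 * G)" for \<delta>
  proof -
    define w where "w = (\<lambda>z. 1 - \<delta> * g z)"
    have dG: "norm \<delta> * G \<le> 1 / 2" using \<delta> G by (simp add: field_simps)
    have w2: "1 / 2 \<le> norm (w z)" if "z \<in> disc" for z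
    proof -
      have "norm (\<delta> * g z) \<le> norm \<delta> * G" using G(2)[OF that] by (simp add: norm_mult mult_left_mono)
      then show ?thesis using norm_triangle_ineq2[of 1 "\<delta> * g z"] dG by (simp add: w_def)
    qed
    have wn: "w z \<noteq> 0" if "z \<in> disc" for z using w2[OF that] by auto
    have wB: "w \<in> bounded_V" unfolding w_def by (intro bounded_V_diff bounded_V_mult bounded_V_const gB)
    have iw: "(\<lambda>z. 1 / w z) \<in> bounded_V" by (rule bounded_V_inverse[OF wB _ w2]) simp
    have gw: "(\<lambda>z. g z * (1 / w z)) \<in> bounded_V" by (intro bounded_V_mult gB iw)
    have "inverse_mod (l + \<delta>) (\<lambda>z. g z * (1 / w z))"
      unfolding inverse_mod_def
    proof (intro conjI gw bexI ballI)
      show "(\<lambda>z. b z * (1 / w z)) \<in> bounded_V" by (intro bounded_V_mult b iw)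
      fix z assume z: "z \<in> disc"
      have "(z - (l + \<delta>)) * g z = w z + f z * b z"
        using e[OF z] by (simp add: w_def algebra_simps)
      then have "(z - (l + \<delta>)) * (g z * (1 / w z)) = (w z + f z * b z) * (1 / w z)" by simp
      also have "\<dots> = 1 + f z * (b z * (1 / w z))" using wn[OF z] by (simp add: field_simps)
      finally show "(z - (l + \<delta>)) * (g z * (1 / w z)) = 1 + f z * (b z * (1 / w z))" .
    qed
    then have P1: "Phi (l + \<delta>) = L (\<lambda>z. g z * (1 / w z))" by (rule Phi_eq)
    define r where "r = (\<lambda>z. g z ^ 3 * (1 / w z))"
    have rB: "r \<in> bounded_V" unfolding r_def by (intro bounded_V_mult bounded_V_power gB iw)
    have g2: "(\<lambda>z. (g z)\<^sup>2) \<in> V" by (intro bounded_V_D bounded_V_power gB)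
    have "g z * (1 / w z) = g z + (\<delta> * (g z)\<^sup>2 + \<delta>\<^sup>2 * r z)" if "z \<in> disc" for z
      using wn[OF that] by (simp add: r_def field_simps) (simp add: w_def algebra_simps power2_eq_square power3_eq_cube)
    then have "L (\<lambda>z. g z * (1 / w z)) = L (\<lambda>z. g z + (\<delta> * (g z)\<^sup>2 + \<delta>\<^sup>2 * r z))"
      by (rule L_cong[OF bounded_V_D[OF gw]])
    also have "\<dots> = L g + (\<delta> * L (\<lambda>z. (g z)\<^sup>2) + \<delta>\<^sup>2 * L r)"
      using gV g2 bounded_V_D[OF rB] by (simp add: L_add L_scale add scale)
    finally have "Phi (l + \<delta>) - Phi l - \<delta> * L (\<lambda>z. (g z)\<^sup>2) = \<delta>\<^sup>2 * L r"
      unfolding P1 Phi_eq[OF g] by simp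
    moreover have "norm (L r) \<le> C"
    proof -
      have "norm (deriv r z) \<le> 8 * G\<^sup>2 * norm (deriv g z) + 0 * norm (deriv g z) + 0" if z: "z \<in> disc" for z
      proof -
        have dg: "(g has_field_derivative deriv g z) (at z)"
          using V_field_differentiable[OF gV z] by (simp add: field_differentiable_derivI)
        have "(r has_field_derivative (3 * (g z)\<^sup>2 * deriv g z * (1 / w z) + g z ^ 3 * (\<delta> * deriv g z / (w z)\<^sup>2))) (at z)"
        proof -
          have dw: "(w has_field_derivative - (\<delta> * deriv g z)) (at z)"
            unfolding w_def by (auto intro!: derivative_eq_intros dg)
          have "((\<lambda>z. 1 / w z) has_field_derivative \<delta> * deriv g z / (w z)\<^sup>2) (at z)"
            using DERIV_divide[OF DERIV_const[of 1] dw wn[OF z]] by (simp add: power2_eq_square)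
          from DERIV_mult[OF DERIV_power[OF dg, of 3] this] show ?thesis
            unfolding r_def by (simp add: mult_ac add_ac)
        qed
        then have "deriv r z = deriv g z * (3 * (g z)\<^sup>2 * (1 / w z) + \<delta> * g z ^ 3 * (1 / w z)\<^sup>2)"
          by (simp add: DERIV_imp_deriv algebra_simps power_divide)
        moreover have "norm (3 * (g z)\<^sup>2 * (1 / w z) + \<delta> * g z ^ 3 * (1 / w z)\<^sup>2) \<le> 3 * G\<^sup>2 * 2 + (norm \<delta> * G) * G\<^sup>2 * 2\<^sup>2"
        proof (rule norm_triangle_mono)
          have w': "norm (1 / w z) \<le> 2" using w2[OF z] wn[OF z] by (simp add: norm_divide pos_divide_le_eq)
          have gz: "norm (g z) \<le> G" by (rule G(2)[OF z])
          show "norm (3 * (g z)\<^sup>2 * (1 / w z)) \<le> 3 * G\<^sup>2 * 2"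
            unfolding norm_mult norm_power using w' gz G(1) by (intro mult_mono power_mono) auto
          have "norm (\<delta> * g z ^ 3 * (1 / w z)\<^sup>2) \<le> norm \<delta> * G ^ 3 * 2\<^sup>2"
            unfolding norm_mult norm_power using w' gz G(1) by (intro mult_mono power_mono) auto
          also have "\<dots> = (norm \<delta> * G) * G\<^sup>2 * 2\<^sup>2" by (simp add: power3_eq_cube power2_eq_square)
          finally show "norm (\<delta> * g z ^ 3 * (1 / w z)\<^sup>2) \<le> (norm \<delta> * G) * G\<^sup>2 * 2\<^sup>2" .
        qed
        moreover have "(norm \<delta> * G) * G\<^sup>2 * 2\<^sup>2 \<le> (1 / 2) * G\<^sup>2 * 2\<^sup>2"
          using dG by (intro mult_right_mono) auto
        ultimately show ?thesis
          using mult_left_mono[of "norm (3 * (g z)\<^sup>2 * (1 / w z) + \<delta> * g z ^ 3 * (1 / w z)\<^sup>2)" "8 * G\<^sup>2" "norm (deriv g z)"]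
          by (simp add: norm_mult mult_ac)
      qed
      then have "seminorm r \<le> 8 * G\<^sup>2 * seminorm g + 0 * seminorm g + 0 * mass"
        by (intro V_dominated(2)[OF V_holomorphic[OF bounded_V_D[OF rB]] gV gV]) auto
      moreover have "norm (r 0) \<le> G ^ 3 * 2"
      proof -
        have "norm (1 / w 0) \<le> 2" using w2[of 0] wn[of 0] by (simp add: norm_divide pos_divide_le_eq)
        then show ?thesis
          unfolding r_def norm_mult norm_power using G(1) G(2)[of 0] by (intro mult_mono power_mono) auto
      qed
      ultimately have "sum_norm r \<le> 2 * G ^ 3 + 8 * G\<^sup>2 * seminorm g" by (simp add: sum_norm_def)
      then show ?thesis using L_bound[OF bounded_V_D[OF rB]] by (simp add: C_def)
    qed
    ultimately show ?thesis by (simp add: norm_mult norm_power mult_left_mono)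
  qed
  have "((\<lambda>y. (Phi y - Phi l) / (y - l)) \<longlongrightarrow> L (\<lambda>z. (g z)\<^sup>2)) (at l)"
  proof (rule Lim_transform2)
    show "((\<lambda>y. L (\<lambda>z. (g z)\<^sup>2)) \<longlongrightarrow> L (\<lambda>z. (g z)\<^sup>2)) (at l)" by (rule tendsto_const)
    show "((\<lambda>y. L (\<lambda>z. (g z)\<^sup>2) - (Phi y - Phi l) / (y - l)) \<longlongrightarrow> 0) (at l)"
    proof (rule Lim_null_comparison)
      have "eventually (\<lambda>y. y \<in> cball l (1 / (2 * G)) - {l}) (at l)"
        using eventually_at_in_open[of "ball l (1 / (2 * G))" l] G(1)
        by (auto elim: eventually_mono)
      then show "eventually (\<lambda>y. norm (L (\<lambda>z. (g z)\<^sup>2) - (Phi y - Phi l) / (y - l)) \<le> norm (y - l) * C) (at l)"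
      proof eventually_elim
        case (elim y)
        then have y: "y - l \<noteq> 0" "norm (y - l) \<le> 1 / (2 * G)" by (auto simp: dist_norm norm_minus_commute)
        have "L (\<lambda>z. (g z)\<^sup>2) - (Phi y - Phi l) / (y - l) = - (Phi y - Phi l - (y - l) * L (\<lambda>z. (g z)\<^sup>2)) / (y - l)"
          using y(1) by (simp add: divide_simps)
        then have "norm (L (\<lambda>z. (g z)\<^sup>2) - (Phi y - Phi l) / (y - l)) =
            norm (Phi y - Phi l - (y - l) * L (\<lambda>z. (g z)\<^sup>2)) / norm (y - l)"
          by (simp add: norm_divide norm_minus_commute)
        also have "\<dots> \<le> (norm (y - l))\<^sup>2 * C / norm (y - l)"
          using key[OF y(2)] by (intro divide_right_mono) auto
        also have "\<dots> = norm (y - l) * C" using y(1) by (simp add: power2_eq_square)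
        finally show ?case .
      qed
      have "((\<lambda>y. norm (y - l) * C) \<longlongrightarrow> norm (l - l) * C) (at l)" by (intro tendsto_intros)
      then show "((\<lambda>y. norm (y - l) * C) \<longlongrightarrow> 0) (at l)" by simp
    qed
  qed
  then show ?thesis
    unfolding field_differentiable_def has_field_derivative_iff by blast
qed

text \<open>Here z - l is invertible in the algebra itself, with cofactor b = 0, and the norm of the
  inverse is governed by the distance of l to the disc.\<close>

lemma inverse_mod_outside:
  assumes l: "norm l > 1"
  shows "inverse_mod l (\<lambda>z. 1 / (z - l))" "norm (Phi l) \<le> 2 * (1 / norm l + mass / (norm l - 1)\<^sup>2)"
proof -
  have hol: "(\<lambda>z. 1 / (z - l)) holomorphic_on ball 0 (norm l)"
    by (intro holomorphic_intros) auto
  have B: "(\<lambda>z. 1 / (z - l)) \<in> bounded_V" by (rule bounded_V_holomorphic[OF hol l])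
  have ne: "z - l \<noteq> 0" if "z \<in> disc" for z using that l by auto
  show inv: "inverse_mod l (\<lambda>z. 1 / (z - l))"
    unfolding inverse_mod_def using B ne by (auto intro!: bexI[of _ "\<lambda>z. 0"])
  have "norm (deriv (\<lambda>z. 1 / (z - l)) z) \<le> 1 / (norm l - 1)\<^sup>2" if z: "z \<in> disc" for z
  proof -
    have "deriv (\<lambda>z. 1 / (z - l)) z = - 1 / (z - l)\<^sup>2"
      using ne[OF z] by (intro DERIV_imp_deriv) (auto intro!: derivative_eq_intros simp: power2_eq_square)
    moreover have "norm l - 1 \<le> norm (z - l)"
      using norm_triangle_ineq2[of l z] z by (simp add: norm_minus_commute)
    then have "(norm l - 1)\<^sup>2 \<le> (norm (z - l))\<^sup>2" using l by (intro power_mono) auto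
    ultimately show ?thesis using l by (simp add: norm_divide norm_power frac_le)
  qed
  then have "seminorm (\<lambda>z. 1 / (z - l)) \<le> 1 / (norm l - 1)\<^sup>2 * mass"
    using B by (intro V_bounded_deriv(2) V_holomorphic bounded_V_D) auto
  then have "sum_norm (\<lambda>z. 1 / (z - l)) \<le> 1 / norm l + mass / (norm l - 1)\<^sup>2"
    by (simp add: sum_norm_def norm_divide)
  then show "norm (Phi l) \<le> 2 * (1 / norm l + mass / (norm l - 1)\<^sup>2)"
    unfolding Phi_eq[OF inv] by (intro order_trans[OF L_bound[OF bounded_V_D[OF B]]]) simp
qed

text \<open>The difference quotient of f at l, multiplied by - 1 / f l, is an inverse modulo f with
  the constant cofactor - 1 / f l. One factor 1 / |f l| is the whole cost beyond the estimate of the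
  quotient.\<close>

lemma inverse_mod_inside:
  "\<exists>C\<ge>0. \<forall>l. norm l < 1 \<longrightarrow> f l \<noteq> 0 \<longrightarrow>
     (\<exists>g. inverse_mod l g) \<and> norm (Phi l) \<le> C / ((1 - norm l)\<^sup>2 * norm (f l))"
proof -
  obtain K where K: "K > 0" "\<And>z. z \<in> disc \<Longrightarrow> norm (f z) \<le> K" using bounded_V_E[OF f] by blast
  have fV: "f \<in> V" and fhol: "f holomorphic_on disc" using bounded_V_D[OF f] V_holomorphic by auto
  define C where "C = 2 * (4 * K + 4 * seminorm f + 16 * K * mass)"
  have "C \<ge> 0" using K by (simp add: C_def)
  moreover have "(\<exists>g. inverse_mod l g) \<and> norm (Phi l) \<le> C / ((1 - norm l)\<^sup>2 * norm (f l))"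
    if l: "norm l < 1" and fl: "f l \<noteq> 0" for l
  proof -
    define k where "k = (\<lambda>z. if z = l then deriv f l else (f z - f l) / (z - l))"
    define d where "d = 1 - norm l"
    have d: "0 < d" "d \<le> 1" using l by (auto simp: d_def)
    have kb: "k holomorphic_on disc" "\<And>z. z \<in> disc \<Longrightarrow> norm (k z) \<le> 4 * K / d"
      "\<And>z. z \<in> disc \<Longrightarrow> norm (deriv k z) \<le> 4 / d * norm (deriv f z) + 16 * K / d\<^sup>2"
      unfolding k_def d_def using difference_quotient_bounds[of f K l] fhol K(2) l by blast+
    have kV: "k \<in> V" and kS: "seminorm k \<le> 4 / d * seminorm f + 0 * seminorm f + 16 * K / d\<^sup>2 * mass"
      using V_dominated[OF kb(1) fV fV, of "4 / d" 0 "16 * K / d\<^sup>2"] kb(3) d K by auto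
    have kB: "k \<in> bounded_V" by (rule bounded_V_I[OF kV kb(2)])
    define g where "g = (\<lambda>z. (- 1 / f l) * k z)"
    have gB: "g \<in> bounded_V" unfolding g_def by (intro bounded_V_mult bounded_V_const kB)
    have inv: "inverse_mod l g"
      unfolding inverse_mod_def
    proof (intro conjI gB bexI ballI)
      show "(\<lambda>z. - 1 / f l) \<in> bounded_V" by simp
      show "(z - l) * g z = 1 + f z * (- 1 / f l)" for z
        using fl by (simp add: g_def k_def field_simps)
    qed
    have "sum_norm k \<le> 4 * K / d + (4 / d * seminorm f + 16 * K / d\<^sup>2 * mass)"
      using kb(2)[of 0] kS by (simp add: sum_norm_def)
    also have "\<dots> = (4 * K * d + 4 * seminorm f * d + 16 * K * mass) / d\<^sup>2"
      using d by (simp add: field_simps power2_eq_square)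
    also have "\<dots> \<le> (4 * K * 1 + 4 * seminorm f * 1 + 16 * K * mass) / d\<^sup>2"
      using d K by (intro divide_right_mono add_mono mult_left_mono) auto
    also have "4 * K * 1 + 4 * seminorm f * 1 + 16 * K * mass = C / 2" by (simp add: C_def)
    also have "C / 2 / d\<^sup>2 = C / d\<^sup>2 / 2" by simp
    finally have sk: "2 * sum_norm k \<le> C / d\<^sup>2" by argo
    have "norm (Phi l) \<le> 2 * sum_norm g"
      unfolding Phi_eq[OF inv] by (rule L_bound[OF bounded_V_D[OF gB]])
    also have "\<dots> = 2 * sum_norm k / norm (f l)"
      unfolding g_def sum_norm_scale[OF kV] by (simp add: norm_divide)
    also have "\<dots> \<le> C / d\<^sup>2 / norm (f l)" using sk by (intro divide_right_mono) auto
    finally show ?thesis using inv by (auto simp: d_def)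
  qed
  ultimately show ?thesis by blast
qed

text \<open>For |l| = 1 the difference quotient of f itself is not controlled. The dilation P is
  holomorphic across the circle, so its quotient Q is in the algebra, and (z - l) Q = f - u with u =
  f - P + P l. As f - P is uniformly small and P l is close to f l, u is bounded away from 0 and - Q
  / u is the inverse.\<close>

lemma inverse_mod_circle:
  assumes cont: "continuous_on (cball 0 1) f" and l: "norm l = 1" and fl: "f l \<noteq> 0"
  shows "\<exists>g. inverse_mod l g"
proof -
  have fhol: "f holomorphic_on disc" using bounded_V_D[OF f] V_holomorphic by auto
  \<comment> \<open>With a quarter of |f l|, the two approximation errors of size e leave |u| \<ge>
    4 e - 2 e.\<close>
  define e where "e = norm (f l) / 4"
  have e: "e > 0" using fl by (simp add: e_def)
  have "uniformly_continuous_on (cball 0 1) f"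
    by (rule compact_uniformly_continuous[OF cont]) simp
  then obtain d where d: "d > 0" "\<And>x y. x \<in> cball 0 1 \<Longrightarrow> y \<in> cball 0 1 \<Longrightarrow> dist y x < d \<Longrightarrow> dist (f y) (f x) < e"
    using e unfolding uniformly_continuous_on_def by blast
  define r where "r = max (1 / 2) (1 - d / 2)"
  have r: "0 < r" "r < 1" "1 - r < d" using d(1) by (auto simp: r_def)
  define P where "P = (\<lambda>z. f (of_real r * z))"
  have Pf: "norm (f z - P z) \<le> e" if "z \<in> cball 0 1" for z
  proof -
    have "dist z (of_real r * z) = norm (of_real (1 - r) * z)" by (simp add: dist_norm algebra_simps)
    also have "\<dots> = (1 - r) * norm z" using r by (simp only: norm_mult norm_of_real)
    also have "\<dots> \<le> (1 - r) * 1" using that r by (intro mult_left_mono) auto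
    finally have "dist z (of_real r * z) < d" using r by simp
    moreover have "norm (of_real r * z) \<le> 1 * 1" unfolding norm_mult using that r by (intro mult_mono) auto
    ultimately show ?thesis
      using d(2)[of "of_real r * z" z] that by (simp add: P_def dist_norm)
  qed
  have Phol: "P holomorphic_on ball 0 (1 / r)"
    unfolding P_def
  proof (rule holomorphic_on_compose_gen[of _ _ f disc, unfolded o_def])
    show "(*) (complex_of_real r) ` ball 0 (1 / r) \<subseteq> disc"
      using r by (auto simp: norm_mult field_simps)
  qed (auto intro!: holomorphic_intros fhol)
  have R: "1 / r > 1" using r by (simp add: field_simps)
  define Q where "Q = (\<lambda>z. if z = l then deriv P l else (P z - P l) / (z - l))"
  have QB: "Q \<in> bounded_V"
    unfolding Q_def by (rule bounded_V_holomorphic[OF pole_lemma_open[OF Phol open_ball] R])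
  have PB: "P \<in> bounded_V" by (rule bounded_V_holomorphic[OF Phol R])
  define u where "u = (\<lambda>z. f z - P z + P l)"
  have uB: "u \<in> bounded_V" unfolding u_def by (intro bounded_V_add bounded_V_diff bounded_V_const f PB)
  have ub: "2 * e \<le> norm (u z)" if "z \<in> disc" for z
  proof -
    have "norm (f l) \<le> norm (u z) + norm (f l - P l) + norm (f z - P z)"
      using norm_triangle_ineq4[of "u z" "f z - P z"] norm_triangle_ineq[of "P l" "f l - P l"] by (simp add: u_def)
    moreover have "norm (f l - P l) \<le> e" "norm (f z - P z) \<le> e" using Pf l that by auto
    ultimately show ?thesis by (simp add: e_def)
  qed
  have iu: "(\<lambda>z. 1 / u z) \<in> bounded_V" by (rule bounded_V_inverse[OF uB _ ub]) (use e in auto)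
  have "inverse_mod l (\<lambda>z. - (Q z * (1 / u z)))"
    unfolding inverse_mod_def
  proof (intro conjI bexI ballI)
    show "(\<lambda>z. - (Q z * (1 / u z))) \<in> bounded_V" by (intro bounded_V_uminus bounded_V_mult QB iu)
    show "(\<lambda>z. - (1 / u z)) \<in> bounded_V" by (intro bounded_V_uminus iu)
    fix z assume z: "z \<in> disc"
    then have "z \<noteq> l" using l by auto
    then have "(z - l) * Q z = f z - u z" by (simp add: Q_def u_def)
    moreover have "u z \<noteq> 0" using ub[OF z] e by auto
    moreover have "(z - l) * - (Q z * (1 / u z)) = - (((z - l) * Q z) / u z)" by simp
    ultimately show "(z - l) * - (Q z * (1 / u z)) = 1 + f z * - (1 / u z)"
      by (simp add: diff_divide_distrib)
  qed
  then show ?thesis by blast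
qed

end

section \<open>Inversion at the boundary zero: the entire function F and its growth\<close>

text \<open>The dictionary of the inversion: the outside and the inside of the circle correspond to
  the two sides of the line Re w = - 1/2, and distances to the circle are distances to the line
  divided by |w|^2, up to bounded factors for large w.\<close>

lemma norm_one_plus_inverse:
  fixes w :: complex
  assumes "w \<noteq> 0"
  shows "(norm (1 + 1 / w))\<^sup>2 - 1 = (2 * Re w + 1) / (norm w)\<^sup>2"
proof -
  have "1 + 1 / w = (w + 1) / w" using assms by (simp add: field_simps)
  then have "(norm (1 + 1 / w))\<^sup>2 = (norm (w + 1))\<^sup>2 / (norm w)\<^sup>2"
    by (simp add: norm_divide power_divide)
  also have "(norm (w + 1))\<^sup>2 = (norm w)\<^sup>2 + (2 * Re w + 1)"
    by (simp add: cmod_power2) (simp add: power2_eq_square algebra_simps)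
  finally show ?thesis using assms by (simp add: add_divide_distrib)
qed

lemma square_le_exp: "t \<ge> 0 \<Longrightarrow> t\<^sup>2 \<le> 2 * exp (t :: real)"
  using exp_lower_Taylor_quadratic[of t] by simp

text \<open>Brings the polynomial bound from outside the circle into the exponential form that
  \<open>bound_across_line\<close> expects.\<close>

lemma affine_square_le_exp:
  fixes a b t :: real
  assumes "a \<ge> 0" "b \<ge> 0" "t \<ge> 0"
  shows "a + b * t\<^sup>2 \<le> exp (a + 2 * b + t)"
proof -
  have "a + b * t\<^sup>2 \<le> a * exp t + b * (2 * exp t)"
    using assms square_le_exp[of t] by (intro add_mono mult_left_mono) (auto simp: mult_le_cancel_left1)
  also have "\<dots> = (a + 2 * b) * exp t" by (simp add: algebra_simps)
  also have "a + 2 * b \<le> exp (a + 2 * b)"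
    using exp_ge_add_one_self[of "a + 2 * b"] by linarith
  finally show ?thesis by (simp add: exp_add mult_right_mono)
qed

text \<open>Outerness is represented by \<open>low\<close>, with \<epsilon> arbitrarily
  small.\<close>

locale boundary_zero = annihilator +
  assumes cont: "continuous_on (cball 0 1) f"
    and nz: "z \<in> cball 0 1 \<Longrightarrow> z \<noteq> 1 \<Longrightarrow> f z \<noteq> 0"
    and low: "\<epsilon> > 0 \<Longrightarrow> \<exists>C. \<forall>z. norm z < 1 \<longrightarrow> exp (- C - \<epsilon> / (1 - norm z)) \<le> norm (f z)"
begin

lemma Phi_holomorphic: "Phi holomorphic_on - {1}"
proof -
  have "\<exists>g. inverse_mod l g" if "l \<noteq> 1" for l
  proof -
    consider "norm l > 1" | "norm l = 1" | "norm l < 1" by linarith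
    then show ?thesis
    proof cases
      case 1
      then show ?thesis using inverse_mod_outside(1) by blast
    next
      case 2
      then show ?thesis using inverse_mod_circle[OF cont] nz[of l] that by auto
    next
      case 3
      then show ?thesis using inverse_mod_inside nz[of l] that by fastforce
    qed
  qed
  then show ?thesis
    unfolding holomorphic_on_def using Phi_has_derivative field_differentiable_at_within by blast
qed

text \<open>The point w = 0 corresponds to \<lambda> = \<infinity>, where \<open>Phi\<close> tends
  to 0; the value 0 removes the singularity.\<close>

definition F :: "complex \<Rightarrow> complex" where
  "F w = (if w = 0 then 0 else Phi (1 + 1 / w))"

lemma F_holomorphic: "F holomorphic_on UNIV"
proof (rule no_isolated_singularity[of _ _ "{0}"])
  have "(\<lambda>w. Phi (1 + 1 / w)) holomorphic_on UNIV - {0}"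
    by (rule holomorphic_on_compose_gen[OF _ Phi_holomorphic, unfolded o_def])
       (auto intro!: holomorphic_intros)
  then show hol: "F holomorphic_on UNIV - {0}"
    by (rule holomorphic_transform) (simp add: F_def)
  have "F \<midarrow>0\<rightarrow> 0"
  proof (rule Lim_null_comparison)
    \<comment> \<open>For |w| < 1/3 one has |1 + 1/w| - 1 \<ge> 1/|w| - 2 \<ge> 1 / (3 |w|).\<close>
    have "eventually (\<lambda>w::complex. w \<in> ball 0 (1 / 3) - {0}) (at 0)"
      by (intro eventually_at_in_open) auto
    then show "eventually (\<lambda>w. norm (F w) \<le> 2 * (3 * norm w + mass * (3 * norm w)\<^sup>2)) (at 0)"
    proof eventually_elim
      case (elim w)
      then have w: "w \<noteq> 0" "norm w < 1 / 3" by auto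
      have "1 / norm w - 1 \<le> norm (1 + 1 / w)"
        using norm_triangle_ineq2[of "1 / w" "- 1"] by (simp add: norm_divide add.commute)
      moreover have "1 / (3 * norm w) \<le> 1 / norm w - 2" using w by (simp add: field_simps)
      ultimately have l: "1 / (3 * norm w) \<le> norm (1 + 1 / w) - 1" by linarith
      have w3: "0 < 1 / (3 * norm w)" using w by simp
      then have l1: "norm (1 + 1 / w) > 1" using l by linarith
      have "1 / norm (1 + 1 / w) \<le> 1 / (1 / (3 * norm w))"
        using l w3 by (intro frac_le) auto
      moreover have "mass / (norm (1 + 1 / w) - 1)\<^sup>2 \<le> mass / (1 / (3 * norm w))\<^sup>2"
        using l w3 l1 by (intro frac_le power_mono) auto
      ultimately have "norm (Phi (1 + 1 / w)) \<le> 2 * (1 / (1 / (3 * norm w)) + mass / (1 / (3 * norm w))\<^sup>2)"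
        using inverse_mod_outside(2)[OF l1] unfolding distrib_left by linarith
      then show ?case using w by (simp add: F_def power_divide)
    qed
    have "((\<lambda>w::complex. 2 * (3 * norm w + mass * (3 * norm w)\<^sup>2)) \<longlongrightarrow> 2 * (3 * norm (0::complex) + mass * (3 * norm (0::complex))\<^sup>2)) (at 0)"
      by (intro tendsto_intros)
    then show "((\<lambda>w::complex. 2 * (3 * norm w + mass * (3 * norm w)\<^sup>2)) \<longlongrightarrow> 0) (at 0)" by simp
  qed
  then have "isCont F 0" by (simp add: isCont_def F_def)
  moreover have "isCont F w" if "w \<noteq> 0" for w
    using hol that holomorphic_on_imp_continuous_on[OF hol] continuous_on_interior[of "UNIV - {0}" F w]
    by (simp add: interior_open open_delete)
  ultimately show "continuous_on UNIV F"
    by (metis continuous_at_imp_continuous_on)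
qed auto

text \<open>For |w| \<ge> 1 the point \<lambda> = 1 + 1/w has |\<lambda>| \<le> 2, so |\<lambda>|^2
  - 1 \<le> 3 (|\<lambda>| - 1), and |\<lambda>| - 1 \<ge> 2 x / (3 |w|^2) with x the distance of w
  to the line. The constant 9/2 is 2 (3/2)^2.\<close>

lemma F_right:
  assumes "Re w > - 1 / 2" "norm w \<ge> 1"
  shows "norm (F w) \<le> 2 + 9 / 2 * mass * ((norm w)\<^sup>2 / (Re w + 1 / 2))\<^sup>2"
proof -
  define x where "x = Re w + 1 / 2"
  define l where "l = 1 + 1 / w"
  have x: "x > 0" and w: "w \<noteq> 0" using assms by (auto simp: x_def)
  have l2: "(norm l)\<^sup>2 - 1 = 2 * x / (norm w)\<^sup>2"
    using norm_one_plus_inverse[OF w] by (simp add: l_def x_def algebra_simps)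
  have "(norm l)\<^sup>2 > 1" using l2 x w by (smt (verit) divide_pos_pos zero_less_power zero_less_norm_iff)
  then have l1: "norm l > 1" by (smt (verit) norm_ge_zero power_le_one)
  have "norm (1 / w) \<le> 1" using assms w by (simp add: norm_divide)
  then have "norm l \<le> 2" using norm_triangle_ineq[of 1 "1 / w"] by (simp add: l_def)
  have "2 * x / (norm w)\<^sup>2 = (norm l - 1) * (norm l + 1)"
    using l2 by (simp add: power2_eq_square algebra_simps)
  also have "\<dots> \<le> (norm l - 1) * 3"
    using \<open>norm l \<le> 2\<close> l1 by (intro mult_left_mono) auto
  also have "2 * x / (norm w)\<^sup>2 = 3 * (2 * x / (3 * (norm w)\<^sup>2))" by simp
  finally have l3: "2 * x / (3 * (norm w)\<^sup>2) \<le> norm l - 1" by argo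
  have pos: "0 < 2 * x / (3 * (norm w)\<^sup>2)" using x w by simp
  have "norm (F w) \<le> 2 * (1 / norm l + mass / (norm l - 1)\<^sup>2)"
    using inverse_mod_outside(2)[OF l1] w by (simp add: F_def l_def)
  also have "\<dots> \<le> 2 * (1 + mass / (2 * x / (3 * (norm w)\<^sup>2))\<^sup>2)"
  proof (intro mult_left_mono add_mono)
    show "1 / norm l \<le> 1" using l1 frac_le[of 1 1 1 "norm l"] by simp
    show "mass / (norm l - 1)\<^sup>2 \<le> mass / (2 * x / (3 * (norm w)\<^sup>2))\<^sup>2"
      by (intro frac_le power_mono zero_less_power pos l3 mass_nonneg order_refl less_imp_le[OF pos])
  qed simp
  also have "\<dots> = 2 + 9 / 2 * mass * ((norm w)\<^sup>2 / x)\<^sup>2"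
    using x w by (simp add: field_simps power2_eq_square)
  finally show ?thesis by (simp add: x_def)
qed

text \<open>With t = |w|^2 / x, where x is the distance to the line, 1 - |\<lambda>| is at least 1 /
  t. Half of \<epsilon> is spent on the lower bound for |f|; the other half absorbs the factor t^2
  coming from the difference quotient.\<close>

lemma F_left:
  assumes \<epsilon>: "\<epsilon> > 0"
  shows "\<exists>C. \<forall>w. Re w < - 1 / 2 \<longrightarrow> norm (F w) \<le> exp (C + \<epsilon> * ((norm w)\<^sup>2 / (- (Re w + 1 / 2))))"
proof -
  obtain C1 where C1: "C1 \<ge> 0" "\<And>l. norm l < 1 \<Longrightarrow> f l \<noteq> 0 \<Longrightarrow> norm (Phi l) \<le> C1 / ((1 - norm l)\<^sup>2 * norm (f l))"
    using inverse_mod_inside by blast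
  obtain C2 where C2: "\<And>z. norm z < 1 \<Longrightarrow> exp (- C2 - \<epsilon> / 2 / (1 - norm z)) \<le> norm (f z)"
    using low[of "\<epsilon> / 2"] \<epsilon> by auto
  define C where "C = C2 + 8 * C1 / \<epsilon>\<^sup>2"
  have "norm (F w) \<le> exp (C + \<epsilon> * ((norm w)\<^sup>2 / (- (Re w + 1 / 2))))" if "Re w < - 1 / 2" for w
  proof -
    define x where "x = - (Re w + 1 / 2)"
    define l where "l = 1 + 1 / w"
    have x: "x > 0" and w: "w \<noteq> 0" using that by (auto simp: x_def)
    define t where "t = (norm w)\<^sup>2 / x"
    have t: "t > 0" using x w by (simp add: t_def)
    have "2 * Re w + 1 = - (2 * x)" by (simp add: x_def)
    then have l2: "1 - (norm l)\<^sup>2 = 2 * x / (norm w)\<^sup>2"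
      using norm_one_plus_inverse[OF w] unfolding l_def by (simp only: minus_divide_left[symmetric])
    have "(norm l)\<^sup>2 < 1" using l2 x w by (smt (verit) divide_pos_pos zero_less_power zero_less_norm_iff)
    then have l1: "norm l < 1" by (simp add: power_less_one_iff abs_square_less_1)
    have "2 * x / (norm w)\<^sup>2 = (1 - norm l) * (1 + norm l)"
      using l2 by (simp add: power2_eq_square algebra_simps)
    also have "\<dots> \<le> (1 - norm l) * 2"
      using l1 by (intro mult_left_mono) auto
    also have "2 * x / (norm w)\<^sup>2 = 2 * (x / (norm w)\<^sup>2)" by simp
    finally have "x / (norm w)\<^sup>2 \<le> 1 - norm l" by argo
    moreover have "x / (norm w)\<^sup>2 = 1 / t" by (simp add: t_def)
    ultimately have d: "1 / t \<le> 1 - norm l" by simp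
    have fl: "f l \<noteq> 0" using nz[of l] l1 by fastforce
    have "\<epsilon> / 2 / (1 - norm l) \<le> \<epsilon> / 2 / (1 / t)"
      using d t l1 \<epsilon> by (intro divide_left_mono) auto
    then have "exp (- C2 - \<epsilon> / 2 * t) \<le> exp (- C2 - \<epsilon> / 2 / (1 - norm l))" by simp
    also have "\<dots> \<le> norm (f l)" by (rule C2[OF l1])
    finally have fl': "exp (- C2 - \<epsilon> / 2 * t) \<le> norm (f l)" .
    have "norm (F w) \<le> C1 / ((1 - norm l)\<^sup>2 * norm (f l))"
      using C1(2)[OF l1 fl] w by (simp add: F_def l_def)
    also have "\<dots> \<le> C1 / ((1 / t)\<^sup>2 * exp (- C2 - \<epsilon> / 2 * t))"
      using C1 d t fl' l1 fl by (intro divide_left_mono mult_mono power_mono mult_pos_pos) auto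
    also have "\<dots> = C1 * t\<^sup>2 * exp (C2 + \<epsilon> / 2 * t)"
      using t exp_minus[of "C2 + \<epsilon> / 2 * t"] by (simp add: power_divide inverse_eq_divide)
    also have "\<dots> \<le> C1 * (8 / \<epsilon>\<^sup>2 * exp (\<epsilon> / 2 * t)) * exp (C2 + \<epsilon> / 2 * t)"
    proof -
      have "(\<epsilon> / 2 * t)\<^sup>2 \<le> 2 * exp (\<epsilon> / 2 * t)" using t \<epsilon> by (intro square_le_exp) auto
      then have "4 / \<epsilon>\<^sup>2 * (\<epsilon> / 2 * t)\<^sup>2 \<le> 4 / \<epsilon>\<^sup>2 * (2 * exp (\<epsilon> / 2 * t))" by (intro mult_left_mono) auto
      then have "t\<^sup>2 \<le> 8 / \<epsilon>\<^sup>2 * exp (\<epsilon> / 2 * t)" using \<epsilon> by (simp add: power_mult_distrib power_divide)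
      then show ?thesis using C1 by (intro mult_right_mono mult_left_mono) auto
    qed
    also have "\<dots> = (8 * C1 / \<epsilon>\<^sup>2) * exp (C2 + \<epsilon> * t)"
      by (simp add: mult_ac flip: exp_add)
    also have "\<dots> \<le> exp (8 * C1 / \<epsilon>\<^sup>2) * exp (C2 + \<epsilon> * t)"
      using exp_ge_add_one_self[of "8 * C1 / \<epsilon>\<^sup>2"] by (intro mult_right_mono) (linarith, simp)
    also have "\<dots> = exp (C + \<epsilon> * t)" by (simp add: C_def algebra_simps flip: exp_add)
    finally show ?thesis by (simp add: t_def x_def)
  qed
  then show ?thesis by blast
qed

lemma F_bounded_compact: "\<exists>K\<ge>0. \<forall>w\<in>cball 0 r. norm (F w) \<le> K"
proof -
  have "continuous_on (cball 0 r) F"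
    using F_holomorphic holomorphic_on_imp_continuous_on continuous_on_subset by blast
  then have "bounded (F ` cball 0 r)"
    by (intro compact_imp_bounded compact_continuous_image) auto
  then obtain K where "K > 0" "\<And>w. w \<in> cball 0 r \<Longrightarrow> norm (F w) \<le> K"
    unfolding bounded_pos by blast
  then show ?thesis by (intro exI[of _ K]) auto
qed

text \<open>The bound from the left settles Re w \<le> - 1. The strip - 1 \<le> Re w \<le> 0
  contains the line on which neither one-sided bound holds; high up it is crossed along a square
  centred on the line at the height of w, and the rest of the strip is compact.\<close>

lemma F_order_two: "\<exists>C. \<forall>w. Re w \<le> 0 \<longrightarrow> norm (F w) \<le> exp (C * (1 + (norm w)\<^sup>2))"
proof -
  obtain C1 where C1: "\<And>w. Re w < - 1 / 2 \<Longrightarrow> norm (F w) \<le> exp (C1 + 1 * ((norm w)\<^sup>2 / (- (Re w + 1 / 2))))"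
    using F_left[of 1] by auto
  obtain K where K: "K \<ge> 0" "\<And>w. w \<in> cball 0 4 \<Longrightarrow> norm (F w) \<le> K"
    using F_bounded_compact by blast
  \<comment> \<open>The constant 2 + 9 mass is a + 2 b in \<open>affine_square_le_exp\<close> for a
    = 2 and b = 9/2 mass, so exp (B + t) bounds \<open>F\<close> on both sides of the line.\<close>
  define B where "B = \<bar>C1\<bar> + (2 + 9 * mass)"
  have B: "B \<ge> 0" "C1 \<le> B" "2 + 9 * mass \<le> B"
    unfolding B_def using mass_nonneg by linarith+
  \<comment> \<open>The 4 B and the 40 cover four times the exponent \<open>A\<close> used in the
    strip, as 4 (|w| + 2)^2 \<le> 8 |w|^2 + 32; K covers the compact part.\<close>
  define C where "C = 4 * B + 40 + K"
  have CB: "C = 4 * B + 40 + K" by (rule C_def)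
  have "norm (F w) \<le> exp (C * (1 + (norm w)\<^sup>2))" if w: "Re w \<le> 0" for w
  proof -
    have n2: "(norm w)\<^sup>2 \<ge> 0" by simp
    have Cn: "40 * (norm w)\<^sup>2 \<le> C * (norm w)\<^sup>2" using B K by (intro mult_right_mono) (auto simp: C_def)
    \<comment> \<open>Height 3 keeps the whole square around the line in the region |v| \<ge> 1
      where \<open>F_right\<close> applies.\<close>
    consider "Re w \<le> -1" | "-1 \<le> Re w" "\<bar>Im w\<bar> \<ge> 3" | "-1 \<le> Re w" "\<bar>Im w\<bar> \<le> 3" by linarith
    then show ?thesis
    proof cases
      case 1
      have "(norm w)\<^sup>2 / (- (Re w + 1 / 2)) \<le> (norm w)\<^sup>2 / (1 / 2)"
        using 1 by (intro divide_left_mono) auto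
      also have "(norm w)\<^sup>2 / (1 / 2) = 2 * (norm w)\<^sup>2" by simp
      finally have "C1 + 1 * ((norm w)\<^sup>2 / (- (Re w + 1 / 2))) \<le> C * (1 + (norm w)\<^sup>2)"
        unfolding distrib_left mult_1 mult_1_right using Cn B(1,2) K(1) n2 CB by linarith
      then have "exp (C1 + 1 * ((norm w)\<^sup>2 / (- (Re w + 1 / 2)))) \<le> exp (C * (1 + (norm w)\<^sup>2))"
        by (simp only: exp_le_cancel_iff)
      moreover have "norm (F w) \<le> exp (C1 + 1 * ((norm w)\<^sup>2 / (- (Re w + 1 / 2))))"
        using 1 by (intro C1) auto
      ultimately show ?thesis by (rule order_trans[rotated])
    next
      case 2
      define A where "A = B + (norm w + 2)\<^sup>2"
      define c where "c = Complex (- 1 / 2) (Im w)"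
      have "(norm w + 2)\<^sup>2 > 0" by (intro zero_less_power add_nonneg_pos) auto
      then have A: "A > 0" unfolding A_def using B by linarith
      have "norm (F v) \<le> exp (A / \<bar>Re (v - c)\<bar>)" if v: "\<bar>Re (v - c)\<bar> + \<bar>Im (v - c)\<bar> \<le> 1" and x0: "Re (v - c) \<noteq> 0" for v
      proof -
        define x where "x = Re (v - c)"
        have x: "x = Re v + 1 / 2" "\<bar>x\<bar> \<le> 1" "x \<noteq> 0" using v x0 by (auto simp: x_def c_def)
        have "\<bar>Im v\<bar> \<ge> 1" using v 2 by (simp add: c_def)
        then have v1: "norm v \<ge> 1" using abs_Im_le_cmod[of v] by linarith
        have "norm (v - w) \<le> 2"
          using cmod_le[of "v - w"] v 2 w by (simp add: c_def)
        then have "norm v \<le> norm w + 2" using norm_triangle_ineq[of "v - w" w] by simp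
        then have vw: "(norm v)\<^sup>2 \<le> (norm w + 2)\<^sup>2" by (intro power_mono) auto
        define t where "t = (norm v)\<^sup>2 / \<bar>x\<bar>"
        have t0: "t \<ge> 0" by (simp add: t_def)
        have "norm (F v) \<le> exp (B + t)"
        proof (cases "x > 0")
          case True
          then have "norm (F v) \<le> 2 + 9 / 2 * mass * t\<^sup>2"
            using F_right[of v] v1 x by (simp add: t_def)
          also have "\<dots> \<le> exp (2 + 2 * (9 / 2 * mass) + t)"
            using t0 by (intro affine_square_le_exp) auto
          also have "\<dots> \<le> exp (B + t)" using B by simp
          finally show ?thesis .
        next
          case False
          then have "norm (F v) \<le> exp (C1 + 1 * t)"
            using C1[of v] x by (simp add: t_def)
          also have "\<dots> \<le> exp (B + t)" using B by simp
          finally show ?thesis .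
        qed
        also have "B + t \<le> A / \<bar>x\<bar>"
        proof -
          have "B \<le> B / \<bar>x\<bar>" using B x by (simp add: le_divide_eq mult_left_le)
          moreover have "t \<le> (norm w + 2)\<^sup>2 / \<bar>x\<bar>" unfolding t_def using vw by (intro divide_right_mono) auto
          ultimately show ?thesis by (simp add: A_def add_divide_distrib)
        qed
        finally show ?thesis by (simp add: x_def)
      qed
      then have "norm (F (c + of_real (Re w + 1 / 2))) \<le> exp (4 * A)"
        using 2 w by (intro bound_across_line[OF F_holomorphic A]) auto
      moreover have "c + of_real (Re w + 1 / 2) = w" by (simp add: c_def complex_eq_iff)
      moreover have "4 * A \<le> C * (1 + (norm w)\<^sup>2)"
      proof -
        have "(norm w + 2)\<^sup>2 \<le> 2 * (norm w)\<^sup>2 + 8"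
          using sum_squares_bound[of "norm w" 2] by (simp add: power2_eq_square algebra_simps)
        then show ?thesis
          unfolding A_def distrib_left mult_1_right using Cn B(1) K(1) n2 CB by linarith
      qed
      ultimately show ?thesis by (metis exp_le_cancel_iff order_trans)
    next
      case 3
      have "norm w \<le> 4" using cmod_le[of w] 3 w by linarith
      then have "norm (F w) \<le> K" by (intro K) auto
      also have "K \<le> exp K" using exp_ge_add_one_self[of K] by linarith
      also have "\<dots> \<le> exp (C * (1 + (norm w)\<^sup>2))"
        unfolding exp_le_cancel_iff distrib_left mult_1_right using Cn B(1) n2 CB by linarith
      finally show ?thesis .
    qed
  qed
  then show ?thesis by blast
qed

text \<open>On Re w \<ge> 0 the distance to the line is at least 1/2, so the squared quotient in
  \<open>F_right\<close> becomes |w|^4. The quartic bound spreads to the plane and Liouville's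
  theorem gives degree at most 4.\<close>

lemma F_polynomial: "\<exists>a. \<forall>w. F w = (\<Sum>k\<le>4. a k * w ^ k)"
proof -
  obtain K where K: "K \<ge> 0" "\<And>w. w \<in> cball 0 1 \<Longrightarrow> norm (F w) \<le> K"
    using F_bounded_compact by blast
  define M where "M = 2 + 18 * mass + K"
  have M: "M \<ge> 0" using K by (simp add: M_def)
  have right: "norm (F w) \<le> M * (1 + norm w) ^ 4" if "Re w \<ge> 0" for w
  proof (cases "norm w \<le> 1")
    case True
    have "norm (F w) \<le> K" using True by (intro K) simp
    then have "norm (F w) \<le> M * 1" unfolding M_def mult_1_right using mass_nonneg by linarith
    also have "\<dots> \<le> M * (1 + norm w) ^ 4" using M by (intro mult_left_mono one_le_power) auto
    finally show ?thesis .
  next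
    case False
    then have "norm (F w) \<le> 2 + 9 / 2 * mass * ((norm w)\<^sup>2 / (Re w + 1 / 2))\<^sup>2"
      using that by (intro F_right) auto
    also have "\<dots> \<le> 2 + 9 / 2 * mass * ((norm w)\<^sup>2 / (1 / 2))\<^sup>2"
      using that by (intro add_left_mono mult_left_mono power_mono divide_left_mono) auto
    also have "\<dots> = 2 * 1 + 18 * mass * norm w ^ 4" by (simp add: power_mult_distrib flip: power_mult)
    also have "\<dots> \<le> 2 * (1 + norm w) ^ 4 + 18 * mass * (1 + norm w) ^ 4"
      by (intro add_mono mult_left_mono power_mono one_le_power) auto
    also have "\<dots> \<le> M * (1 + norm w) ^ 4"
      unfolding M_def distrib_right using K by simp
    finally show ?thesis .
  qed
  have left: "\<exists>C. \<forall>w. Re w \<le> -1 \<longrightarrow> norm (F w) \<le> exp (C + \<epsilon> * (norm w)\<^sup>2 / \<bar>Re w\<bar>)" if \<epsilon>: "\<epsilon> > 0" for \<epsilon>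
  proof -
    obtain C where C: "\<And>w. Re w < - 1 / 2 \<Longrightarrow> norm (F w) \<le> exp (C + \<epsilon> / 2 * ((norm w)\<^sup>2 / (- (Re w + 1 / 2))))"
      using F_left[of "\<epsilon> / 2"] \<epsilon> by auto
    have "norm (F w) \<le> exp (C + \<epsilon> * (norm w)\<^sup>2 / \<bar>Re w\<bar>)" if "Re w \<le> -1" for w
    proof -
      have "(norm w)\<^sup>2 / (- (Re w + 1 / 2)) \<le> (norm w)\<^sup>2 / (\<bar>Re w\<bar> / 2)"
        using that by (intro divide_left_mono mult_pos_pos) auto
      then have "\<epsilon> / 2 * ((norm w)\<^sup>2 / (- (Re w + 1 / 2))) \<le> \<epsilon> / 2 * ((norm w)\<^sup>2 / (\<bar>Re w\<bar> / 2))"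
        using \<epsilon> by (intro mult_left_mono) auto
      also have "\<dots> = \<epsilon> * (norm w)\<^sup>2 / \<bar>Re w\<bar>" by simp
      finally show ?thesis using that by (intro order_trans[OF C]) auto
    qed
    then show ?thesis by blast
  qed
  obtain C where gr: "\<And>w. Re w \<le> 0 \<Longrightarrow> norm (F w) \<le> exp (C * (1 + (norm w)\<^sup>2))"
    using F_order_two by blast
  obtain K' where K': "\<And>w. norm (F w) \<le> K' * (1 + norm w) ^ 4"
    using entire_quartic_growth[OF F_holomorphic right left gr] by blast
  have K'0: "K' \<ge> 0" using K'[of 0] norm_ge_zero[of "F 0"] by (simp del: norm_ge_zero)
  have "norm (F w) \<le> 16 * K' * norm w ^ 4" if "1 \<le> norm w" for w
  proof -
    have "norm (F w) \<le> K' * (1 + norm w) ^ 4" by (rule K')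
    also have "\<dots> \<le> K' * (2 * norm w) ^ 4" using that K'0 by (intro mult_left_mono power_mono) auto
    finally show ?thesis by (simp add: power_mult_distrib mult_ac)
  qed
  from Liouville_polynomial[OF F_holomorphic this]
  have "F w = (\<Sum>k\<le>4. ((deriv ^^ k) F 0 / fact k) * w ^ k)" for w by simp
  then show ?thesis by (intro exI[of _ "\<lambda>k. (deriv ^^ k) F 0 / fact k"]) simp
qed

end

subsection \<open>Test functions at the critical exponent\<close>

text \<open>On the shell 2^-(k+1) \<le> s < 2^-k the single term of index k already dominates s^-p;
  the summand 1 covers s \<ge> 1.\<close>

lemma dyadic_powr_le:
  fixes s p :: real
  assumes "s > 0" "p > 0" "(1 / 2) ^ J \<le> s"
  shows "s powr (- p) \<le> 1 + (\<Sum>k<J. 2 powr (real (Suc k) * p) * indicator {..<(1 / 2) ^ k} s)"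
  using assms
proof (induction J)
  case 0
  then show ?case using powr_mono2'[of "- p" 1 s] by simp
next
  case (Suc J)
  show ?case
  proof (cases "(1 / 2) ^ J \<le> s")
    case True
    have "s powr (- p) \<le> 1 + (\<Sum>k<J. 2 powr (real (Suc k) * p) * indicator {..<(1 / 2) ^ k} s)"
      using Suc True by simp
    then show ?thesis using True by simp
  next
    case False
    have "s powr (- p) \<le> ((1 / 2) ^ Suc J) powr (- p)"
      using Suc.prems by (intro powr_mono2') auto
    also have "((1 / 2 :: real) ^ Suc J) powr (- p) = 2 powr (real (Suc J) * p)"
    proof -
      have "((1 / 2 :: real) ^ Suc J) = 2 powr (- real (Suc J))"
        by (simp add: powr_minus powr_realpow power_one_over field_simps del: of_nat_Suc power_Suc)
      then show ?thesis by (simp add: powr_powr del: power_Suc of_nat_Suc)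
    qed
    finally have "s powr (- p) \<le> 2 powr (real (Suc J) * p) * indicator {..<(1 / 2) ^ J} s"
      using False by simp
    moreover have "0 \<le> (\<Sum>k<J. 2 powr (real (Suc k) * p) * indicator {..<(1 / 2) ^ k} s)"
      by (intro sum_nonneg) auto
    ultimately show ?thesis by (simp del: of_nat_Suc)
  qed
qed

text \<open>Regularised at the scale 2^-J, the estimate extends to all s > 0 with one more term,
  which serves s below that scale.\<close>

lemma dyadic_powr_le':
  fixes s p :: real
  assumes s: "s > 0" and p: "p > 0"
  shows "((1 / 2) ^ J + s) powr (- p) \<le> 1 + (\<Sum>k\<le>J. 2 powr (real (Suc k) * p) * indicator {..<(1 / 2) ^ k} s)"
proof (cases "(1 / 2) ^ J \<le> s")
  case True
  have "((1 / 2) ^ J + s) powr (- p) \<le> s powr (- p)"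
    using s p by (intro powr_mono2') auto
  also have "\<dots> \<le> 1 + (\<Sum>k<J. 2 powr (real (Suc k) * p) * indicator {..<(1 / 2) ^ k} s)"
    by (rule dyadic_powr_le[OF s p True])
  also have "\<dots> \<le> 1 + (\<Sum>k\<le>J. 2 powr (real (Suc k) * p) * indicator {..<(1 / 2) ^ k} s)"
    by (intro add_left_mono sum_mono2) auto
  finally show ?thesis .
next
  case False
  have "((1 / 2) ^ J + s) powr (- p) \<le> ((1 / 2) ^ J) powr (- p)"
    using s p by (intro powr_mono2') auto
  also have "((1 / 2 :: real) ^ J) powr (- p) = 2 powr (real J * p)"
  proof -
    have "((1 / 2 :: real) ^ J) = 2 powr (- real J)"
      by (simp add: powr_minus powr_realpow power_one_over field_simps)
    then show ?thesis by (simp add: powr_powr)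
  qed
  also have "\<dots> \<le> 2 powr (real (Suc J) * p)" using p by (intro powr_mono mult_right_mono) auto
  also have "\<dots> = (\<Sum>k\<in>{J}. 2 powr (real (Suc k) * p) * indicator {..<(1 / 2) ^ k} s)"
    using False by simp
  also have "\<dots> \<le> (\<Sum>k\<le>J. 2 powr (real (Suc k) * p) * indicator {..<(1 / 2) ^ k} s)"
    by (intro sum_mono2) auto
  finally show ?thesis by simp
qed

text \<open>For x = 2^-j the right side is a difference of consecutive terms, since x / 2 belongs to
  j + 1. Summation over j then collapses instead of costing a factor J.\<close>

lemma telescope_le:
  fixes x s :: real
  assumes "x > 0" "s > 0"
  shows "x / (x + s)\<^sup>2 \<le> 2 * (1 / (x / 2 + s) - 1 / (x + s))"
proof -
  have "2 * (1 / (x / 2 + s) - 1 / (x + s)) = x / ((x / 2 + s) * (x + s))"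
    using assms by (simp add: diff_frac_eq)
  moreover have "x / (x + s)\<^sup>2 \<le> x / ((x / 2 + s) * (x + s))"
    unfolding power2_eq_square using assms by (intro divide_left_mono mult_right_mono) auto
  ultimately show ?thesis by simp
qed

text \<open>Poles at 1 + 2^-j, outside the disc, with weights equal to their distances from 1: a
  substitute for a logarithm at 1, smoothed at the scale 2^-J. The inversion places the poles at w =
  2^j.\<close>

definition test_fun :: "nat \<Rightarrow> complex \<Rightarrow> complex" where
  "test_fun J z = (\<Sum>j<J. (1 / 2) ^ j * (1 / (z - (1 + (1 / 2) ^ j))))"

text \<open>The pole 1 + t and the point z lie on opposite sides of the vertical line through 1, so
  the cross term in the square is nonnegative.\<close>

lemma norm_shift_ge:
  fixes z :: complex
  assumes "norm z < 1" "t > 0"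
  shows "(t + norm (1 - z))\<^sup>2 \<le> 2 * (norm (z - (1 + of_real t)))\<^sup>2"
proof -
  have "Re z \<le> 1" using complex_Re_le_cmod[of z] assms by linarith
  then have "0 \<le> t * (1 - Re z)" using assms by simp
  then have "t\<^sup>2 + (norm (1 - z))\<^sup>2 \<le> (norm (z - (1 + of_real t)))\<^sup>2"
    by (simp add: cmod_power2) (simp add: power2_eq_square algebra_simps)
  moreover have "(t + norm (1 - z))\<^sup>2 \<le> 2 * (t\<^sup>2 + (norm (1 - z))\<^sup>2)"
    using sum_squares_bound[of t "norm (1 - z)"] by (simp add: power2_eq_square algebra_simps)
  ultimately show ?thesis by argo
qed

text \<open>The sum of moduli telescopes. The constant 4 is the 2 of \<open>norm_shift_ge\<close>
  times the 2 of \<open>telescope_le\<close>.\<close>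

lemma deriv_test_fun_le:
  assumes z: "norm z < 1"
  shows "norm (deriv (test_fun J) z) \<le> 4 / ((1 / 2) ^ J + norm (1 - z))"
proof -
  define s where "s = norm (1 - z)"
  have s: "s > 0" using z by (auto simp: s_def)
  have ne: "z - (1 + (1 / 2) ^ j) \<noteq> 0" for j
  proof
    assume "z - (1 + (1 / 2) ^ j) = 0"
    then have "z = of_real (1 + (1 / 2) ^ j)" by simp
    then have "norm z = \<bar>1 + (1 / 2) ^ j\<bar>" by (simp only: norm_of_real)
    then show False using z by simp
  qed
  have "(test_fun J has_field_derivative (\<Sum>j<J. (1 / 2) ^ j * (- 1 / (z - (1 + (1 / 2) ^ j))\<^sup>2))) (at z)"
    unfolding test_fun_def using ne
    by (auto intro!: derivative_eq_intros sum.cong simp: power2_eq_square)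
  then have "deriv (test_fun J) z = (\<Sum>j<J. (1 / 2) ^ j * (- 1 / (z - (1 + (1 / 2) ^ j))\<^sup>2))"
    by (rule DERIV_imp_deriv)
  also have "norm \<dots> \<le> (\<Sum>j<J. 4 * (1 / ((1 / 2) ^ Suc j + s) - 1 / ((1 / 2) ^ j + s)))"
  proof (intro order_trans[OF norm_sum] sum_mono)
    fix j
    define x :: real where "x = (1 / 2) ^ j"
    have x: "x > 0" by (simp add: x_def)
    have cx: "(1 / 2 :: complex) ^ j = of_real x" by (simp add: x_def)
    have "(x + s)\<^sup>2 \<le> 2 * (norm (z - (1 + of_real x)))\<^sup>2"
      unfolding s_def by (rule norm_shift_ge[OF z x])
    then have "x / (2 * (norm (z - (1 + of_real x)))\<^sup>2) \<le> x / (x + s)\<^sup>2"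
      using x s by (intro divide_left_mono mult_pos_pos) (auto intro: less_le_trans[of 0 "(x + s)\<^sup>2"])
    also have "\<dots> \<le> 2 * (1 / (x / 2 + s) - 1 / (x + s))" by (rule telescope_le[OF x s])
    finally have "x / (norm (z - (1 + of_real x)))\<^sup>2 \<le> 4 * (1 / (x / 2 + s) - 1 / (x + s))" by simp
    moreover have "norm (of_real x * (- 1 / (z - (1 + of_real x))\<^sup>2)) = x / (norm (z - (1 + of_real x)))\<^sup>2"
      using x by (simp add: norm_mult norm_divide norm_power)
    moreover have "(1 / 2) ^ Suc j = x / 2" by (simp add: x_def)
    ultimately show "norm ((1 / 2) ^ j * (- 1 / (z - (1 + (1 / 2) ^ j))\<^sup>2)) \<le> 4 * (1 / ((1 / 2) ^ Suc j + s) - 1 / ((1 / 2) ^ j + s))"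
      unfolding cx by (simp add: x_def)
  qed
  also have "\<dots> = 4 * (1 / ((1 / 2) ^ J + s) - 1 / ((1 / 2) ^ 0 + s))"
    unfolding sum_distrib_left[symmetric] by (subst sum_lessThan_telescope) simp
  also have "\<dots> \<le> 4 / ((1 / 2) ^ J + s)" using s by simp
  finally show ?thesis by (simp add: s_def)
qed

context besov
begin

lemma test_fun_in_bounded_V: "test_fun J \<in> bounded_V"
proof -
  have "(\<lambda>z. \<Sum>j<J. (1 / 2) ^ j * (1 / (z - (1 + (1 / 2) ^ j)))) \<in> bounded_V"
  proof (induction J)
    case (Suc J)
    have n: "norm (1 + (1 / 2) ^ J :: complex) > 1"
    proof -
      have "(1 + (1 / 2) ^ J :: complex) = of_real (1 + (1 / 2) ^ J)" by simp
      then have "norm (1 + (1 / 2) ^ J :: complex) = \<bar>1 + (1 / 2) ^ J\<bar>" by (simp only: norm_of_real)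
      then show ?thesis by simp
    qed
    have "(\<lambda>z. (1 / 2) ^ J * (1 / (z - (1 + (1 / 2) ^ J)))) \<in> bounded_V"
      by (rule bounded_V_holomorphic[OF _ n]) (auto intro!: holomorphic_intros)
    with Suc show ?case by (simp add: bounded_V_add)
  qed simp
  then show ?thesis by (simp add: test_fun_def[abs_def])
qed

text \<open>At distance about 2^-k from 1 the p-th power of the derivative is O (2^(k p)), on a set
  of measure O (2^(- k (\<alpha> + 2))). By p \<le> \<alpha> + 2 every scale contributes a bounded
  amount, and J + 1 scales occur.\<close>

lemma integral_deriv_test_fun:
  assumes crit: "p \<le> \<alpha> + 2"
  shows "\<exists>C\<ge>0. \<forall>J. (\<integral>z. norm (deriv (test_fun J) z) powr p \<partial>W) \<le> C * (real J + 1)"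
proof -
  interpret finite_measure W by (rule finite_W)
  define E where "E = (\<lambda>k. ball 1 ((1 / 2) ^ k) \<inter> disc)"
  have E: "E k \<in> sets W" for k
    unfolding sets_weighted_area E_def by (auto simp: sets_restrict_space_iff)
  obtain C where C: "C \<ge> 0" "\<And>s. 0 < s \<Longrightarrow> s \<le> 1 / 2 \<Longrightarrow>
      emeasure W (ball 1 s \<inter> ball 0 1) \<le> ennreal (C * s powr (\<alpha> + 2))"
    using emeasure_weighted_area_ball[OF alpha] by blast
  define T where "T = measure W disc"
  define B where "B = 2 powr p * (C + T)"
  have B0: "B \<ge> 0" using C by (simp add: B_def T_def)
  have summand: "2 powr (real (Suc k) * p) * measure W (E k) \<le> B" for k
  proof (cases "k = 0")
    case True
    \<comment> \<open>For k = 0 the ball has radius 1, beyond the range of the area estimate, and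
      the total mass is used instead.\<close>
    have "measure W (E 0) \<le> T" unfolding T_def E_def by (intro finite_measure_mono) (use sets.top[of W] in auto)
    then have "2 powr p * measure W (E 0) \<le> 2 powr p * (C + T)" using C by (intro mult_left_mono) auto
    then show ?thesis using True by (simp add: B_def)
  next
    case False
    then have half: "(1 / 2 :: real) ^ k \<le> 1 / 2" using power_decreasing[of 1 k "1 / 2 :: real"] by simp
    have "ennreal (measure W (E k)) \<le> ennreal (C * ((1 / 2) ^ k) powr (\<alpha> + 2))"
      unfolding E_def emeasure_eq_measure[symmetric] using half by (intro C) auto
    then have "measure W (E k) \<le> C * ((1 / 2) ^ k) powr (\<alpha> + 2)" using C by (simp add: ennreal_le_iff)
    also have "((1 / 2 :: real) ^ k) powr (\<alpha> + 2) \<le> ((1 / 2) ^ k) powr p"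
      using crit by (intro powr_mono') (auto simp: power_le_one)
    finally have "measure W (E k) \<le> C * ((1 / 2) ^ k) powr p" using C by (simp add: mult_left_mono)
    then have "2 powr (real (Suc k) * p) * measure W (E k) \<le> 2 powr (real (Suc k) * p) * (C * ((1 / 2) ^ k) powr p)"
      by (intro mult_left_mono) auto
    also have "\<dots> = 2 powr p * C"
    proof -
      have "((1 / 2 :: real) ^ k) = 2 powr (- real k)"
        by (simp add: powr_minus powr_realpow power_one_over field_simps)
      then have "((1 / 2 :: real) ^ k) powr p = 2 powr (- (real k * p))" by (simp add: powr_powr)
      moreover have "2 powr (real (Suc k) * p) * 2 powr (- (real k * p)) = 2 powr p"
        by (simp add: powr_add[symmetric] algebra_simps)
      ultimately show ?thesis by (simp add: mult_ac)
    qed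
    also have "\<dots> \<le> B" unfolding B_def T_def by (intro mult_left_mono) auto
    finally show ?thesis .
  qed
  have "(\<integral>z. norm (deriv (test_fun J) z) powr p \<partial>W) \<le> (4 powr p * (T + B)) * (real J + 1)" for J
  proof -
    let ?g = "\<lambda>z. 4 powr p * (1 + (\<Sum>k\<le>J. 2 powr (real (Suc k) * p) * indicator (E k) z))"
    have ie: "integrable W (\<lambda>z. indicator (E k) z :: real)" for k
    proof -
      have "E k \<inter> space W = E k" by (auto simp: E_def)
      then show ?thesis using E[of k] by (simp add: integrable_indicator_iff emeasure_eq_measure)
    qed
    have isum: "integrable W (\<lambda>z. \<Sum>k\<le>J. 2 powr (real (Suc k) * p) * indicator (E k) z)"
      by (intro Bochner_Integration.integrable_sum integrable_mult_right ie)
    have ig: "integrable W ?g"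
      by (intro integrable_mult_right Bochner_Integration.integrable_add integrable_const_W isum)
    have "(\<integral>z. norm (deriv (test_fun J) z) powr p \<partial>W) \<le> (\<integral>z. ?g z \<partial>W)"
    proof (rule integral_mono[OF V_integrable[OF bounded_V_D[OF test_fun_in_bounded_V]] ig])
      fix z assume "z \<in> space W"
      then have z: "norm z < 1" by simp
      have s: "norm (1 - z) > 0" using z by auto
      have "norm (deriv (test_fun J) z) powr p \<le> (4 / ((1 / 2) ^ J + norm (1 - z))) powr p"
        using p deriv_test_fun_le[OF z] by (intro powr_mono2) auto
      also have "\<dots> = 4 powr p * ((1 / 2) ^ J + norm (1 - z)) powr (- p)"
        using s by (subst powr_divide) (auto simp: powr_minus_divide add_nonneg_pos)
      also have "\<dots> \<le> 4 powr p * (1 + (\<Sum>k\<le>J. 2 powr (real (Suc k) * p) * indicator {..<(1 / 2) ^ k} (norm (1 - z))))"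
        using s p by (intro mult_left_mono dyadic_powr_le') auto
      also have "\<dots> = ?g z"
      proof -
        have "indicator {..<(1 / 2) ^ k} (norm (1 - z)) = (indicator (E k) z :: real)" for k
          using z by (simp add: E_def indicator_def dist_norm)
        then show ?thesis by (simp only:)
      qed
      finally show "norm (deriv (test_fun J) z) powr p \<le> ?g z" .
    qed
    also have "\<dots> = 4 powr p * (T + (\<Sum>k\<le>J. 2 powr (real (Suc k) * p) * measure W (E k)))"
    proof -
      have "(\<integral>z. 2 powr (real (Suc k) * p) * indicator (E k) z \<partial>W) = 2 powr (real (Suc k) * p) * measure W (E k)" for k
        using sets.Int_space_eq2[OF E[of k]] by (simp del: space_weighted_area)
      moreover have "(\<integral>z. (1 :: real) \<partial>W) = T" by (simp add: T_def)
      ultimately show ?thesis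
        by (simp only: integral_mult_right_zero Bochner_Integration.integral_add[OF integrable_const_W isum]
            Bochner_Integration.integral_sum[OF integrable_mult_right[OF ie]])
    qed
    also have "\<dots> \<le> 4 powr p * (T + (\<Sum>k\<le>J. B))"
      by (intro mult_left_mono add_left_mono sum_mono summand) auto
    also have "\<dots> = 4 powr p * (T * 1 + B * (real J + 1))" by (simp add: mult.commute)
    also have "\<dots> \<le> 4 powr p * (T * (real J + 1) + B * (real J + 1))"
      using B0 by (intro mult_left_mono add_mono) (auto simp: T_def)
    also have "\<dots> = (4 powr p * (T + B)) * (real J + 1)" by (simp add: algebra_simps)
    finally show ?thesis .
  qed
  moreover have "4 powr p * (T + B) \<ge> 0" using B0 by (simp add: T_def)
  ultimately show ?thesis by blast
qed

lemma sum_norm_test_fun: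
  assumes crit: "p \<le> \<alpha> + 2"
  shows "\<exists>C\<ge>0. \<forall>J. sum_norm (test_fun J) \<le> 2 + C * (real J + 1) powr (1 / p)"
proof -
  obtain C where C: "C \<ge> 0" "\<And>J. (\<integral>z. norm (deriv (test_fun J) z) powr p \<partial>W) \<le> C * (real J + 1)"
    using integral_deriv_test_fun[OF crit] by blast
  have "sum_norm (test_fun J) \<le> 2 + C powr (1 / p) * (real J + 1) powr (1 / p)" for J
  proof -
    have "seminorm (test_fun J) \<le> (C * (real J + 1)) powr (1 / p)"
      unfolding seminorm_def Lp_norm_def using p C(2)[of J] by (intro powr_mono2) auto
    also have "\<dots> = C powr (1 / p) * (real J + 1) powr (1 / p)" by (rule powr_mult)
    finally have "seminorm (test_fun J) \<le> C powr (1 / p) * (real J + 1) powr (1 / p)" .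
    moreover have "norm (test_fun J 0) \<le> 2"
    proof -
      have "norm (test_fun J 0) \<le> (\<Sum>j<J. (1 / 2) ^ j)"
        unfolding test_fun_def
      proof (intro order_trans[OF norm_sum] sum_mono)
        fix j
        have "(1 + (1 / 2) ^ j :: complex) = of_real (1 + (1 / 2) ^ j)" by simp
        then have "norm (1 + (1 / 2) ^ j :: complex) = \<bar>1 + (1 / 2) ^ j\<bar>" by (simp only: norm_of_real)
        then have n: "norm (0 - (1 + (1 / 2) ^ j) :: complex) \<ge> 1" by (simp only: diff_0 norm_minus_cancel) simp
        then have "norm (1 / (0 - (1 + (1 / 2) ^ j)) :: complex) \<le> 1"
          unfolding norm_divide by (simp add: divide_le_eq_1)
        then have "norm ((1 / 2) ^ j :: complex) * norm (1 / (0 - (1 + (1 / 2) ^ j)) :: complex) \<le> (1 / 2) ^ j * 1"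
          by (intro mult_mono) (auto simp: norm_power)
        then show "norm ((1 / 2) ^ j * (1 / (0 - (1 + (1 / 2) ^ j))) :: complex) \<le> (1 / 2) ^ j"
          by (simp only: norm_mult mult_1_right)
      qed
      also have "\<dots> = 2 - 2 * (1 / 2) ^ J" by (subst geometric_sum) auto
      also have "\<dots> \<le> 2" by simp
      finally show ?thesis .
    qed
    ultimately show ?thesis by (simp add: sum_norm_def)
  qed
  then show ?thesis by (intro exI[of _ "C powr (1 / p)"]) auto
qed

end

section \<open>Vanishing of F and of the annihilating functional\<close>

context boundary_zero
begin

lemma L_test_fun: "L (test_fun J) = (\<Sum>j<J. (1 / 2) ^ j * F (2 ^ j))"
proof -
  have "L (\<lambda>z. \<Sum>j<J. (1 / 2) ^ j * (1 / (z - (1 + (1 / 2) ^ j)))) = (\<Sum>j<J. (1 / 2) ^ j * F (2 ^ j))"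
  proof (induction J)
    case 0
    have "L (\<lambda>z. 0) = 0" using L_scale[OF zero, of 0] by simp
    then show ?case by simp
  next
    case (Suc J)
    have n: "norm (1 + (1 / 2) ^ J :: complex) > 1"
    proof -
      have "(1 + (1 / 2) ^ J :: complex) = of_real (1 + (1 / 2) ^ J)" by simp
      then have "norm (1 + (1 / 2) ^ J :: complex) = \<bar>1 + (1 / 2) ^ J\<bar>" by (simp only: norm_of_real)
      then show ?thesis by simp
    qed
    note inv = inverse_mod_outside(1)[OF n]
    have B: "(\<lambda>z. 1 / (z - (1 + (1 / 2) ^ J))) \<in> V"
      using inv bounded_V_D by (simp add: inverse_mod_def)
    have "F (2 ^ J) = Phi (1 + (1 / 2) ^ J)" by (simp add: F_def power_one_over)
    then have "F (2 ^ J) = L (\<lambda>z. 1 / (z - (1 + (1 / 2) ^ J)))" using Phi_eq[OF inv] by simp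
    then have "L (\<lambda>z. (1 / 2) ^ J * (1 / (z - (1 + (1 / 2) ^ J)))) = (1 / 2) ^ J * F (2 ^ J)"
      using L_scale[OF B, of "(1 / 2) ^ J"] by simp
    moreover have "(\<lambda>z. \<Sum>j<J. (1 / 2) ^ j * (1 / (z - (1 + (1 / 2) ^ j)))) \<in> V"
      using bounded_V_D[OF test_fun_in_bounded_V[of J]] by (simp add: test_fun_def[abs_def])
    ultimately show ?case
      using Suc L_add[OF _ scale[OF B, of "(1 / 2) ^ J"]] by simp
  qed
  then show ?thesis by (simp add: test_fun_def[abs_def])
qed

text \<open>The values \<Sum> 2^-j F (2^j) of \<open>L\<close> on the test functions are O
  (J^(1/p)). Their consecutive differences 2^-J F (2^J) are thus of at most polynomial size in J,
  which removes the degrees 2 to 4, and F 0 = 0 removes the constant term. What remains is J a1 = O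
  (J^(1/p)), and p > 1 forces a1 = 0.\<close>

lemma F_zero:
  assumes crit: "p \<le> \<alpha> + 2"
  shows "F w = 0"
proof -
  obtain a where a: "\<And>w. F w = (\<Sum>k\<le>4. a k * w ^ k)" using F_polynomial by blast
  have "a 0 = F 0"
    unfolding a by (subst sum.remove[of _ 0]) (auto simp: power_0_left intro!: sum.neutral)
  then have a0: "a 0 = 0" by (simp add: F_def)
  have Fa: "F w = a 1 * w + a 2 * w\<^sup>2 + a 3 * w ^ 3 + a 4 * w ^ 4" for w
    unfolding a using a0 by (simp add: eval_nat_numeral)
  define S where "S = (\<lambda>J. \<Sum>j<J. (1 / 2) ^ j * F (2 ^ j))"
  obtain C where C: "C \<ge> 0" "\<And>J. sum_norm (test_fun J) \<le> 2 + C * (real J + 1) powr (1 / p)"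
    using sum_norm_test_fun[OF crit] by blast
  define B where "B = (\<lambda>J. 2 * (2 + C * (real J + 1) powr (1 / p)))"
  have SB: "norm (S J) \<le> B J" for J
    unfolding S_def L_test_fun[symmetric] B_def
    using L_bound[OF bounded_V_D[OF test_fun_in_bounded_V[of J]]] C(2)[of J] by argo
  define q where "q = (\<lambda>J. (1 / 2) ^ J * F (2 ^ J))"
  have q: "q J = a 1 + a 2 * 2 ^ J + a 3 * (2 ^ J)\<^sup>2 + a 4 * (2 ^ J) ^ 3" for J
    unfolding q_def Fa by (simp add: field_simps power2_eq_square power3_eq_cube eval_nat_numeral power_one_over)
  have qS: "q J = S (Suc J) - S J" for J by (simp add: q_def S_def)
  have qB: "norm (q J) \<le> B (Suc J) + B J" for J
    unfolding qS using SB[of J] SB[of "Suc J"] by (intro norm_triangle_le_diff) linarith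
  have e: "0 < 1 / p" "1 / p < 1" using p by auto
  have lim0: "(\<lambda>J. q J / 2 ^ (n * J)) \<longlonglongrightarrow> 0" if n: "n \<ge> 1" for n
  proof (rule Lim_null_comparison)
    show "eventually (\<lambda>J. norm (q J / 2 ^ (n * J)) \<le> (B (Suc J) + B J) / 2 ^ J) sequentially"
    proof (rule always_eventually, rule allI)
      fix J
      have "(2 :: real) ^ J \<le> 2 ^ (n * J)" using n by (intro power_increasing) auto
      then show "norm (q J / 2 ^ (n * J)) \<le> (B (Suc J) + B J) / 2 ^ J"
        unfolding norm_divide using qB[of J] by (intro frac_le) (auto simp: norm_power intro: order_trans[OF norm_ge_zero])
    qed
    have "(\<lambda>J. (2 * (2 + C * (real (Suc J) + 1) powr (1 / p)) + 2 * (2 + C * (real J + 1) powr (1 / p))) / 2 ^ J) \<longlonglongrightarrow> 0"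
      using e by real_asymp
    then show "(\<lambda>J. (B (Suc J) + B J) / 2 ^ J) \<longlonglongrightarrow> 0" by (simp add: B_def)
  qed
  have a4: "a 4 = 0"
  proof -
    have "(\<lambda>J. a 1 * (1 / 8) ^ J + a 2 * (1 / 4) ^ J + a 3 * (1 / 2) ^ J + a 4) \<longlonglongrightarrow> a 1 * 0 + a 2 * 0 + a 3 * 0 + a 4"
      by (intro tendsto_intros LIMSEQ_power_zero) (auto simp: norm_divide)
    moreover have "a 1 * (1 / 8) ^ J + a 2 * (1 / 4) ^ J + a 3 * (1 / 2) ^ J + a 4 = q J / 2 ^ (3 * J)" for J
    proof -
      define y :: complex where "y = 2 ^ J"
      have y: "y \<noteq> 0" by (simp add: y_def)
      have p8: "(1 / 8 :: complex) ^ J = 1 / y ^ 3" "(1 / 4 :: complex) ^ J = 1 / y\<^sup>2" "(1 / 2 :: complex) ^ J = 1 / y"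
        "(2 :: complex) ^ (3 * J) = y ^ 3"
        using power_mult[of "2 :: complex" 3 J] power_mult[of "2 :: complex" J 3]
          power_mult[of "2 :: complex" 2 J] power_mult[of "2 :: complex" J 2]
        by (simp_all add: y_def power_one_over mult.commute)
      show ?thesis
        unfolding q p8 y_def[symmetric] using y by (simp add: field_simps power2_eq_square power3_eq_cube)
    qed
    ultimately show ?thesis
      using LIMSEQ_unique[OF lim0[of 3]] by simp
  qed
  have a3: "a 3 = 0"
  proof -
    have "(\<lambda>J. a 1 * (1 / 4) ^ J + a 2 * (1 / 2) ^ J + a 3) \<longlonglongrightarrow> a 1 * 0 + a 2 * 0 + a 3"
      by (intro tendsto_intros LIMSEQ_power_zero) (auto simp: norm_divide)
    moreover have "a 1 * (1 / 4) ^ J + a 2 * (1 / 2) ^ J + a 3 = q J / 2 ^ (2 * J)" for J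
    proof -
      define y :: complex where "y = 2 ^ J"
      have y: "y \<noteq> 0" by (simp add: y_def)
      have p4: "(1 / 4 :: complex) ^ J = 1 / y\<^sup>2" "(1 / 2 :: complex) ^ J = 1 / y"
        "(2 :: complex) ^ (2 * J) = y\<^sup>2"
        using power_mult[of "2 :: complex" 2 J] power_mult[of "2 :: complex" J 2]
        by (simp_all add: y_def power_one_over mult.commute)
      show ?thesis
        unfolding q p4 y_def[symmetric] a4 using y by (simp add: field_simps power2_eq_square)
    qed
    ultimately show ?thesis
      using LIMSEQ_unique[OF lim0[of 2]] by simp
  qed
  have a2: "a 2 = 0"
  proof -
    have "(\<lambda>J. a 1 * (1 / 2) ^ J + a 2) \<longlonglongrightarrow> a 1 * 0 + a 2"
      by (intro tendsto_intros LIMSEQ_power_zero) (auto simp: norm_divide)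
    moreover have "a 1 * (1 / 2) ^ J + a 2 = q J / 2 ^ (1 * J)" for J
      unfolding q a4 a3 by (simp add: field_simps power_one_over)
    ultimately show ?thesis
      using LIMSEQ_unique[OF lim0[of 1]] by simp
  qed
  have a1: "a 1 = 0"
  proof -
    have "S J = of_nat J * a 1" for J
      unfolding S_def q_def[symmetric] q a2 a3 a4 by simp
    then have "norm (a 1) \<le> B (Suc J) / real (Suc J)" for J
      using SB[of "Suc J"] by (simp add: norm_mult field_simps del: of_nat_Suc)
    moreover have "(\<lambda>J. (2 * (2 + C * (real (Suc J) + 1) powr (1 / p))) / real (Suc J)) \<longlonglongrightarrow> 0"
      using e by real_asymp
    ultimately have "norm (a 1) \<le> 0"
      unfolding B_def by (intro LIMSEQ_le_const) auto
    then show ?thesis by simp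
  qed
  show ?thesis unfolding Fa a1 a2 a3 a4 by simp
qed

text \<open>F = 0 says that \<open>L\<close> annihilates the Cauchy kernels 1 / (1 - \<mu> z).
  Letting \<mu> tend to 0 in z^n / (1 - \<mu> z) = z^n + \<mu> z^(n+1) / (1 - \<mu> z) gives L (z^n)
  = 0, and dividing by \<mu> passes to n + 1.\<close>

lemma L_monomial:
  assumes crit: "p \<le> \<alpha> + 2"
  shows "L (\<lambda>z. z ^ n) = 0"
proof -
  have ne: "1 - \<mu> * z \<noteq> 0" if "norm \<mu> < 1" "z \<in> disc" for \<mu> z :: complex
  proof
    assume "1 - \<mu> * z = 0"
    then have "norm \<mu> * norm z = 1" by (metis norm_mult norm_one right_minus_eq)
    moreover have "norm \<mu> * norm z \<le> norm \<mu> * 1" using that by (intro mult_left_mono) auto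
    ultimately show False using that by simp
  qed
  have hB: "(\<lambda>z. z ^ n / (1 - \<mu> * z)) \<in> bounded_V" if \<mu>: "0 < norm \<mu>" "norm \<mu> < 1" for \<mu> n
  proof (rule bounded_V_holomorphic[of _ "1 / norm \<mu>"])
    show "(\<lambda>z. z ^ n / (1 - \<mu> * z)) holomorphic_on ball 0 (1 / norm \<mu>)"
    proof (intro holomorphic_intros)
      fix z :: complex assume "z \<in> ball 0 (1 / norm \<mu>)"
      then have "norm (\<mu> * z) < 1" using \<mu> by (simp add: norm_mult field_simps)
      then show "1 - \<mu> * z \<noteq> 0" by auto
    qed
  qed (use \<mu> in \<open>simp add: field_simps\<close>)
  have zB: "(\<lambda>z. z ^ n) \<in> V" for n
    by (intro bounded_V_D bounded_V_holomorphic[of _ 2] holomorphic_intros) auto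
  have step: "L (\<lambda>z. z ^ n / (1 - \<mu> * z)) = L (\<lambda>z. z ^ n) + \<mu> * L (\<lambda>z. z ^ Suc n / (1 - \<mu> * z))"
    if \<mu>: "0 < norm \<mu>" "norm \<mu> < 1" for \<mu> n
  proof -
    have "z ^ n / (1 - \<mu> * z) = z ^ n + \<mu> * (z ^ Suc n / (1 - \<mu> * z))" if "z \<in> disc" for z
      using ne[OF \<mu>(2) that] by (simp add: field_simps)
    then have "L (\<lambda>z. z ^ n / (1 - \<mu> * z)) = L (\<lambda>z. z ^ n + \<mu> * (z ^ Suc n / (1 - \<mu> * z)))"
      by (intro L_cong bounded_V_D hB \<mu>)
    also have "\<dots> = L (\<lambda>z. z ^ n) + \<mu> * L (\<lambda>z. z ^ Suc n / (1 - \<mu> * z))"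
      using L_add[OF zB scale[OF bounded_V_D[OF hB[OF \<mu>, of "Suc n"]], of \<mu>]]
        L_scale[OF bounded_V_D[OF hB[OF \<mu>, of "Suc n"]]] by simp
    finally show ?thesis .
  qed
  \<comment> \<open>The limit \<mu> \<rightarrow> 0 rests on a bound uniform in \<mu>; for |\<mu>|
    \<le> 1/2 the denominator is at least 1/2 in modulus on the disc.\<close>
  have bound: "norm (L (\<lambda>z. z ^ Suc n / (1 - \<mu> * z))) \<le> 2 * ((2 * real (Suc n) + 4) * mass)"
    if \<mu>: "0 < norm \<mu>" "norm \<mu> \<le> 1 / 2" for \<mu> n
  proof -
    have \<mu>1: "norm \<mu> < 1" using \<mu> by simp
    let ?h = "\<lambda>z. z ^ Suc n / (1 - \<mu> * z)"
    have "norm (deriv ?h z) \<le> 2 * real (Suc n) + 4" if z: "z \<in> disc" for z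
    proof -
      have n0: "1 - \<mu> * z \<noteq> 0" by (rule ne[OF \<mu>1 z])
      have "norm (\<mu> * z) \<le> 1 / 2 * 1" unfolding norm_mult using \<mu> z by (intro mult_mono) auto
      then have h2: "1 / 2 \<le> norm (1 - \<mu> * z)" using norm_triangle_ineq2[of 1 "\<mu> * z"] by simp
      then have i2: "norm (1 / (1 - \<mu> * z)) \<le> 2" using n0 by (simp add: norm_divide pos_divide_le_eq)
      have "(?h has_field_derivative (of_nat (Suc n) * z ^ n * (1 / (1 - \<mu> * z)) + \<mu> * z ^ Suc n * (1 / (1 - \<mu> * z))\<^sup>2)) (at z)"
      proof -
        have d1: "((\<lambda>z. z ^ Suc n) has_field_derivative of_nat (Suc n) * z ^ n) (at z)"
          by (rule DERIV_cong[OF DERIV_power[OF DERIV_ident]]) simp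
        have d2: "((\<lambda>z. 1 - \<mu> * z) has_field_derivative - \<mu>) (at z)"
          by (auto intro!: derivative_eq_intros)
        have "(D * w - P * - \<mu>) / (w * w) = D * (1 / w) + \<mu> * P * (1 / w)\<^sup>2" if "w \<noteq> 0" for D w P
          using that by (simp add: field_simps power2_eq_square)
        then show ?thesis using DERIV_divide[OF d1 d2 n0] n0 by metis
      qed
      then have "deriv ?h z = of_nat (Suc n) * z ^ n * (1 / (1 - \<mu> * z)) + \<mu> * z ^ Suc n * (1 / (1 - \<mu> * z))\<^sup>2"
        by (rule DERIV_imp_deriv)
      also have "norm \<dots> \<le> real (Suc n) * 1 * 2 + 1 * 1 * 2\<^sup>2"
      proof (rule norm_triangle_mono)
        have zn: "norm z ^ k \<le> 1" for k using z by (intro power_le_one) auto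
        show "norm (of_nat (Suc n) * z ^ n * (1 / (1 - \<mu> * z))) \<le> real (Suc n) * 1 * 2"
          unfolding norm_mult norm_power norm_of_nat using i2 zn by (intro mult_mono) auto
        show "norm (\<mu> * z ^ Suc n * (1 / (1 - \<mu> * z))\<^sup>2) \<le> 1 * 1 * 2\<^sup>2"
          unfolding norm_mult norm_power using i2 zn[of "Suc n"] \<mu> by (intro mult_mono power_mono) auto
      qed
      finally show ?thesis by simp
    qed
    then have "seminorm ?h \<le> (2 * real (Suc n) + 4) * mass"
      by (intro V_bounded_deriv(2) V_holomorphic bounded_V_D hB \<mu> \<mu>1) auto
    then have "sum_norm ?h \<le> (2 * real (Suc n) + 4) * mass" by (simp add: sum_norm_def)
    then show ?thesis using L_bound[OF bounded_V_D[OF hB[OF \<mu>(1) \<mu>1]], of "Suc n"] by linarith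
  qed
  have limit: "L (\<lambda>z. z ^ n) = 0" if 0: "\<And>\<mu>. 0 < norm \<mu> \<Longrightarrow> norm \<mu> < 1 \<Longrightarrow> L (\<lambda>z. z ^ n / (1 - \<mu> * z)) = 0" for n
  proof -
    define K where "K = 2 * ((2 * real (Suc n) + 4) * mass)"
    have "norm (L (\<lambda>z. z ^ n)) \<le> inverse (real (Suc (Suc j))) * K" for j
    proof -
      \<comment> \<open>The value 1 / (j + 2) stays within the range |\<mu>| \<le> 1/2 of the
        uniform bound from j = 0 on.\<close>
      define \<mu> :: complex where "\<mu> = of_real (inverse (real (Suc (Suc j))))"
      have n\<mu>: "norm \<mu> = inverse (real (Suc (Suc j)))" unfolding \<mu>_def norm_of_real by simp
      have \<mu>: "0 < norm \<mu>" "norm \<mu> \<le> 1 / 2" unfolding n\<mu> by (auto simp: field_simps)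
      then have "norm \<mu> < 1" by linarith
      then have "L (\<lambda>z. z ^ n) = - (\<mu> * L (\<lambda>z. z ^ Suc n / (1 - \<mu> * z)))"
        using step[OF \<mu>(1), of n] 0[OF \<mu>(1)] by (simp add: eq_neg_iff_add_eq_0)
      then have "norm (L (\<lambda>z. z ^ n)) = norm \<mu> * norm (L (\<lambda>z. z ^ Suc n / (1 - \<mu> * z)))"
        by (simp only: norm_minus_cancel norm_mult)
      also have "\<dots> \<le> norm \<mu> * K" unfolding K_def by (intro mult_left_mono bound \<mu>) auto
      finally show ?thesis unfolding n\<mu> .
    qed
    moreover have "(\<lambda>j. inverse (real (Suc (Suc j))) * K) \<longlonglongrightarrow> 0 * K"
      by (intro tendsto_intros LIMSEQ_Suc[OF LIMSEQ_inverse_real_of_nat])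
    ultimately have "norm (L (\<lambda>z. z ^ n)) \<le> 0"
      by (intro LIMSEQ_le_const[of "\<lambda>j. inverse (real (Suc (Suc j))) * K"]) auto
    then show ?thesis by simp
  qed
  have all: "L (\<lambda>z. z ^ n / (1 - \<mu> * z)) = 0" if "0 < norm \<mu>" "norm \<mu> < 1" for \<mu> n
    using that
  proof (induction n arbitrary: \<mu>)
    case 0
    define l where "l = 1 / \<mu>"
    have \<mu>0: "\<mu> \<noteq> 0" using 0 by auto
    have l: "norm l > 1" using 0 by (simp add: l_def norm_divide)
    have "l \<noteq> 1" using l by auto
    then have "Phi l = F (1 / (l - 1))" by (simp add: F_def)
    then have "L (\<lambda>z. 1 / (z - l)) = 0" using F_zero[OF crit] Phi_eq[OF inverse_mod_outside(1)[OF l]] by simp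
    then have "L (\<lambda>z. (- l) * (1 / (z - l))) = 0"
      using L_scale[of "\<lambda>z. 1 / (z - l)" "- l"] inverse_mod_outside(1)[OF l] bounded_V_D
      by (simp add: inverse_mod_def)
    moreover have "L (\<lambda>z. z ^ 0 / (1 - \<mu> * z)) = L (\<lambda>z. (- l) * (1 / (z - l)))"
    proof (rule L_cong[OF bounded_V_D[OF hB[OF 0]]])
      fix z assume z: "z \<in> disc"
      have "(1 - \<mu> * z) = (z - l) * (- \<mu>)" using \<mu>0 by (simp add: l_def field_simps)
      then show "z ^ 0 / (1 - \<mu> * z) = (- l) * (1 / (z - l))" using \<mu>0 by (simp add: l_def)
    qed
    ultimately show ?case by simp
  next
    case (Suc n)
    have "L (\<lambda>z. z ^ n) = 0" by (rule limit[OF Suc.IH])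
    then have "\<mu> * L (\<lambda>z. z ^ Suc n / (1 - \<mu> * z)) = 0"
      using step[OF Suc.prems, of n] Suc.IH[OF Suc.prems] by simp
    then show ?case using Suc.prems by auto
  qed
  show ?thesis by (rule limit[OF all])
qed

text \<open>By continuity of \<open>L\<close>, since the Fejer means of h are polynomials that
  converge to h in norm.\<close>

lemma L_zero:
  assumes crit: "p \<le> \<alpha> + 2" and h: "h \<in> V"
  shows "L h = 0"
proof -
  have zV: "(\<lambda>z. c * z ^ k) \<in> V" for c k
    by (intro bounded_V_D bounded_V_holomorphic[of _ 2] holomorphic_intros) auto
  have poly: "L (\<lambda>z. \<Sum>k<n. c k * z ^ k) = 0 \<and> (\<lambda>z. \<Sum>k<n. c k * z ^ k) \<in> V" for n :: nat and c
  proof (induction n)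
    case 0
    then show ?case using L_scale[OF zero, of 0] zero by simp
  next
    case (Suc n)
    have "L (\<lambda>z. c n * z ^ n) = 0"
      using L_scale[of "\<lambda>z. z ^ n" "c n"] zV[of 1 n] L_monomial[OF crit, of n] by simp
    then show ?case using Suc L_add[OF _ zV] add[OF _ zV] by simp
  qed
  have fz: "L (fejer n h) = 0" for n
    using poly[where n = n and c = "\<lambda>k. of_nat (n - k) / of_nat n * taylor_coeff h k"]
    by (simp add: fejer_def[abs_def] mult.assoc)
  have "norm (L h) \<le> 2 * sum_norm (\<lambda>z. fejer (Suc n) h z - h z)" for n
  proof -
    have fV: "fejer (Suc n) h \<in> V" by (rule bounded_V_D[OF fejer_in_bounded_V])
    have "norm (L (\<lambda>z. fejer (Suc n) h z - h z)) \<le> 2 * sum_norm (\<lambda>z. fejer (Suc n) h z - h z)"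
      by (intro L_bound diff fV h)
    then show ?thesis using L_diff[OF fV h] fz by simp
  qed
  moreover have "(\<lambda>n. 2 * sum_norm (\<lambda>z. fejer (Suc n) h z - h z)) \<longlonglongrightarrow> 2 * 0"
    by (intro tendsto_mult tendsto_const sum_norm_fejer_diff_tendsto h)
  ultimately have "norm (L h) \<le> 0"
    by (intro LIMSEQ_le_const[of "\<lambda>n. 2 * sum_norm (\<lambda>z. fejer (Suc n) h z - h z)"]) auto
  then show ?thesis by simp
qed

end

section \<open>Separation of a function from a closed subspace, and cyclicity\<close>

context besov
begin

text \<open>Hahn-Banach is applied to the distance q to M, a seminorm that vanishes on M: a
  functional bounded by 2 q annihilates M automatically, and closedness of M makes q g0
  positive.\<close>

lemma separating_functional:
  assumes M: "closed_subspace p \<alpha> M" and g0: "g0 \<in> V" "g0 \<notin> M"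
  shows "\<exists>L :: (complex \<Rightarrow> complex) \<Rightarrow> complex.
    (\<forall>g\<in>V. \<forall>h\<in>V. L (\<lambda>z. g z + h z) = L g + L h) \<and>
    (\<forall>c. \<forall>g\<in>V. L (\<lambda>z. c * g z) = c * L g) \<and>
    (\<forall>g\<in>V. norm (L g) \<le> 2 * sum_norm g) \<and> (\<forall>m\<in>M. L m = 0) \<and> L g0 \<noteq> 0"
proof -
  define q where "q = (\<lambda>g. INF m\<in>M. sum_norm (\<lambda>z. g z - m z))"
  have M0: "(\<lambda>z. 0) \<in> M" using M by (simp add: closed_subspace_def)
  then have ne: "M \<noteq> {}" by auto
  have bdd: "bdd_below ((\<lambda>m. sum_norm (\<lambda>z. g z - m z)) ` M)" for g
    by (rule bdd_belowI2[of _ 0]) simp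
  have q_le: "q g \<le> sum_norm (\<lambda>z. g z - m z)" if "m \<in> M" for g m
    unfolding q_def by (rule cINF_lower[OF bdd that])
  have q_ge: "c \<le> q g" if "\<And>m. m \<in> M \<Longrightarrow> c \<le> sum_norm (\<lambda>z. g z - m z)" for g c
    unfolding q_def by (rule cINF_greatest[OF ne that])
  have q0: "q g \<ge> 0" for g by (rule q_ge) simp
  have MV: "m \<in> V" if "m \<in> M" for m by (rule closed_subspace_V[OF M that])
  have qadd: "q (\<lambda>z. g z + h z) \<le> q g + q h" if gh: "g \<in> V" "h \<in> V" for g h
  proof -
    have le: "q (\<lambda>z. g z + h z) \<le> sum_norm (\<lambda>z. g z - m z) + sum_norm (\<lambda>z. h z - n z)" if mn: "m \<in> M" "n \<in> M" for m n
    proof -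
      have "q (\<lambda>z. g z + h z) \<le> sum_norm (\<lambda>z. (g z + h z) - (m z + n z))"
        by (rule q_le[OF closed_subspace_add[OF M mn]])
      also have "(\<lambda>z. (g z + h z) - (m z + n z)) = (\<lambda>z. (g z - m z) + (h z - n z))" by auto
      also have "sum_norm \<dots> \<le> sum_norm (\<lambda>z. g z - m z) + sum_norm (\<lambda>z. h z - n z)"
        using gh mn MV by (intro sum_norm_add diff)
      finally show ?thesis .
    qed
    have "q (\<lambda>z. g z + h z) - q h \<le> sum_norm (\<lambda>z. g z - m z)" if m: "m \<in> M" for m
    proof -
      have "q (\<lambda>z. g z + h z) - sum_norm (\<lambda>z. g z - m z) \<le> q h"
        using le[OF m] by (intro q_ge) (simp add: algebra_simps)
      then show ?thesis by linarith
    qed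
    then have "q (\<lambda>z. g z + h z) - q h \<le> q g" by (rule q_ge)
    then show ?thesis by linarith
  qed
  have qsc_le: "q (\<lambda>z. c * g z) \<le> norm c * q g" if g: "g \<in> V" and c: "c \<noteq> 0" for c g
  proof -
    have "q (\<lambda>z. c * g z) / norm c \<le> sum_norm (\<lambda>z. g z - m z)" if m: "m \<in> M" for m
    proof -
      have "q (\<lambda>z. c * g z) \<le> sum_norm (\<lambda>z. c * g z - c * m z)"
        by (rule q_le[OF closed_subspace_scale[OF M m]])
      also have "\<dots> = norm c * sum_norm (\<lambda>z. g z - m z)"
        using sum_norm_scale[OF diff[OF g MV[OF m]], of c] by (simp add: right_diff_distrib)
      finally show ?thesis using c by (simp add: field_simps)
    qed
    then have "q (\<lambda>z. c * g z) / norm c \<le> q g" by (rule q_ge)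
    then show ?thesis using c by (simp add: field_simps)
  qed
  have qM: "q m = 0" if "m \<in> M" for m
  proof -
    have "q m \<le> sum_norm (\<lambda>z. m z - m z)" by (rule q_le[OF that])
    also have "\<dots> = 0" using sum_norm_scale[OF zero, of 0] by simp
    finally show ?thesis using q0[of m] by linarith
  qed
  have qsc: "q (\<lambda>z. c * g z) = norm c * q g" if g: "g \<in> V" for c g
  proof (cases "c = 0")
    case True
    then show ?thesis using qM[OF M0] by simp
  next
    case False
    have "q g = q (\<lambda>z. (1 / c) * (c * g z))" using False by simp
    also have "\<dots> \<le> norm (1 / c) * q (\<lambda>z. c * g z)"
      using False g by (intro qsc_le scale) auto
    finally have "norm c * q g \<le> q (\<lambda>z. c * g z)" using False by (simp add: norm_divide field_simps)
    then show ?thesis using qsc_le[OF g False] by linarith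
  qed
  have q_sum: "q g \<le> sum_norm g" for g using q_le[OF M0, of g] by simp
  have qpos: "q g0 > 0"
  proof (rule ccontr)
    assume "\<not> q g0 > 0"
    then have "q g0 < inverse (real (Suc n))" for n
      using q0[of g0] by (simp add: less_le_trans[of _ 0] le_less_trans[of "q g0" 0])
    then have "\<exists>m\<in>M. sum_norm (\<lambda>z. g0 z - m z) < inverse (real (Suc n))" for n
      using cINF_less_iff[OF ne bdd] unfolding q_def by blast
    then obtain m where m: "\<And>n. m n \<in> M" "\<And>n. sum_norm (\<lambda>z. g0 z - m n z) < inverse (real (Suc n))"
      by metis
    have sw: "sum_norm (\<lambda>z. m n z - g0 z) = sum_norm (\<lambda>z. g0 z - m n z)" for n
      using sum_norm_scale[OF diff[OF g0(1) MV[OF m(1)]], of "-1" n] by simp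
    have "(\<lambda>n. sum_norm (\<lambda>z. m n z - g0 z)) \<longlonglongrightarrow> 0"
    proof (rule tendsto_sandwich[OF _ _ tendsto_const LIMSEQ_inverse_real_of_nat])
      show "eventually (\<lambda>n. sum_norm (\<lambda>z. m n z - g0 z) \<le> inverse (real (Suc n))) sequentially"
        unfolding sw using m(2) by (intro always_eventually allI less_imp_le)
    qed simp
    then have "g0 \<in> M" by (rule closed_subspace_limit[OF M g0(1) m(1)])
    then show False using g0 by simp
  qed
  obtain L :: "(complex \<Rightarrow> complex) \<Rightarrow> complex" where
    L: "\<forall>g\<in>V. \<forall>h\<in>V. L (\<lambda>z. g z + h z) = L g + L h" "\<forall>c. \<forall>g\<in>V. L (\<lambda>z. c * g z) = c * L g"
       "\<forall>g\<in>V. norm (L g) \<le> 2 * q g" "q g0 \<le> norm (L g0)"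
    using hahn_banach[of q g0, OF qadd qsc g0(1)] by blast
  have "\<forall>g\<in>V. norm (L g) \<le> 2 * sum_norm g"
  proof
    fix g assume "g \<in> V"
    then have "norm (L g) \<le> 2 * q g" using L(3) by blast
    then show "norm (L g) \<le> 2 * sum_norm g" using q_sum[of g] by linarith
  qed
  moreover have "\<forall>m\<in>M. L m = 0"
  proof
    fix m assume m: "m \<in> M"
    then have "norm (L m) \<le> 2 * q m" using L(3) MV by blast
    then show "L m = 0" using qM[OF m] by simp
  qed
  moreover have "L g0 \<noteq> 0" using L(4) qpos by auto
  ultimately show ?thesis using L(1,2) by blast
qed

end

theorem theorem1:
  fixes \<alpha> p :: real and f :: "complex \<Rightarrow> complex"
  assumes "\<alpha> > -1" and "p > 1"
    and "\<alpha> + 1 \<le> p" and "p \<le> \<alpha> + 2"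
    and "f \<in> besov_dirichlet p \<alpha> \<inter> disc_algebra"
    and "outer f"
    and "circle_zeros f = {1}"
  shows "cyclic p \<alpha> f"
proof -
  interpret besov p \<alpha> by unfold_locales fact+
  have fV: "f \<in> V" and cont: "continuous_on (cball 0 1) f"
    using assms(5) by (auto simp: disc_algebra_def)
  have "bounded (f ` cball 0 1)"
    using cont by (intro compact_imp_bounded compact_continuous_image) auto
  then obtain K where "\<And>z. z \<in> cball 0 1 \<Longrightarrow> norm (f z) \<le> K" unfolding bounded_iff by blast
  then have fB: "f \<in> bounded_V" by (intro bounded_V_I[OF fV, of K]) auto
  have low: "\<exists>C. \<forall>z. norm z < 1 \<longrightarrow> exp (- C - \<epsilon> / (1 - norm z)) \<le> norm (f z)" if "\<epsilon> > 0" for \<epsilon>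
    by (rule outer_lower_bound[OF assms(6) that])
  obtain C where C: "\<And>z. norm z < 1 \<Longrightarrow> exp (- C - 1 / (1 - norm z)) \<le> norm (f z)"
    using low[of 1] by auto
  \<comment> \<open>The exponential lower bound excludes zeros inside the disc, and the hypothesis
    on the boundary zeros excludes the rest of the circle.\<close>
  have nz: "f z \<noteq> 0" if "z \<in> cball 0 1" "z \<noteq> 1" for z
  proof (cases "norm z < 1")
    case True
    then show ?thesis using C[OF True] by (metis exp_gt_zero leD norm_zero)
  next
    case False
    then have "z \<in> sphere 0 1" using that by simp
    then show ?thesis using assms(7) that by (auto simp: circle_zeros_def)
  qed
  \<comment> \<open>The generated subspace is an intersection, so each g0 has to be found in every
    closed invariant M containing f; a functional separating g0 from one such M would satisfy all
    assumptions of \<open>boundary_zero\<close> and hence vanish.\<close>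
  have "g0 \<in> M" if g0: "g0 \<in> V" and M: "closed_subspace p \<alpha> M" "shift ` M \<subseteq> M" "f \<in> M" for g0 M
  proof (rule ccontr)
    assume "g0 \<notin> M"
    then obtain L :: "(complex \<Rightarrow> complex) \<Rightarrow> complex" where
      L: "\<forall>g\<in>V. \<forall>h\<in>V. L (\<lambda>z. g z + h z) = L g + L h" "\<forall>c. \<forall>g\<in>V. L (\<lambda>z. c * g z) = c * L g"
         "\<forall>g\<in>V. norm (L g) \<le> 2 * sum_norm g" "\<forall>m\<in>M. L m = 0" "L g0 \<noteq> 0"
      using separating_functional[OF M(1) g0] by blast
    interpret boundary_zero p \<alpha> f L
    proof unfold_locales
      show "L (\<lambda>z. f z * h z) = 0" if "h \<in> bounded_V" for h
        using L(4) mult_in_invariant_subspace[OF M fB that] by blast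
    qed (use L fB cont nz low in auto)
    show False using L_zero[OF assms(4) g0] L(5) by simp
  qed
  then have "V \<subseteq> generated_invariant_subspace p \<alpha> f"
    unfolding generated_invariant_subspace_def by blast
  then show ?thesis
    unfolding cyclic_def generated_invariant_subspace_def by blast
qed

end
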